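(* Let $G$ be a group, let $(B,\Delta)$ be a regular $G$-cograded multiplier Hopf algebra, so that as an algebra $B=\bigoplus_{p\in G}B_p$, with counit $\varepsilon$ and antipode $S$. Assume that $\pi$ is an admissible action of $G$ on $B$, and let $\widetilde{\Delta}:B\to M(B\otimes B)$ be the deformed comultiplication determined by $\widetilde{\Delta}(b)(1\otimes b')=(\pi_{q^{-1}}\otimes\iota)(\Delta(b)(1\otimes b'))$ and $(1\otimes b')\widetilde{\Delta}(b)=(\pi_{q^{-1}}\otimes\iota)((1\otimes b')\Delta(b))$ for $b\in B$, $b'\in B_q$, $q\in G$. Then: (1) $(B,\widetilde{\Delta})$ (with the same algebra structure on $B$) is a regular multiplier Hopf algebra. The counit $\widetilde{\varepsilon}$ is the original counit $\varepsilon$. The antipode $\widetilde{S}$ is given by $\widetilde{S}(b)=\pi_{p^{-1}}(S(b))$ for $b\in B_p$. (2) If $B$ is a $G$-cograded multiplier Hopf $^*$-algebra, then $(B,\widetilde{\Delta})$ is again a multiplier Hopf $^*$-algebra. (3) If $\varphi$ is a left integral on $B$, then $\varphi$ is also a left integral on $(B,\widetilde{\Delta})$. However, if $\psi$ is a right integral on $B$, it is in general not right invariant on $(B,\widetilde{\Delta})$; it has to be modified. For $b\in B_p$, define $\widetilde{\psi}(b)=\psi(\pi_{p^{-1}}(b))$. Then $\widetilde{\psi}$ is a right integral on $(B,\widetilde{\Delta})$. In the $^*$-case, a positive left integral on $B$ is again a positive left integral on $(B,\widetilde{\Delta})$, and a positive right integral $\psi$ on $B$ gives rise to a positive right integral $\widetilde{\psi}$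 on $(B,\widetilde{\Delta})$.
   Context: Multiplier Hopf algebras. All algebras are over $\mathbb{C}$, may lack a unit, and have non-degenerate product. $M(A)$ is the multiplier algebra of $A$ (the largest unital algebra containing $A$ as a dense two-sided ideal). A homomorphism $\gamma:A\to M(C)$ is non-degenerate if $\gamma(A)C=C\gamma(A)=C$ (linear spans of products); it then extends uniquely to a unital homomorphism $M(A)\to M(C)$, still denoted $\gamma$. A comultiplication on $A$ is a homomorphism $\Delta:A\to M(A\otimes A)$ such that $\Delta(a)(1\otimes b)$ and $(a\otimes 1)\Delta(b)$ lie in $A\otimes A$ for all $a,b\in A$ and which is coassociative: $(a\otimes1\otimes1)(\Delta\otimes\iota)(\Delta(b)(1\otimes c))=(\iota\otimes\Delta)((a\otimes1)\Delta(b))(1\otimes1\otimes c)$; $\iota$ is the identity map. $(A,\Delta)$ is a multiplier Hopf algebra if the maps $a\otimes b\mapsto\Delta(a)(1\otimes b)$ and $a\otimes b\mapsto(a\otimes1)\Delta(b)$ are bijections of $A\otimes A$. Then there are a unique counit (homomorphism) $\varepsilon:A\to\mathbb{C}$ and antipode (anti-homomorphism) $S:A\to M(A)$ with $(\varepsilon\otimes\iota)(\Delta(a)(1\otimes b))=ab$, $(\iota\otimes\varepsilon)((a\otimes1)\Delta(b))=ab$, $m((S\otimes\iota)(\Delta(a)(1\otimes b)))=\varepsilon(a)b$, $m((\iota\otimes S)((a\otimes1)\Delta(b)))=\varepsilon(b)a$, $m$ being multiplication. It is regular if $(A,\sigma\circ\Delta)$ ($\sigma$ the flip) is also a multiplier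 Hopf algebra; equivalently $S$ is a bijection of $A$ onto $A$. In the regular case also $\Delta(a)(b\otimes1)$ and $(1\otimes b)\Delta(a)$ lie in $A\otimes A$. A multiplier Hopf $^*$-algebra is a multiplier Hopf algebra whose algebra is a $^*$-algebra and whose comultiplication is a $^*$-homomorphism (regularity is then automatic). Integrals. For a linear functional $f$ on a regular $(A,\Delta)$ and $a\in A$, the multiplier $(\iota\otimes f)\Delta(a)\in M(A)$ is defined by $((\iota\otimes f)\Delta(a))b=(\iota\otimes f)(\Delta(a)(b\otimes1))$ and $b((\iota\otimes f)\Delta(a))=(\iota\otimes f)((b\otimes1)\Delta(a))$; $(f\otimes\iota)\Delta(a)$ is defined similarly. A left integral is a non-zero functional $\varphi$ with $(\iota\otimes\varphi)\Delta(a)=\varphi(a)1$ for all $a$; a functional $\psi$ is right invariant if $(\psi\otimes\iota)\Delta(a)=\psi(a)1$ for all $a$, and a right integral is a non-zero right invariant functional. In the $^*$-case a functional $f$ is positive if $f(a^*a)\ge0$ for all $a$. Cograded. A $G$-cograded multiplier Hopf ($^*$-)algebra is a multiplier Hopf ($^*$-)algebra $B$ with ($^*$-)subalgebras $\{B_p\}_{p\in G}$ such that $B=\bigoplus_{p\in G}B_p$, $B_pB_q=0$ if $p\ne q$, and $\Delta(B_{pq})(1\otimes B_q)=B_p\otimes B_q=(B_p\otimes1)\Delta(B_{pq})$ for all $p,q\in G$ (linear spans of products). Actions. An action of $G$ on a $G$-cograded $B$ is a group homomorphism $\pi:G\to\mathrm{Aut}(B)$, $p\mapsto\pi_p$, into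 the algebra automorphisms of $B$ (with every $\pi_p$ a $^*$-automorphism when $B$ is a multiplier Hopf $^*$-algebra) with $\Delta(\pi_p(b))=(\pi_p\otimes\pi_p)(\Delta(b))$ for all $p\in G$, $b\in B$. It is admissible if there is an action $\rho$ of $G$ on itself by group automorphisms such that $\pi_p(B_q)=B_{\rho_p(q)}$ and $\pi_{\rho_p(q)}=\pi_{pqp^{-1}}$ for all $p,q\in G$. *)

theory Defs
  imports
    Complex_Main
    "HOL-Algebra.Bij"
    "HOL-Library.Poly_Mapping"
    "HOL-Library.Product_Plus"
begin

section \<open>Complex vector spaces and algebras without unit\<close>

class complex_vector = ab_group_add +
  fixes scaleC :: "complex \<Rightarrow> 'a \<Rightarrow> 'a"  (infixr "*\<^sub>C" 75)
  assumes scaleC_add_right: "c *\<^sub>C (x + y) = c *\<^sub>C x + c *\<^sub>C y"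
    and scaleC_add_left: "(c + d) *\<^sub>C x = c *\<^sub>C x + d *\<^sub>C x"
    and scaleC_scaleC [simp]: "c *\<^sub>C d *\<^sub>C x = (c * d) *\<^sub>C x"
    and scaleC_one [simp]: "1 *\<^sub>C x = x"

global_interpretation cvec: vector_space "scaleC :: complex \<Rightarrow> 'a \<Rightarrow> 'a::complex_vector"
  by unfold_locales (rule scaleC_add_right scaleC_add_left scaleC_scaleC scaleC_one)+

abbreviation clinear :: "('a::complex_vector \<Rightarrow> 'b::complex_vector) \<Rightarrow> bool" where
  "clinear \<equiv> Vector_Spaces.linear scaleC scaleC"

lemma clinear_iff:
  "clinear f \<longleftrightarrow> (\<forall>x y. f (x + y) = f x + f y) \<and> (\<forall>c x. f (c *\<^sub>C x) = c *\<^sub>C f x)"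
  by (simp add: Vector_Spaces.linear_iff cvec.vector_space_axioms)

lemma clinear_zero: "clinear f \<Longrightarrow> f 0 = 0"
  by (metis clinear_iff cvec.scale_zero_left)

class complex_algebra = complex_vector + ring +
  assumes scaleC_mult_left [simp]: "(c *\<^sub>C x) * y = c *\<^sub>C (x * y)"
    and scaleC_mult_right [simp]: "x * (c *\<^sub>C y) = c *\<^sub>C (x * y)"

class nondegenerate_complex_algebra = complex_algebra +
  assumes nondegenerate_left: "(\<And>y. x * y = 0) \<Longrightarrow> x = 0"
    and nondegenerate_right: "(\<And>y. y * x = 0) \<Longrightarrow> x = 0"

instantiation complex :: nondegenerate_complex_algebra
begin
definition scaleC_complex :: "complex \<Rightarrow> complex \<Rightarrow> complex" where
  "scaleC_complex c x = c * x"
instance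
proof
  fix x :: complex
  show "x = 0" if "\<And>y. x * y = 0" using that[of 1] by simp
  show "x = 0" if "\<And>y. y * x = 0" using that[of 1] by simp
qed (simp_all add: scaleC_complex_def algebra_simps)
end

definition algebra_hom :: "('a::complex_algebra \<Rightarrow> 'b::complex_algebra) \<Rightarrow> bool" where
  "algebra_hom f \<longleftrightarrow> clinear f \<and> (\<forall>x y. f (x * y) = f x * f y)"


section \<open>The algebraic tensor product\<close>

instantiation poly_mapping :: (type, complex_vector) complex_vector
begin
definition scaleC_poly_mapping :: "complex \<Rightarrow> ('a \<Rightarrow>\<^sub>0 'b) \<Rightarrow> ('a \<Rightarrow>\<^sub>0 'b)" where
  "scaleC_poly_mapping c = Poly_Mapping.map (scaleC c)"
lemma lookup_scaleC [simp]: "Poly_Mapping.lookup (c *\<^sub>C p) k = c *\<^sub>C Poly_Mapping.lookup p k"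
  by (simp add: scaleC_poly_mapping_def Poly_Mapping.map.rep_eq when_def)
instance
  by standard
    (auto intro!: poly_mapping_eqI simp: lookup_add scaleC_add_right scaleC_add_left)
end

text \<open>The free complex vector space on \<open>A \<times> B\<close> modulo the bilinearity relations.\<close>

definition pure :: "'a \<Rightarrow> 'b \<Rightarrow> ('a \<times> 'b \<Rightarrow>\<^sub>0 complex)" where
  "pure a b = Poly_Mapping.single (a, b) 1"

definition bilinear_relations ::
    "('a::complex_vector \<times> 'b::complex_vector \<Rightarrow>\<^sub>0 complex) set" where
  "bilinear_relations =
     {pure (a + a') b - pure a b - pure a' b | a a' b. True} \<union>
     {pure a (b + b') - pure a b - pure a b' | a b b'. True} \<union>
     {pure (c *\<^sub>C a) b - c *\<^sub>C pure a b | c a b. True} \<union>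
     {pure a (c *\<^sub>C b) - c *\<^sub>C pure a b | c a b. True}"

definition tensor_rel ::
    "('a::complex_vector \<times> 'b::complex_vector \<Rightarrow>\<^sub>0 complex) \<Rightarrow> ('a \<times> 'b \<Rightarrow>\<^sub>0 complex) \<Rightarrow> bool" where
  "tensor_rel x y \<longleftrightarrow> x - y \<in> cvec.span bilinear_relations"

lemma tensor_rel_eqI: "x = y \<Longrightarrow> tensor_rel x y"
  by (simp add: tensor_rel_def cvec.span_zero)

lemma tensor_rel_refl: "tensor_rel x x"
  by (simp add: tensor_rel_def cvec.span_zero)

lemma equivp_tensor_rel:
  "equivp (tensor_rel :: ('a::complex_vector \<times> 'b::complex_vector \<Rightarrow>\<^sub>0 complex) \<Rightarrow> _)"
proof (rule equivpI)
  show "reflp (tensor_rel :: ('a \<times> 'b \<Rightarrow>\<^sub>0 complex) \<Rightarrow> _)"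
    by (rule reflpI) (rule tensor_rel_refl)
  show "symp (tensor_rel :: ('a \<times> 'b \<Rightarrow>\<^sub>0 complex) \<Rightarrow> _)"
  proof (rule sympI)
    fix x y :: "'a \<times> 'b \<Rightarrow>\<^sub>0 complex"
    assume "tensor_rel x y"
    then have "- (x - y) \<in> cvec.span bilinear_relations"
      unfolding tensor_rel_def by (rule cvec.span_neg)
    then show "tensor_rel y x"
      by (simp only: tensor_rel_def minus_diff_eq)
  qed
  show "transp (tensor_rel :: ('a \<times> 'b \<Rightarrow>\<^sub>0 complex) \<Rightarrow> _)"
  proof (rule transpI)
    fix x y z :: "'a \<times> 'b \<Rightarrow>\<^sub>0 complex"
    assume "tensor_rel x y" "tensor_rel y z"
    then show "tensor_rel x z"
      using cvec.span_add[of "x - y" bilinear_relations "y - z"]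
      by (simp add: tensor_rel_def add_diff_eq)
  qed
qed

quotient_type (overloaded) ('a, 'b) tensor =
  "('a::complex_vector \<times> 'b::complex_vector) \<Rightarrow>\<^sub>0 complex" / tensor_rel
  by (rule equivp_tensor_rel)

lemma tensor_abs_cases:
  obtains x where "t = abs_tensor x"
  using Quotient3_abs_rep[OF Quotient3_tensor, of t] by metis

instantiation tensor :: (complex_vector, complex_vector) complex_vector
begin
lift_definition zero_tensor :: "('a, 'b) tensor" is 0 .
lift_definition plus_tensor :: "('a, 'b) tensor \<Rightarrow> ('a, 'b) tensor \<Rightarrow> ('a, 'b) tensor" is "(+)"
  unfolding tensor_rel_def add_diff_add by (rule cvec.span_add)
lift_definition uminus_tensor :: "('a, 'b) tensor \<Rightarrow> ('a, 'b) tensor" is uminus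
  unfolding tensor_rel_def minus_diff_minus by (rule cvec.span_neg)
lift_definition minus_tensor :: "('a, 'b) tensor \<Rightarrow> ('a, 'b) tensor \<Rightarrow> ('a, 'b) tensor" is "(-)"
  subgoal for a b c d
    using cvec.span_diff[of "a - b" _ "c - d"] by (simp add: tensor_rel_def algebra_simps)
  done
lift_definition scaleC_tensor :: "complex \<Rightarrow> ('a, 'b) tensor \<Rightarrow> ('a, 'b) tensor" is scaleC
  unfolding tensor_rel_def cvec.scale_right_diff_distrib [symmetric] by (rule cvec.span_scale)
instance
  by standard
    (transfer, rule tensor_rel_eqI, simp add: ac_simps scaleC_add_right scaleC_add_left)+
end

lift_definition tensor :: "'a::complex_vector \<Rightarrow> 'b::complex_vector \<Rightarrow> ('a, 'b) tensor"
    (infixr "\<otimes>\<^sub>C" 72) is pure .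

lemma
  shows tensor_add_left: "(a + a') \<otimes>\<^sub>C b = a \<otimes>\<^sub>C b + a' \<otimes>\<^sub>C b"
    and tensor_add_right: "a \<otimes>\<^sub>C (b + b') = a \<otimes>\<^sub>C b + a \<otimes>\<^sub>C b'"
    and tensor_scaleC_left: "(c *\<^sub>C a) \<otimes>\<^sub>C b = c *\<^sub>C (a \<otimes>\<^sub>C b)"
    and tensor_scaleC_right: "a \<otimes>\<^sub>C (c *\<^sub>C b) = c *\<^sub>C (a \<otimes>\<^sub>C b)"
  by (transfer; unfold tensor_rel_def diff_diff_eq [symmetric]; rule cvec.span_base;
      unfold bilinear_relations_def; blast)+

lemma pure_induct:
  fixes x :: "'a \<times> 'b \<Rightarrow>\<^sub>0 complex"
  assumes zero: "P 0" and step: "\<And>c a b x. P x \<Longrightarrow> P (c *\<^sub>C pure a b + x)"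
  shows "P x"
proof -
  have "P x" if "finite K" "Poly_Mapping.keys x \<subseteq> K" for K x
    using that
  proof (induction K arbitrary: x)
    case empty
    then show ?case using zero by simp
  next
    case (insert k K)
    define y where "y = x - Poly_Mapping.lookup x k *\<^sub>C pure (fst k) (snd k)"
    have y: "Poly_Mapping.lookup y j = (if j = k then 0 else Poly_Mapping.lookup x j)" for j
      by (auto simp: y_def pure_def lookup_minus lookup_single scaleC_complex_def when_def)
    have "Poly_Mapping.keys y \<subseteq> K"
      using insert.prems by (auto simp: in_keys_iff y split: if_splits)
    then have "P y" by (rule insert.IH)
    moreover have "Poly_Mapping.lookup x k *\<^sub>C pure (fst k) (snd k) + y = x"
      unfolding y_def by (subst add.commute) (rule diff_add_cancel)
    ultimately show ?case
      using step[of y "Poly_Mapping.lookup x k" "fst k" "snd k"] by (simp only:)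
  qed
  from this[OF finite_keys subset_refl] show ?thesis .
qed

lemma tensor_induct [case_names zero add tensor, induct type: tensor]:
  fixes t :: "('a::complex_vector, 'b::complex_vector) tensor"
  assumes "P 0" and "\<And>s t. P s \<Longrightarrow> P t \<Longrightarrow> P (s + t)" and "\<And>a b. P (a \<otimes>\<^sub>C b)"
  shows "P t"
proof (cases t rule: tensor_abs_cases)
  case (1 x)
  have "P (abs_tensor x)"
  proof (induction x rule: pure_induct)
    case 1
    then show ?case using assms(1) by (simp add: zero_tensor_def)
  next
    case (2 c a b x)
    have "abs_tensor (c *\<^sub>C pure a b + x) = (c *\<^sub>C a) \<otimes>\<^sub>C b + abs_tensor x"
      unfolding tensor_scaleC_left
      by (simp only: plus_tensor.abs_eq scaleC_tensor.abs_eq tensor.abs_eq)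
    then show ?case using 2 assms(2,3) by metis
  qed
  then show ?thesis using 1 by simp
qed

text \<open>
  The additive map induced by a biadditive \<open>\<complex>\<close>-balanced map \<open>h\<close>. Only balancedness and not
  bilinearity is needed, so that conjugate-linear maps can be induced as well.
\<close>

definition balanced ::
    "('a::complex_vector \<Rightarrow> 'b::complex_vector \<Rightarrow> 'c::ab_group_add) \<Rightarrow> bool" where
  "balanced h \<longleftrightarrow>
     (\<forall>a a' b. h (a + a') b = h a b + h a' b) \<and>
     (\<forall>a b b'. h a (b + b') = h a b + h a b') \<and>
     (\<forall>c a b. h (c *\<^sub>C a) b = h a (c *\<^sub>C b))"

definition formal_lift ::
    "('a::complex_vector \<Rightarrow> 'b::complex_vector \<Rightarrow> 'c::ab_group_add) \<Rightarrow>
     ('a \<times> 'b \<Rightarrow>\<^sub>0 complex) \<Rightarrow> 'c" where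
  "formal_lift h x = (\<Sum>(a, b) \<in> Poly_Mapping.keys x. h (Poly_Mapping.lookup x (a, b) *\<^sub>C a) b)"

definition tensor_lift ::
    "('a::complex_vector \<Rightarrow> 'b::complex_vector \<Rightarrow> 'c::ab_group_add) \<Rightarrow> ('a, 'b) tensor \<Rightarrow> 'c" where
  "tensor_lift h t = formal_lift h (rep_tensor t)"

context
  fixes h :: "'a::complex_vector \<Rightarrow> 'b::complex_vector \<Rightarrow> 'c::ab_group_add"
  assumes h: "balanced h"
begin

lemma balanced_zero: "h 0 b = 0"
  using h unfolding balanced_def by (metis add_cancel_right_right)

lemma formal_lift_superset:
  assumes "finite K" "Poly_Mapping.keys x \<subseteq> K"
  shows "formal_lift h x = (\<Sum>(a, b) \<in> K. h (Poly_Mapping.lookup x (a, b) *\<^sub>C a) b)"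
  unfolding formal_lift_def
  by (rule sum.mono_neutral_left)
    (use assms in \<open>auto simp: in_keys_iff balanced_zero cvec.scale_zero_left\<close>)

lemma formal_lift_add: "formal_lift h (x + y) = formal_lift h x + formal_lift h y"
proof -
  let ?K = "Poly_Mapping.keys x \<union> Poly_Mapping.keys y"
  have "formal_lift h z = (\<Sum>(a, b) \<in> ?K. h (Poly_Mapping.lookup z (a, b) *\<^sub>C a) b)"
    if "z \<in> {x, y, x + y}" for z
    using that Poly_Mapping.keys_add[of x y] by (intro formal_lift_superset) auto
  moreover have "h (Poly_Mapping.lookup (x + y) k *\<^sub>C fst k) (snd k) =
      h (Poly_Mapping.lookup x k *\<^sub>C fst k) (snd k) +
      h (Poly_Mapping.lookup y k *\<^sub>C fst k) (snd k)" for k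
    using h by (simp add: balanced_def lookup_add scaleC_add_left)
  ultimately show ?thesis
    by (simp add: sum.distrib [symmetric] case_prod_unfold)
qed

lemma formal_lift_zero: "formal_lift h 0 = 0"
  using formal_lift_add[of 0 0] by simp

lemma formal_lift_diff: "formal_lift h (x - y) = formal_lift h x - formal_lift h y"
  using formal_lift_add[of "x - y" y] by simp

lemma formal_lift_pure: "formal_lift h (c *\<^sub>C pure a b) = h (c *\<^sub>C a) b"
  by (subst formal_lift_superset[of "{(a, b)}"])
    (auto simp: in_keys_iff pure_def lookup_single scaleC_complex_def when_def split: if_splits)

lemma formal_lift_relation:
  assumes "x \<in> cvec.span bilinear_relations"
  shows "formal_lift h x = 0"
  using assms
proof (induction rule: cvec.span_induct_alt)
  case base
  show ?case by (rule formal_lift_zero)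
next
  case (step c x y)
  have "formal_lift h (c *\<^sub>C x) = 0"
    using step(1) h unfolding bilinear_relations_def
    by (auto simp: cvec.scale_right_diff_distrib formal_lift_diff formal_lift_pure
        balanced_def scaleC_add_right mult.commute)
  then show ?case using step(2) by (simp add: formal_lift_add)
qed

lemma tensor_lift_abs: "tensor_lift h (abs_tensor x) = formal_lift h x"
proof -
  have "tensor_rel (rep_tensor (abs_tensor x)) x"
    using Quotient3_abs_rep[OF Quotient3_tensor, of "abs_tensor x"] by (simp add: tensor.abs_eq_iff)
  then have "formal_lift h (rep_tensor (abs_tensor x) - x) = 0"
    unfolding tensor_rel_def by (rule formal_lift_relation)
  then show ?thesis by (simp add: tensor_lift_def formal_lift_diff)
qed

lemma tensor_lift_tensor [simp]: "tensor_lift h (a \<otimes>\<^sub>C b) = h a b"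
  using formal_lift_pure[of 1 a b] by (simp add: tensor.abs_eq tensor_lift_abs)

lemma tensor_lift_add: "tensor_lift h (s + t) = tensor_lift h s + tensor_lift h t"
  by (cases s rule: tensor_abs_cases; cases t rule: tensor_abs_cases)
    (simp add: plus_tensor.abs_eq tensor_lift_abs formal_lift_add)

lemma tensor_lift_zero: "tensor_lift h 0 = 0"
  using tensor_lift_add[of 0 0] by simp

end

lemma tensor_lift_clinear:
  fixes h :: "'a::complex_vector \<Rightarrow> 'b::complex_vector \<Rightarrow> 'c::complex_vector"
  assumes "\<And>b. clinear (\<lambda>a. h a b)" "\<And>a. clinear (h a)"
  shows "balanced h" "clinear (tensor_lift h)"
proof -
  show h: "balanced h"
    using assms by (simp add: balanced_def clinear_iff)
  have "tensor_lift h (c *\<^sub>C t) = c *\<^sub>C tensor_lift h t" for c t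
  proof (induction t)
    case zero
    then show ?case by (simp add: tensor_lift_zero[OF h] cvec.scale_zero_right)
  next
    case (add s t)
    then show ?case by (simp add: tensor_lift_add[OF h] scaleC_add_right)
  next
    case (tensor a b)
    show ?case
      using assms(1)[of b] 
      by (simp add: tensor_scaleC_left [symmetric] tensor_lift_tensor[OF h] clinear_iff)
  qed
  then show "clinear (tensor_lift h)"
    by (simp add: clinear_iff tensor_lift_add[OF h])
qed

definition tensor_map ::
    "('a::complex_vector \<Rightarrow> 'c::complex_vector) \<Rightarrow> ('b::complex_vector \<Rightarrow> 'd::complex_vector) \<Rightarrow>
     ('a, 'b) tensor \<Rightarrow> ('c, 'd) tensor" where
  "tensor_map f g = tensor_lift (\<lambda>a b. f a \<otimes>\<^sub>C g b)"

lemma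
  assumes "clinear f" "clinear g"
  shows tensor_map_clinear: "clinear (tensor_map f g)"
    and tensor_map_tensor: "tensor_map f g (a \<otimes>\<^sub>C b) = f a \<otimes>\<^sub>C g b"
proof -
  have *: "\<And>b. clinear (\<lambda>a. f a \<otimes>\<^sub>C g b)" "\<And>a. clinear (\<lambda>b. f a \<otimes>\<^sub>C g b)"
    using assms by (simp_all add: clinear_iff tensor_add_left tensor_add_right
        tensor_scaleC_left tensor_scaleC_right)
  note lift = tensor_lift_clinear[OF *]
  show "clinear (tensor_map f g)"
    unfolding tensor_map_def by (rule lift(2))
  show "tensor_map f g (a \<otimes>\<^sub>C b) = f a \<otimes>\<^sub>C g b"
    unfolding tensor_map_def by (rule tensor_lift_tensor[OF lift(1)])
qed

definition tensor_flip :: "('a::complex_vector, 'b::complex_vector) tensor \<Rightarrow> ('b, 'a) tensor" where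
  "tensor_flip = tensor_lift (\<lambda>a b. b \<otimes>\<^sub>C a)"

definition tensor_assoc ::
    "('a::complex_vector, ('b::complex_vector, 'c::complex_vector) tensor) tensor \<Rightarrow>
     (('a, 'b) tensor, 'c) tensor" where
  "tensor_assoc = tensor_lift (\<lambda>a. tensor_lift (\<lambda>b c. (a \<otimes>\<^sub>C b) \<otimes>\<^sub>C c))"

lemma clinear_eq_tensorI:
  assumes "clinear f" "clinear g" "\<And>a b. f (a \<otimes>\<^sub>C b) = g (a \<otimes>\<^sub>C b)"
  shows "f t = g t"
proof (induction t)
  case zero
  then show ?case using assms(1,2) by (metis clinear_iff cvec.scale_zero_left)
qed (use assms in \<open>simp_all add: clinear_iff\<close>)

instantiation tensor :: (complex_algebra, complex_algebra) complex_algebra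
begin

definition times_tensor :: "('a, 'b) tensor \<Rightarrow> ('a, 'b) tensor \<Rightarrow> ('a, 'b) tensor" where
  "s * t = tensor_lift (\<lambda>a b. tensor_map ((*) a) ((*) b) t) s"

lemma mult_clinear:
  "clinear ((*) (a :: 'c::complex_algebra))" "clinear (\<lambda>b. b * (a :: 'c::complex_algebra))"
  by (simp_all add: clinear_iff distrib_left distrib_right)

lemma tensor_mult_aux:
  fixes t :: "('a, 'b) tensor"
  shows "clinear (\<lambda>a. tensor_map ((*) a) ((*) b) t)" "clinear (\<lambda>b. tensor_map ((*) a) ((*) b) t)"
proof -
  note map = tensor_map_tensor[OF mult_clinear(1) mult_clinear(1)]
    tensor_map_clinear[OF mult_clinear(1) mult_clinear(1), unfolded clinear_iff, rule_format]
  have zero: "tensor_map ((*) a) ((*) b) 0 = 0" for a :: 'a and b :: 'b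
    using tensor_map_clinear[OF mult_clinear(1) mult_clinear(1)]
    by (metis clinear_iff cvec.scale_zero_left)
  show "clinear (\<lambda>a. tensor_map ((*) a) ((*) b) t)"
    by (induction t)
      (simp_all add: clinear_iff map zero distrib_right tensor_add_left tensor_scaleC_left
        scaleC_add_right cvec.scale_zero_right ac_simps)
  show "clinear (\<lambda>b. tensor_map ((*) a) ((*) b) t)"
    by (induction t)
      (simp_all add: clinear_iff map zero distrib_right tensor_add_right tensor_scaleC_right
        scaleC_add_right cvec.scale_zero_right ac_simps)
qed

lemma tensor_mult_tensor_left:
  fixes t :: "('a, 'b) tensor"
  shows "(a \<otimes>\<^sub>C b) * t = tensor_map ((*) a) ((*) b) t"
  unfolding times_tensor_def
  by (rule tensor_lift_tensor, rule tensor_lift_clinear(1)) (rule tensor_mult_aux)+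

lemma tensor_mult_tensor:
  "((a::'a) \<otimes>\<^sub>C (b::'b)) * (c \<otimes>\<^sub>C d) = (a * c) \<otimes>\<^sub>C (b * d)"
  by (simp add: tensor_mult_tensor_left tensor_map_tensor mult_clinear)

lemma tensor_mult_clinear_left: "clinear (\<lambda>s :: ('a, 'b) tensor. s * t)"
  unfolding times_tensor_def
  by (rule tensor_lift_clinear(2)) (rule tensor_mult_aux)+

lemma tensor_mult_clinear_right: "clinear (\<lambda>t :: ('a, 'b) tensor. s * t)"
proof (induction s)
  case zero
  have "(0 :: ('a, 'b) tensor) * t = 0" for t
    using tensor_mult_clinear_left[of t] by (metis clinear_iff cvec.scale_zero_left)
  then show ?case by (simp add: clinear_iff cvec.scale_zero_right)
next
  case (add s t)
  then show ?case
    using tensor_mult_clinear_left by (simp add: clinear_iff scaleC_add_right ac_simps)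
next
  case (tensor a b)
  show ?case
    unfolding tensor_mult_tensor_left by (intro tensor_map_clinear mult_clinear)
qed

instance
proof
  fix r s t :: "('a, 'b) tensor" and c :: complex
  note l = tensor_mult_clinear_left[unfolded clinear_iff, rule_format]
  note r = tensor_mult_clinear_right[unfolded clinear_iff, rule_format]
  show "(r + s) * t = r * t + s * t" using l by blast
  show "r * (s + t) = r * s + r * t" using r by blast
  show "(c *\<^sub>C s) * t = c *\<^sub>C (s * t)" using l by blast
  show "s * (c *\<^sub>C t) = c *\<^sub>C (s * t)" using r by blast
  have z: "0 * x = 0" "x * 0 = 0" for x :: "('a, 'b) tensor"
    by (simp_all add: clinear_zero[OF tensor_mult_clinear_left] clinear_zero[OF tensor_mult_clinear_right])
  show "r * s * t = r * (s * t)"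
  proof (induction r)
    case (tensor a b)
    show ?case
    proof (induction s)
      case (tensor a' b')
      show ?case
        by (induction t) (simp_all add: tensor_mult_tensor l r z mult.assoc)
    qed (simp_all add: l r z)
  qed (simp_all add: l r z)
qed

end


section \<open>The multiplier algebra\<close>

text \<open>
  Multipliers are double centralizers, that is, pairs of a left multiplication \<open>a \<mapsto> ma\<close> and a right
  multiplication \<open>a \<mapsto> am\<close>.
\<close>

definition double_centralizer :: "('a::complex_algebra \<Rightarrow> 'a) \<Rightarrow> ('a \<Rightarrow> 'a) \<Rightarrow> bool" where
  "double_centralizer L R \<longleftrightarrow> clinear L \<and> clinear R \<and>
     (\<forall>a b. L (a * b) = L a * b) \<and> (\<forall>a b. R (a * b) = a * R b) \<and> (\<forall>a b. a * L b = R a * b)"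

typedef (overloaded) 'a multiplier =
  "{(L, R). double_centralizer (L :: 'a::complex_algebra \<Rightarrow> 'a) R}"
  by (rule exI[of _ "(id, id)"]) (simp add: double_centralizer_def clinear_iff)

setup_lifting type_definition_multiplier

lift_definition mult_left :: "'a::complex_algebra multiplier \<Rightarrow> 'a \<Rightarrow> 'a" is fst .
lift_definition mult_right :: "'a::complex_algebra multiplier \<Rightarrow> 'a \<Rightarrow> 'a" is snd .

instantiation multiplier :: (complex_algebra) complex_algebra
begin
lift_definition zero_multiplier :: "'a multiplier" is "(\<lambda>x. 0, \<lambda>x. 0)"
  by (simp add: double_centralizer_def clinear_iff cvec.scale_zero_right)
lift_definition plus_multiplier :: "'a multiplier \<Rightarrow> 'a multiplier \<Rightarrow> 'a multiplier"
  is "\<lambda>(L, R) (L', R'). (\<lambda>x. L x + L' x, \<lambda>x. R x + R' x)"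
  by (auto simp: double_centralizer_def clinear_iff scaleC_add_right distrib_left distrib_right)
lift_definition uminus_multiplier :: "'a multiplier \<Rightarrow> 'a multiplier"
  is "\<lambda>(L, R). (\<lambda>x. - L x, \<lambda>x. - R x)"
  by (auto simp: double_centralizer_def clinear_iff cvec.scale_minus_right)
lift_definition minus_multiplier :: "'a multiplier \<Rightarrow> 'a multiplier \<Rightarrow> 'a multiplier"
  is "\<lambda>(L, R) (L', R'). (\<lambda>x. L x - L' x, \<lambda>x. R x - R' x)"
  by (auto simp: double_centralizer_def clinear_iff cvec.scale_right_diff_distrib left_diff_distrib right_diff_distrib)
lift_definition scaleC_multiplier :: "complex \<Rightarrow> 'a multiplier \<Rightarrow> 'a multiplier"
  is "\<lambda>c (L, R). (\<lambda>x. c *\<^sub>C L x, \<lambda>x. c *\<^sub>C R x)"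
  by (auto simp: double_centralizer_def clinear_iff scaleC_add_right mult.commute)
lift_definition times_multiplier :: "'a multiplier \<Rightarrow> 'a multiplier \<Rightarrow> 'a multiplier"
  is "\<lambda>(L, R) (L', R'). (L \<circ> L', R' \<circ> R)"
  by (auto simp: double_centralizer_def clinear_iff)
instance
  by standard
    (transfer; auto simp: fun_eq_iff double_centralizer_def clinear_iff scaleC_add_right scaleC_add_left)+
end

instantiation multiplier :: (complex_algebra) monoid_mult
begin
lift_definition one_multiplier :: "'a multiplier" is "(id, id)"
  by (simp add: double_centralizer_def clinear_iff)
instance
  by standard (transfer; auto)+
end

lift_definition embed :: "'a::complex_algebra \<Rightarrow> 'a multiplier" is "\<lambda>a. ((*) a, \<lambda>x. x * a)"
  by (simp add: double_centralizer_def mult_clinear mult.assoc)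

text \<open>
  Products such as \<open>\<Delta>(a)(1 \<otimes> b)\<close> are formed in the multiplier algebra; \<open>unembed\<close> reads them as elements
  of the algebra when they belong to it.
\<close>

definition unembed :: "'a::complex_algebra multiplier \<Rightarrow> 'a" where
  "unembed = inv_into UNIV embed"

text \<open>The extension to multipliers of an isomorphism of algebras.\<close>

definition mult_map ::
    "('a::complex_algebra \<Rightarrow> 'b::complex_algebra) \<Rightarrow> 'a multiplier \<Rightarrow> 'b multiplier" where
  "mult_map \<gamma> m =
     Abs_multiplier (\<gamma> \<circ> mult_left m \<circ> inv_into UNIV \<gamma>, \<gamma> \<circ> mult_right m \<circ> inv_into UNIV \<gamma>)"

lemma double_centralizer_mult: "double_centralizer (mult_left m) (mult_right m)"
  by transfer auto

lemma double_centralizer_mult_map: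
  assumes "algebra_hom \<gamma>" "bij \<gamma>"
  shows "double_centralizer (\<gamma> \<circ> mult_left m \<circ> inv_into UNIV \<gamma>) (\<gamma> \<circ> mult_right m \<circ> inv_into UNIV \<gamma>)"
proof -
  let ?i = "inv_into UNIV \<gamma>"
  have r: "\<gamma> (?i y) = y" for y
    using assms(2) by (simp add: bij_is_surj surj_f_inv_f)
  have inj: "inj \<gamma>"
    using assms(2) by (rule bij_is_inj)
  have hom: "\<gamma> (x + y) = \<gamma> x + \<gamma> y" "\<gamma> (c *\<^sub>C x) = c *\<^sub>C \<gamma> x" "\<gamma> (x * y) = \<gamma> x * \<gamma> y" for x y c
    using assms(1) by (simp_all add: algebra_hom_def clinear_iff)
  have i: "?i (x + y) = ?i x + ?i y" "?i (c *\<^sub>C x) = c *\<^sub>C ?i x" "?i (x * y) = ?i x * ?i y" for x y c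
    by (rule injD[OF inj], simp add: r hom)+
  have m: "a * mult_left m b = mult_right m a * b" for a b
    using double_centralizer_mult[of m] by (simp add: double_centralizer_def)
  have "a * \<gamma> (mult_left m (?i b)) = \<gamma> (mult_right m (?i a)) * b" for a b
    using arg_cong[OF m[of "?i a" "?i b"], of \<gamma>] by (simp add: hom r)
  then show ?thesis
    using double_centralizer_mult[of m]
    by (simp add: double_centralizer_def clinear_iff i hom r)
qed

lemma mult_map_embed:
  assumes "algebra_hom \<gamma>" "bij \<gamma>"
  shows "mult_map \<gamma> (embed a) = embed (\<gamma> a)"
proof -
  have r: "\<gamma> (inv_into UNIV \<gamma> y) = y" for y
    using assms(2) by (simp add: bij_is_surj surj_f_inv_f)
  have "mult_left (embed a) = (*) a" "mult_right (embed a) = (\<lambda>x. x * a)"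
    by (transfer, simp)+
  then have "(\<gamma> \<circ> mult_left (embed a) \<circ> inv_into UNIV \<gamma>, \<gamma> \<circ> mult_right (embed a) \<circ> inv_into UNIV \<gamma>) =
      ((*) (\<gamma> a), \<lambda>x. x * \<gamma> a)"
    using assms(1) by (auto simp: algebra_hom_def r)
  then show ?thesis
    by (simp add: mult_map_def embed_def)
qed

lemma double_centralizer_tensor:
  assumes "double_centralizer L R" "double_centralizer L' R'"
  shows "double_centralizer (tensor_map L L') (tensor_map R R')"
proof -
  have lin: "clinear L" "clinear L'" "clinear R" "clinear R'"
    using assms by (auto simp: double_centralizer_def)
  note map = tensor_map_tensor[OF lin(1,2)] tensor_map_tensor[OF lin(3,4)]
  have cl: "clinear (tensor_map L L')" "clinear (tensor_map R R')"
    using lin by (simp_all add: tensor_map_clinear)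
  note add = cl[unfolded clinear_iff, THEN conjunct1, rule_format] cl[THEN clinear_zero]
    distrib_left distrib_right
  have "tensor_map L L' (s * t) = tensor_map L L' s * t \<and>
      tensor_map R R' (s * t) = s * tensor_map R R' t \<and>
      s * tensor_map L L' t = tensor_map R R' s * t" for s t
  proof (induction s)
    case (tensor a b)
    show ?case
    proof (induction t)
      case (tensor c d)
      show ?case
        using assms by (simp add: map tensor_mult_tensor double_centralizer_def)
    qed (simp_all add: add)
  qed (simp_all add: add)
  then show ?thesis
    using cl by (simp add: double_centralizer_def)
qed

lift_definition mult_tensor ::
    "'a::complex_algebra multiplier \<Rightarrow> 'b::complex_algebra multiplier \<Rightarrow> ('a, 'b) tensor multiplier"
    (infixr "\<otimes>\<^sub>M" 72)
  is "\<lambda>(L, R) (L', R'). (tensor_map L L', tensor_map R R')"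
  by (auto intro: double_centralizer_tensor)


section \<open>Multiplier Hopf algebras\<close>

text \<open>The elements \<open>\<Delta>(a)(1 \<otimes> b)\<close> and \<open>(a \<otimes> 1)\<Delta>(b)\<close>.\<close>

definition can1 ::
    "('a::complex_algebra \<Rightarrow> ('a, 'a) tensor multiplier) \<Rightarrow> 'a \<Rightarrow> 'a \<Rightarrow> ('a, 'a) tensor multiplier" where
  "can1 \<Delta> a b = \<Delta> a * (1 \<otimes>\<^sub>M embed b)"

definition can2 ::
    "('a::complex_algebra \<Rightarrow> ('a, 'a) tensor multiplier) \<Rightarrow> 'a \<Rightarrow> 'a \<Rightarrow> ('a, 'a) tensor multiplier" where
  "can2 \<Delta> a b = (embed a \<otimes>\<^sub>M 1) * \<Delta> b"

text \<open>
  In the coassociativity axiom, triple tensor products are bracketed to the left; \<open>\<Delta> \<otimes> \<iota>\<close> and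
  \<open>\<iota> \<otimes> \<Delta>\<close> are maps from \<open>A \<otimes> A\<close> to the multipliers of the triple tensor product.
\<close>

definition comultiplication ::
    "('a::nondegenerate_complex_algebra \<Rightarrow> ('a, 'a) tensor multiplier) \<Rightarrow> bool" where
  "comultiplication \<Delta> \<longleftrightarrow>
     algebra_hom \<Delta> \<and>
     (\<forall>a b. can1 \<Delta> a b \<in> range embed \<and> can2 \<Delta> a b \<in> range embed) \<and>
     (\<forall>a b c.
        ((embed a \<otimes>\<^sub>M 1) \<otimes>\<^sub>M 1) *
          tensor_lift (\<lambda>x y. \<Delta> x \<otimes>\<^sub>M embed y) (unembed (can1 \<Delta> b c)) =
        mult_map tensor_assoc
          (tensor_lift (\<lambda>x y. embed x \<otimes>\<^sub>M \<Delta> y) (unembed (can2 \<Delta> a b))) *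
          (1 \<otimes>\<^sub>M embed c))"

definition multiplier_hopf ::
    "('a::nondegenerate_complex_algebra \<Rightarrow> ('a, 'a) tensor multiplier) \<Rightarrow> bool" where
  "multiplier_hopf \<Delta> \<longleftrightarrow>
     comultiplication \<Delta> \<and>
     bij (tensor_lift (\<lambda>a b. unembed (can1 \<Delta> a b))) \<and>
     bij (tensor_lift (\<lambda>a b. unembed (can2 \<Delta> a b)))"

definition regular_multiplier_hopf ::
    "('a::nondegenerate_complex_algebra \<Rightarrow> ('a, 'a) tensor multiplier) \<Rightarrow> bool" where
  "regular_multiplier_hopf \<Delta> \<longleftrightarrow>
     multiplier_hopf \<Delta> \<and> multiplier_hopf (mult_map tensor_flip \<circ> \<Delta>)"

definition is_counit ::
    "('a::nondegenerate_complex_algebra \<Rightarrow> ('a, 'a) tensor multiplier) \<Rightarrow> ('a \<Rightarrow> complex) \<Rightarrow> bool" where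
  "is_counit \<Delta> \<epsilon> \<longleftrightarrow>
     algebra_hom \<epsilon> \<and>
     (\<forall>a b. tensor_lift (\<lambda>x y. \<epsilon> x *\<^sub>C y) (unembed (can1 \<Delta> a b)) = a * b) \<and>
     (\<forall>a b. tensor_lift (\<lambda>x y. \<epsilon> y *\<^sub>C x) (unembed (can2 \<Delta> a b)) = a * b)"

definition is_antipode ::
    "('a::nondegenerate_complex_algebra \<Rightarrow> ('a, 'a) tensor multiplier) \<Rightarrow> ('a \<Rightarrow> complex) \<Rightarrow>
     ('a \<Rightarrow> 'a multiplier) \<Rightarrow> bool" where
  "is_antipode \<Delta> \<epsilon> S \<longleftrightarrow>
     clinear S \<and> (\<forall>a b. S (a * b) = S b * S a) \<and>
     (\<forall>a b. tensor_lift (*) (tensor_map S embed (unembed (can1 \<Delta> a b))) = embed (\<epsilon> a *\<^sub>C b)) \<and>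
     (\<forall>a b. tensor_lift (*) (tensor_map embed S (unembed (can2 \<Delta> a b))) = embed (\<epsilon> b *\<^sub>C a))"


section \<open>Involutions\<close>

definition involution :: "('a::complex_algebra \<Rightarrow> 'a) \<Rightarrow> bool" where
  "involution st \<longleftrightarrow>
     (\<forall>a b. st (a + b) = st a + st b) \<and> (\<forall>c a. st (c *\<^sub>C a) = cnj c *\<^sub>C st a) \<and>
     (\<forall>a b. st (a * b) = st b * st a) \<and> (\<forall>a. st (st a) = a)"

definition tensor_star :: "('a::complex_algebra \<Rightarrow> 'a) \<Rightarrow> ('a, 'a) tensor \<Rightarrow> ('a, 'a) tensor" where
  "tensor_star st = tensor_lift (\<lambda>a b. st a \<otimes>\<^sub>C st b)"

text \<open>The adjoint of a multiplier is determined by \<open>m\<^sup>*a = (a\<^sup>*m)\<^sup>*\<close> and \<open>am\<^sup>* = (ma\<^sup>*)\<^sup>*\<close>.\<close>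

definition mult_star :: "('a::complex_algebra \<Rightarrow> 'a) \<Rightarrow> 'a multiplier \<Rightarrow> 'a multiplier" where
  "mult_star st m = Abs_multiplier (st \<circ> mult_right m \<circ> st, st \<circ> mult_left m \<circ> st)"

definition multiplier_hopf_star ::
    "('a::nondegenerate_complex_algebra \<Rightarrow> 'a) \<Rightarrow> ('a \<Rightarrow> ('a, 'a) tensor multiplier) \<Rightarrow> bool" where
  "multiplier_hopf_star st \<Delta> \<longleftrightarrow>
     multiplier_hopf \<Delta> \<and> involution st \<and>
     (\<forall>a. \<Delta> (st a) = mult_star (tensor_star st) (\<Delta> a))"

definition positive_functional ::
    "('a::complex_algebra \<Rightarrow> 'a) \<Rightarrow> ('a \<Rightarrow> complex) \<Rightarrow> bool" where
  "positive_functional st f \<longleftrightarrow> (\<forall>a. Im (f (st a * a)) = 0 \<and> Re (f (st a * a)) \<ge> 0)"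


section \<open>Integrals\<close>

text \<open>The multipliers \<open>(\<iota> \<otimes> f)\<Delta>(a)\<close> and \<open>(f \<otimes> \<iota>)\<Delta>(a)\<close>, given by their actions on elements of \<open>A\<close>.\<close>

definition slice_right ::
    "('a::complex_algebra \<Rightarrow> ('a, 'a) tensor multiplier) \<Rightarrow> ('a \<Rightarrow> complex) \<Rightarrow> 'a \<Rightarrow> 'a multiplier" where
  "slice_right \<Delta> f a = Abs_multiplier
     (\<lambda>b. tensor_lift (\<lambda>x y. f y *\<^sub>C x) (unembed (\<Delta> a * (embed b \<otimes>\<^sub>M 1))),
      \<lambda>b. tensor_lift (\<lambda>x y. f y *\<^sub>C x) (unembed ((embed b \<otimes>\<^sub>M 1) * \<Delta> a)))"

definition slice_left ::
    "('a::complex_algebra \<Rightarrow> ('a, 'a) tensor multiplier) \<Rightarrow> ('a \<Rightarrow> complex) \<Rightarrow> 'a \<Rightarrow> 'a multiplier" where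
  "slice_left \<Delta> f a = Abs_multiplier
     (\<lambda>b. tensor_lift (\<lambda>x y. f x *\<^sub>C y) (unembed (\<Delta> a * (1 \<otimes>\<^sub>M embed b))),
      \<lambda>b. tensor_lift (\<lambda>x y. f x *\<^sub>C y) (unembed ((1 \<otimes>\<^sub>M embed b) * \<Delta> a)))"

definition left_invariant ::
    "('a::complex_algebra \<Rightarrow> ('a, 'a) tensor multiplier) \<Rightarrow> ('a \<Rightarrow> complex) \<Rightarrow> bool" where
  "left_invariant \<Delta> f \<longleftrightarrow> clinear f \<and> (\<forall>a. slice_right \<Delta> f a = f a *\<^sub>C 1)"

definition right_invariant ::
    "('a::complex_algebra \<Rightarrow> ('a, 'a) tensor multiplier) \<Rightarrow> ('a \<Rightarrow> complex) \<Rightarrow> bool" where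
  "right_invariant \<Delta> f \<longleftrightarrow> clinear f \<and> (\<forall>a. slice_left \<Delta> f a = f a *\<^sub>C 1)"

definition left_integral ::
    "('a::complex_algebra \<Rightarrow> ('a, 'a) tensor multiplier) \<Rightarrow> ('a \<Rightarrow> complex) \<Rightarrow> bool" where
  "left_integral \<Delta> f \<longleftrightarrow> left_invariant \<Delta> f \<and> (\<exists>a. f a \<noteq> 0)"

definition right_integral ::
    "('a::complex_algebra \<Rightarrow> ('a, 'a) tensor multiplier) \<Rightarrow> ('a \<Rightarrow> complex) \<Rightarrow> bool" where
  "right_integral \<Delta> f \<longleftrightarrow> right_invariant \<Delta> f \<and> (\<exists>a. f a \<noteq> 0)"


section \<open>Cograded multiplier Hopf algebras and actions\<close>

definition decomposition ::
    "('g, 'm) monoid_scheme \<Rightarrow> ('g \<Rightarrow> 'b::complex_vector set) \<Rightarrow> 'b \<Rightarrow> ('g \<Rightarrow> 'b) \<Rightarrow> bool" where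
  "decomposition G B b f \<longleftrightarrow>
     (\<forall>p \<in> carrier G. f p \<in> B p) \<and> (\<forall>p. p \<notin> carrier G \<longrightarrow> f p = 0) \<and>
     finite {p. f p \<noteq> 0} \<and> b = (\<Sum>p | f p \<noteq> 0. f p)"

definition component ::
    "('g, 'm) monoid_scheme \<Rightarrow> ('g \<Rightarrow> 'b::complex_vector set) \<Rightarrow> 'b \<Rightarrow> 'g \<Rightarrow> 'b" where
  "component G B b = (THE f. decomposition G B b f)"

definition cograded_multiplier_hopf ::
    "('g, 'm) monoid_scheme \<Rightarrow> ('g \<Rightarrow> 'b::nondegenerate_complex_algebra set) \<Rightarrow>
     ('b \<Rightarrow> ('b, 'b) tensor multiplier) \<Rightarrow> bool" where
  "cograded_multiplier_hopf G B \<Delta> \<longleftrightarrow>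
     multiplier_hopf \<Delta> \<and>
     (\<forall>p \<in> carrier G. cvec.subspace (B p) \<and> (\<forall>x \<in> B p. \<forall>y \<in> B p. x * y \<in> B p)) \<and>
     (\<forall>b. \<exists>!f. decomposition G B b f) \<and>
     (\<forall>p \<in> carrier G. \<forall>q \<in> carrier G. p \<noteq> q \<longrightarrow> (\<forall>x \<in> B p. \<forall>y \<in> B q. x * y = 0)) \<and>
     (\<forall>p \<in> carrier G. \<forall>q \<in> carrier G.
        cvec.span {\<Delta> b * (1 \<otimes>\<^sub>M embed b') | b b'. b \<in> B (p \<otimes>\<^bsub>G\<^esub> q) \<and> b' \<in> B q} =
          embed ` cvec.span {x \<otimes>\<^sub>C y | x y. x \<in> B p \<and> y \<in> B q} \<and>
        cvec.span {(embed b' \<otimes>\<^sub>M 1) * \<Delta> b | b b'. b \<in> B (p \<otimes>\<^bsub>G\<^esub> q) \<and> b' \<in> B p} =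
          embed ` cvec.span {x \<otimes>\<^sub>C y | x y. x \<in> B p \<and> y \<in> B q})"

definition cograded_multiplier_hopf_star ::
    "('b::nondegenerate_complex_algebra \<Rightarrow> 'b) \<Rightarrow> ('g, 'm) monoid_scheme \<Rightarrow> ('g \<Rightarrow> 'b set) \<Rightarrow>
     ('b \<Rightarrow> ('b, 'b) tensor multiplier) \<Rightarrow> bool" where
  "cograded_multiplier_hopf_star st G B \<Delta> \<longleftrightarrow>
     multiplier_hopf_star st \<Delta> \<and> cograded_multiplier_hopf G B \<Delta> \<and>
     (\<forall>p \<in> carrier G. \<forall>x \<in> B p. st x \<in> B p)"

definition hopf_action ::
    "('g, 'm) monoid_scheme \<Rightarrow> ('b::nondegenerate_complex_algebra \<Rightarrow> ('b, 'b) tensor multiplier) \<Rightarrow>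
     ('g \<Rightarrow> 'b \<Rightarrow> 'b) \<Rightarrow> bool" where
  "hopf_action G \<Delta> \<pi> \<longleftrightarrow>
     (\<forall>p \<in> carrier G. algebra_hom (\<pi> p) \<and> bij (\<pi> p)) \<and>
     (\<forall>p \<in> carrier G. \<forall>q \<in> carrier G. \<pi> (p \<otimes>\<^bsub>G\<^esub> q) = \<pi> p \<circ> \<pi> q) \<and>
     (\<forall>p \<in> carrier G. \<forall>b. \<Delta> (\<pi> p b) = mult_map (tensor_map (\<pi> p) (\<pi> p)) (\<Delta> b))"

definition admissible_action ::
    "('g, 'm) monoid_scheme \<Rightarrow> ('g \<Rightarrow> 'b::nondegenerate_complex_algebra set) \<Rightarrow>
     ('b \<Rightarrow> ('b, 'b) tensor multiplier) \<Rightarrow> ('g \<Rightarrow> 'b \<Rightarrow> 'b) \<Rightarrow> bool" where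
  "admissible_action G B \<Delta> \<pi> \<longleftrightarrow>
     hopf_action G \<Delta> \<pi> \<and>
     (\<exists>\<rho> \<in> hom G (AutoGroup G). \<forall>p \<in> carrier G. \<forall>q \<in> carrier G.
        \<pi> p ` B q = B (\<rho> p q) \<and> \<pi> (\<rho> p q) = \<pi> (p \<otimes>\<^bsub>G\<^esub> q \<otimes>\<^bsub>G\<^esub> inv\<^bsub>G\<^esub> p))"

definition is_deformed_comult ::
    "('g, 'm) monoid_scheme \<Rightarrow> ('g \<Rightarrow> 'b::nondegenerate_complex_algebra set) \<Rightarrow>
     ('g \<Rightarrow> 'b \<Rightarrow> 'b) \<Rightarrow> ('b \<Rightarrow> ('b, 'b) tensor multiplier) \<Rightarrow>
     ('b \<Rightarrow> ('b, 'b) tensor multiplier) \<Rightarrow> bool" where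
  "is_deformed_comult G B \<pi> \<Delta> \<Delta>' \<longleftrightarrow>
     (\<forall>q \<in> carrier G. \<forall>b. \<forall>b' \<in> B q.
        \<Delta>' b * (1 \<otimes>\<^sub>M embed b') =
          embed (tensor_map (\<pi> (inv\<^bsub>G\<^esub> q)) id (unembed (\<Delta> b * (1 \<otimes>\<^sub>M embed b')))) \<and>
        (1 \<otimes>\<^sub>M embed b') * \<Delta>' b =
          embed (tensor_map (\<pi> (inv\<^bsub>G\<^esub> q)) id (unembed ((1 \<otimes>\<^sub>M embed b') * \<Delta> b))))"

definition deformed_comult ::
    "('g, 'm) monoid_scheme \<Rightarrow> ('g \<Rightarrow> 'b::nondegenerate_complex_algebra set) \<Rightarrow>
     ('g \<Rightarrow> 'b \<Rightarrow> 'b) \<Rightarrow> ('b \<Rightarrow> ('b, 'b) tensor multiplier) \<Rightarrow>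
     'b \<Rightarrow> ('b, 'b) tensor multiplier" where
  "deformed_comult G B \<pi> \<Delta> = (THE \<Delta>'. is_deformed_comult G B \<pi> \<Delta> \<Delta>')"

text \<open>The linear functional with value \<open>\<psi>(\<pi>\<^bsub>p\<^sup>-\<^sup>1\<^esub>(b))\<close> on \<open>b \<in> B\<^sub>p\<close>.\<close>

definition deformed_functional ::
    "('g, 'm) monoid_scheme \<Rightarrow> ('g \<Rightarrow> 'b::complex_vector set) \<Rightarrow> ('g \<Rightarrow> 'b \<Rightarrow> 'b) \<Rightarrow>
     ('b \<Rightarrow> complex) \<Rightarrow> 'b \<Rightarrow> complex" where
  "deformed_functional G B \<pi> \<psi> b =
     (\<Sum>p | component G B b p \<noteq> 0. \<psi> (\<pi> (inv\<^bsub>G\<^esub> p) (component G B b p)))"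


section \<open>The algebra of an example\<close>

text \<open>
  The algebra carrying an example in which a right integral is not right invariant for the deformed
  comultiplication is a direct sum of two copies of the four-dimensional algebra with generators \<open>g, x\<close> and relations \<open>g\<^sup>2 = 1\<close>, \<open>x\<^sup>2 = 0\<close>, \<open>xg = - gx\<close>
  (the algebra underlying Sweedler's Hopf algebra). With \<open>e = (1 + g) / 2\<close> and \<open>f = (1 - g) / 2\<close>,
  \<open>Sweedler a b c d\<close> is \<open>a e + b f + c x e + d x f\<close>; note \<open>x e = f x\<close> and \<open>x f = e x\<close>.
\<close>

datatype sweedler = Sweedler complex complex complex complex

instantiation sweedler :: nondegenerate_complex_algebra
begin
definition zero_sweedler :: sweedler where "0 = Sweedler 0 0 0 0"
fun plus_sweedler :: "sweedler \<Rightarrow> sweedler \<Rightarrow> sweedler" where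
  "Sweedler a b c d + Sweedler a' b' c' d' = Sweedler (a + a') (b + b') (c + c') (d + d')"
fun uminus_sweedler :: "sweedler \<Rightarrow> sweedler" where
  "- Sweedler a b c d = Sweedler (- a) (- b) (- c) (- d)"
definition minus_sweedler :: "sweedler \<Rightarrow> sweedler \<Rightarrow> sweedler" where
  "minus_sweedler s t = s + (- t)"
fun scaleC_sweedler :: "complex \<Rightarrow> sweedler \<Rightarrow> sweedler" where
  "k *\<^sub>C Sweedler a b c d = Sweedler (k * a) (k * b) (k * c) (k * d)"
fun times_sweedler :: "sweedler \<Rightarrow> sweedler \<Rightarrow> sweedler" where
  "Sweedler a b c d * Sweedler a' b' c' d' =
     Sweedler (a * a') (b * b') (c * a' + b * c') (d * b' + a * d')"
instance
proof
  fix s t u :: sweedler and k l :: complex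
  show "s + t + u = s + (t + u)" by (cases s; cases t; cases u) simp
  show "s + t = t + s" by (cases s; cases t) simp
  show "0 + s = s" by (cases s) (simp add: zero_sweedler_def)
  show "- s + s = 0" by (cases s) (simp add: zero_sweedler_def)
  show "s - t = s + - t" by (rule minus_sweedler_def)
  show "s * t * u = s * (t * u)" by (cases s; cases t; cases u) (simp add: algebra_simps)
  show "(s + t) * u = s * u + t * u" by (cases s; cases t; cases u) (simp add: algebra_simps)
  show "s * (t + u) = s * t + s * u" by (cases s; cases t; cases u) (simp add: algebra_simps)
  show "k *\<^sub>C (s + t) = k *\<^sub>C s + k *\<^sub>C t" by (cases s; cases t) (simp add: algebra_simps)
  show "(k + l) *\<^sub>C s = k *\<^sub>C s + l *\<^sub>C s" by (cases s) (simp add: algebra_simps)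
  show "k *\<^sub>C l *\<^sub>C s = (k * l) *\<^sub>C s" by (cases s) simp
  show "1 *\<^sub>C s = s" by (cases s) simp
  show "(k *\<^sub>C s) * t = k *\<^sub>C (s * t)" by (cases s; cases t) (simp add: algebra_simps)
  show "s * (k *\<^sub>C t) = k *\<^sub>C (s * t)" by (cases s; cases t) (simp add: algebra_simps)
  have *: "s * Sweedler 1 1 0 0 = s" "Sweedler 1 1 0 0 * s = s" by (cases s; simp)+
  from * show "s = 0" if "\<And>t. s * t = 0"
    using that by metis
  from * show "s = 0" if "\<And>t. t * s = 0"
    using that by metis
qed
end

text \<open>The direct sum of two algebras.\<close>

instantiation prod :: (complex_vector, complex_vector) complex_vector
begin
definition scaleC_prod :: "complex \<Rightarrow> 'a \<times> 'b \<Rightarrow> 'a \<times> 'b" where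
  "scaleC_prod c x = (c *\<^sub>C fst x, c *\<^sub>C snd x)"
instance
  by standard (simp_all add: scaleC_prod_def scaleC_add_right scaleC_add_left)
end

instantiation prod :: (complex_algebra, complex_algebra) complex_algebra
begin
definition times_prod :: "'a \<times> 'b \<Rightarrow> 'a \<times> 'b \<Rightarrow> 'a \<times> 'b" where
  "times_prod x y = (fst x * fst y, snd x * snd y)"
instance
  by standard (simp_all add: times_prod_def scaleC_prod_def distrib_left distrib_right mult.assoc)
end

instance prod :: (nondegenerate_complex_algebra, nondegenerate_complex_algebra)
  nondegenerate_complex_algebra
proof
  fix x :: "'a \<times> 'b"
  show "x = 0" if *: "\<And>y. x * y = 0"
  proof -
    have "fst x * a = 0" "snd x * b = 0" for a b
      using *[of "(a, b)"] by (simp_all add: times_prod_def zero_prod_def)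
    then show ?thesis
      by (simp add: prod_eq_iff nondegenerate_left)
  qed
  show "x = 0" if *: "\<And>y. y * x = 0"
  proof -
    have "a * fst x = 0" "b * snd x = 0" for a b
      using *[of "(a, b)"] by (simp_all add: times_prod_def zero_prod_def)
    then show ?thesis
      by (simp add: prod_eq_iff nondegenerate_right)
  qed
qed

end

(*
Let Theta be the algebra automorphism of the tensor square of B which is pi_{q^-1} tensor id on
B tensor B_q. Since B is a direct sum of the mutually orthogonal subalgebras B_q, the deformed
comultiplication is Theta composed with Delta, and Delta(a)(1 tensor b) is simply transformed by
Theta. For (a tensor 1)Delta(b) with a in B_p and b in B_r the cograding and the admissibility of the
action show that a has to be replaced by pi_{r p^-1}(a) first; this replacement is again bijective.
Hence the canonical maps stay bijective, and both iterated deformed comultiplications arise from the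
original ones by one automorphism of the triple tensor product. The counit, the antipode and the
integrals follow from their uniqueness and by computing on homogeneous elements. For the negative
statement on right integrals one tensors Sweedler's algebra with the functions on Z/2, where the
non-trivial element acts by the sign change of the skew-primitive generator.
*)
theory Submission
  imports Defs
begin

section \<open>Linear maps and tensor products\<close>

text \<open>The substitution by \<open>\<pi> (r \<otimes> inv p)\<close> arises as follows. For b of
  degree r, the part of \<Delta>(b) with second leg in degree q has its first leg u in degree r
  q^-1, and a \<pi>_{q^-1}(u) = \<pi>_{q^-1}(\<pi>_q(a) u). This is nonzero only if \<pi>_q(a) also
  has degree r q^-1, and then admissibility forces \<pi>_q = \<pi>_{r p^-1}: one substitution serves
  all q at once. The recurring obstacle is that admissibility does not determine degrees. Of the
  degree \<rho>_p(q) of \<pi>_p(B_q) only the induced automorphism \<pi>_{p q p^-1} is known.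
  Degrees are therefore compared through their automorphisms, and arguments about supports split
  according to whether two automorphisms agree. Regularity is by definition a property of the
  flipped comultiplication. To avoid a second proof of coassociativity it is first restated through
  four canonical maps of a single comultiplication. Multipliers are compared by their action on
  algebra elements, which for tensor squares and cubes presupposes that tensor products of
  non-degenerate algebras are non-degenerate.\<close>

named_theorems clin

lemma clinear_id [clin]: "clinear (\<lambda>x. x)" "clinear id"
  by (simp_all add: clinear_iff)

lemma clinear_comp [clin]: "clinear f \<Longrightarrow> clinear g \<Longrightarrow> clinear (f \<circ> g)"
  by (simp add: clinear_iff)

lemma clinear_compose: "clinear f \<Longrightarrow> clinear g \<Longrightarrow> clinear (\<lambda>x. f (g x))"
  by (simp add: clinear_iff)

lemma clinear_const_zero [clin]: "clinear (\<lambda>x. 0)"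
  by (simp add: clinear_iff cvec.scale_zero_right)

lemma clinear_plus [clin]: "clinear f \<Longrightarrow> clinear g \<Longrightarrow> clinear (\<lambda>x. f x + g x)"
  by (simp add: clinear_iff scaleC_add_right)

lemma clinear_scaleC_vector [clin]: "clinear f \<Longrightarrow> clinear (\<lambda>x. c *\<^sub>C f x)"
  by (simp add: clinear_iff scaleC_add_right mult.commute)

lemma clinear_scaleC_functional [clin]: "clinear f \<Longrightarrow> clinear (\<lambda>x. f x *\<^sub>C v)"
  by (simp add: clinear_iff scaleC_add_left scaleC_complex_def)

lemma clinear_mult_const [clin]:
  fixes f :: "'a::complex_vector \<Rightarrow> 'b::complex_algebra"
  shows "clinear f \<Longrightarrow> clinear (\<lambda>x. b * f x)" "clinear f \<Longrightarrow> clinear (\<lambda>x. f x * b)"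
  by (simp_all add: clinear_iff distrib_left distrib_right)

lemma clinear_tensor [clin]:
  "clinear f \<Longrightarrow> clinear (\<lambda>x. f x \<otimes>\<^sub>C b)" "clinear f \<Longrightarrow> clinear (\<lambda>x. b \<otimes>\<^sub>C f x)"
  by (simp_all add: clinear_iff tensor_add_left tensor_add_right tensor_scaleC_left tensor_scaleC_right)

lemma clinear_add: "clinear f \<Longrightarrow> f (x + y) = f x + f y"
  by (simp add: clinear_iff)

lemma clinear_scale: "clinear f \<Longrightarrow> f (c *\<^sub>C x) = c *\<^sub>C f x"
  by (simp add: clinear_iff)

lemma clinear_sum: "clinear f \<Longrightarrow> f (sum g I) = (\<Sum>i\<in>I. f (g i))"
  by (induction I rule: infinite_finite_induct) (simp_all add: clinear_zero clinear_add)

lemma clinear_neg: "clinear f \<Longrightarrow> f (- x) = - f x"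
  by (metis add.right_inverse clinear_add clinear_zero minus_unique)

lemma clinear_diff: "clinear f \<Longrightarrow> f (x - y) = f x - f y"
  by (metis clinear_add clinear_neg diff_conv_add_uminus)

lemma clinear_uminus: "clinear f \<Longrightarrow> clinear (\<lambda>x. - f x)"
  by (simp add: clinear_iff cvec.scale_minus_right)

lemma clinear_inv: "clinear f \<Longrightarrow> bij f \<Longrightarrow> clinear (inv_into UNIV f)"
  by (simp add: clinear_iff) (metis bij_inv_eq_iff)

lemma clinear_eq_on_span:
  assumes "clinear f" "clinear g" "\<And>x. x \<in> X \<Longrightarrow> f x = g x" "t \<in> cvec.span X"
  shows "f t = g t"
  using assms(4)
proof (induction rule: cvec.span_induct_alt)
  case base
  show ?case by (simp add: clinear_zero assms(1,2))
next
  case (step c x y)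
  then show ?case
    by (simp add: clinear_add[OF assms(1)] clinear_add[OF assms(2)] clinear_scale[OF assms(1)]
        clinear_scale[OF assms(2)] assms(3))
qed

section \<open>Bilinear maps and the linear maps they induce on tensor products\<close>

definition cbilinear :: "('a::complex_vector \<Rightarrow> 'b::complex_vector \<Rightarrow> 'c::complex_vector) \<Rightarrow> bool"
  where "cbilinear h \<longleftrightarrow> (\<forall>b. clinear (\<lambda>a. h a b)) \<and> (\<forall>a. clinear (h a))"

lemma cbilinearI [intro]:
  "(\<And>b. clinear (\<lambda>a. h a b)) \<Longrightarrow> (\<And>a. clinear (\<lambda>b. h a b)) \<Longrightarrow> cbilinear h"
  by (simp add: cbilinear_def)

lemma cbilinear_balanced: "cbilinear h \<Longrightarrow> balanced h"
  by (rule tensor_lift_clinear) (simp_all add: cbilinear_def)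

lemma tensor_lift_apply: "cbilinear h \<Longrightarrow> tensor_lift h (a \<otimes>\<^sub>C b) = h a b"
  by (rule tensor_lift_tensor[OF cbilinear_balanced])

lemma clinear_tensor_lift [clin]: "cbilinear h \<Longrightarrow> clinear (tensor_lift h)"
  by (rule tensor_lift_clinear) (simp_all add: cbilinear_def)

declare tensor_map_clinear [clin]

lemma tensor_ext:
  assumes "clinear f" "clinear g" "\<And>a b. f (a \<otimes>\<^sub>C b) = g (a \<otimes>\<^sub>C b)"
  shows "f = g"
  using clinear_eq_tensorI[OF assms] by blast

lemma tensor_map_compose:
  assumes "clinear f" "clinear g" "clinear f'" "clinear g'"
  shows "tensor_map f g \<circ> tensor_map f' g' = tensor_map (f \<circ> f') (g \<circ> g')"
  by (rule tensor_ext) (use assms in \<open>simp_all add: clin tensor_map_tensor\<close>)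

lemma tensor_map_id: "tensor_map id id = id"
  by (rule tensor_ext) (simp_all add: clin tensor_map_tensor)

lemma tensor_zero: "0 \<otimes>\<^sub>C b = 0" "a \<otimes>\<^sub>C 0 = 0"
  by (rule clinear_zero[OF clinear_tensor(1)] clinear_zero[OF clinear_tensor(2)]; rule clin)+

lemma tensor_neg: "(- a) \<otimes>\<^sub>C b = - (a \<otimes>\<^sub>C b)" "a \<otimes>\<^sub>C (- b) = - (a \<otimes>\<^sub>C b)"
  by (metis tensor_add_left tensor_zero(1) add.right_inverse add_eq_0_iff)
    (metis tensor_add_right tensor_zero(2) add.right_inverse add_eq_0_iff)

lemma bij_tensor_map:
  assumes "clinear f" "clinear g" "bij f" "bij g"
  shows "bij (tensor_map f g)"
proof (rule o_bij)
  note inv = clinear_inv[OF assms(1,3)] clinear_inv[OF assms(2,4)]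
  show "tensor_map (inv_into UNIV f) (inv_into UNIV g) \<circ> tensor_map f g = id"
    using assms inv by (simp add: tensor_map_compose bij_is_inj tensor_map_id)
  show "tensor_map f g \<circ> tensor_map (inv_into UNIV f) (inv_into UNIV g) = id"
    using assms inv
    by (simp add: tensor_map_compose surj_iff[THEN iffD1, OF bij_is_surj] tensor_map_id)
qed

lemma algebra_hom_clinear: "algebra_hom f \<Longrightarrow> clinear f"
  by (simp add: algebra_hom_def)

lemma algebra_hom_mult: "algebra_hom f \<Longrightarrow> f (x * y) = f x * f y"
  by (simp add: algebra_hom_def)

lemma algebra_hom_compose: "algebra_hom f \<Longrightarrow> algebra_hom g \<Longrightarrow> algebra_hom (f \<circ> g)"
  by (simp add: algebra_hom_def clinear_iff)

lemma algebra_hom_tensorI: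
  fixes f :: "('a::complex_algebra, 'b::complex_algebra) tensor \<Rightarrow> 'c::complex_algebra"
  assumes f: "clinear f"
    and mult: "\<And>a b a' b'. f ((a * a') \<otimes>\<^sub>C (b * b')) = f (a \<otimes>\<^sub>C b) * f (a' \<otimes>\<^sub>C b')"
  shows "algebra_hom f"
proof -
  have "f (s * t) = f s * f t" for s t
  proof (induction s)
    case (tensor a b)
    then show ?case
      by (induction t)
        (simp_all add: clinear_zero[OF f] clinear_add[OF f] distrib_left tensor_mult_tensor mult)
  qed (simp_all add: clinear_zero[OF f] clinear_add[OF f] distrib_right)
  with f show ?thesis by (simp add: algebra_hom_def)
qed

lemma algebra_hom_tensor_map:
  assumes "algebra_hom f" "algebra_hom g"
  shows "algebra_hom (tensor_map f g)"
  by (rule algebra_hom_tensorI)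
    (use assms in \<open>simp_all add: algebra_hom_def clin tensor_map_tensor tensor_mult_tensor\<close>)

section \<open>Permutation and rebracketing of tensor legs\<close>

lemma clinear_tensor_flip [clin]: "clinear tensor_flip"
  unfolding tensor_flip_def by (intro clinear_tensor_lift cbilinearI clin)

lemma tensor_flip_tensor [simp]: "tensor_flip (a \<otimes>\<^sub>C b) = b \<otimes>\<^sub>C a"
  unfolding tensor_flip_def by (rule tensor_lift_apply) (intro cbilinearI clin)

lemma tensor_flip_flip: "tensor_flip \<circ> tensor_flip = id"
  by (rule tensor_ext) (simp_all add: clin)

lemma bij_tensor_flip: "bij tensor_flip"
  by (rule o_bij) (rule tensor_flip_flip)+

lemma algebra_hom_tensor_flip: "algebra_hom tensor_flip"
  by (rule algebra_hom_tensorI) (simp_all add: clin tensor_mult_tensor)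

lemma cbilinear_tensor_assoc:
  "cbilinear (\<lambda>b c. ((a::'a::complex_vector) \<otimes>\<^sub>C (b::'b::complex_vector)) \<otimes>\<^sub>C (c::'c::complex_vector))"
  "cbilinear (\<lambda>a. tensor_lift (\<lambda>b c. ((a::'a::complex_vector) \<otimes>\<^sub>C (b::'b::complex_vector)) \<otimes>\<^sub>C (c::'c::complex_vector)))"
proof -
  show *: "cbilinear (\<lambda>b c. (a \<otimes>\<^sub>C b) \<otimes>\<^sub>C c)" for a :: 'a and b :: 'b and c :: 'c
    by (intro cbilinearI clin)
  show "cbilinear (\<lambda>a. tensor_lift (\<lambda>b c. ((a::'a) \<otimes>\<^sub>C (b::'b)) \<otimes>\<^sub>C (c::'c)))"
  proof
    fix t :: "('b, 'c) tensor"
    show "clinear (\<lambda>a::'a. tensor_lift (\<lambda>b c. (a \<otimes>\<^sub>C b) \<otimes>\<^sub>C c) t)"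
    proof (induction t)
      case zero
      show ?case by (simp add: clinear_zero[OF clinear_tensor_lift[OF *]] clin)
    next
      case (add s t)
      then show ?case by (simp add: clinear_add[OF clinear_tensor_lift[OF *]] clin)
    next
      case (tensor b c)
      show ?case by (simp add: tensor_lift_apply[OF *] clin)
    qed
  qed (intro clin *)
qed

lemma clinear_tensor_assoc [clin]: "clinear tensor_assoc"
  unfolding tensor_assoc_def by (intro clin cbilinear_tensor_assoc)

lemma tensor_assoc_tensor [simp]: "tensor_assoc (a \<otimes>\<^sub>C (b \<otimes>\<^sub>C c)) = (a \<otimes>\<^sub>C b) \<otimes>\<^sub>C c"
  unfolding tensor_assoc_def by (simp add: tensor_lift_apply cbilinear_tensor_assoc)

lemma tensor_ext3:
  assumes "clinear f" "clinear g" "\<And>a b c. f ((a \<otimes>\<^sub>C b) \<otimes>\<^sub>C c) = g ((a \<otimes>\<^sub>C b) \<otimes>\<^sub>C c)"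
  shows "f = g"
proof (rule tensor_ext[OF assms(1,2)])
  fix s c
  have "(\<lambda>s. f (s \<otimes>\<^sub>C c)) = (\<lambda>s. g (s \<otimes>\<^sub>C c))"
    by (rule tensor_ext) (use assms in \<open>auto intro!: clinear_compose[of f] clinear_compose[of g] clin\<close>)
  then show "f (s \<otimes>\<^sub>C c) = g (s \<otimes>\<^sub>C c)" by metis
qed

lemma tensor_ext3':
  assumes "clinear f" "clinear g" "\<And>a b c. f (a \<otimes>\<^sub>C (b \<otimes>\<^sub>C c)) = g (a \<otimes>\<^sub>C (b \<otimes>\<^sub>C c))"
  shows "f = g"
proof (rule tensor_ext[OF assms(1,2)])
  fix a s
  have "(\<lambda>s. f (a \<otimes>\<^sub>C s)) = (\<lambda>s. g (a \<otimes>\<^sub>C s))"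
    by (rule tensor_ext) (use assms in \<open>auto intro!: clinear_compose[of f] clinear_compose[of g] clin\<close>)
  then show "f (a \<otimes>\<^sub>C s) = g (a \<otimes>\<^sub>C s)" by metis
qed

text \<open>The reversal of three legs, assembled so that source and target are both bracketed to
  the left. It carries coassociativity of a comultiplication to that of its opposite.\<close>

definition tensor_flip3 ::
    "(('a::complex_vector, 'b::complex_vector) tensor, 'c::complex_vector) tensor \<Rightarrow> (('c, 'b) tensor, 'a) tensor"
  where "tensor_flip3 = tensor_assoc \<circ> tensor_map id tensor_flip \<circ> tensor_flip"

lemma clinear_tensor_flip3 [clin]: "clinear tensor_flip3"
  unfolding tensor_flip3_def by (intro clin)

lemma tensor_flip3_tensor [simp]: "tensor_flip3 ((a \<otimes>\<^sub>C b) \<otimes>\<^sub>C c) = (c \<otimes>\<^sub>C b) \<otimes>\<^sub>C a"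
  by (simp add: tensor_flip3_def tensor_map_tensor clin)

lemma tensor_flip3_flip3: "tensor_flip3 \<circ> tensor_flip3 = id"
  by (rule tensor_ext3) (simp_all add: clin)

lemma bij_tensor_flip3: "bij tensor_flip3"
  by (rule o_bij) (rule tensor_flip3_flip3)+

text \<open>The inverse is composed of permutations: reverse all legs, exchange the first two of the
  result, then flip the outer tensor product.\<close>

lemma bij_tensor_assoc: "bij tensor_assoc"
proof (rule o_bij)
  let ?f = "tensor_flip \<circ> tensor_map tensor_flip id \<circ> tensor_flip3"
  show "?f \<circ> tensor_assoc = id"
    by (rule tensor_ext3') (simp_all add: clin tensor_map_tensor)
  show "tensor_assoc \<circ> ?f = id"
    by (rule tensor_ext3) (simp_all add: clin tensor_map_tensor)
qed

lemma algebra_hom_tensor_assoc: "algebra_hom tensor_assoc"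
proof (rule algebra_hom_tensorI)
  fix a a' :: "'a" and s s' :: "('b, 'c) tensor"
  show "tensor_assoc ((a * a') \<otimes>\<^sub>C (s * s')) = tensor_assoc (a \<otimes>\<^sub>C s) * tensor_assoc (a' \<otimes>\<^sub>C s')"
  proof (induction s)
    case (tensor b c)
    then show ?case
      by (induction s')
        (simp_all add: tensor_zero clinear_zero[OF clinear_tensor_assoc]
          clinear_add[OF clinear_tensor_assoc] distrib_left tensor_add_right tensor_mult_tensor)
  qed (simp_all add: tensor_zero clinear_zero[OF clinear_tensor_assoc]
          clinear_add[OF clinear_tensor_assoc] distrib_right tensor_add_right)
qed (rule clin)

lemma algebra_hom_id: "algebra_hom id"
  by (simp add: algebra_hom_def clin)

lemma algebra_hom_tensor_flip3: "algebra_hom tensor_flip3"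
  unfolding tensor_flip3_def
  by (intro algebra_hom_compose algebra_hom_tensor_assoc algebra_hom_tensor_map algebra_hom_tensor_flip
      algebra_hom_id)

section \<open>Slice maps and non-degeneracy of tensor products\<close>

abbreviation slice_fst ::
    "('a::complex_vector \<Rightarrow> complex) \<Rightarrow> ('a, 'b::complex_vector) tensor \<Rightarrow> 'b" where
  "slice_fst f \<equiv> tensor_lift (\<lambda>x y. f x *\<^sub>C y)"

abbreviation slice_snd ::
    "('b::complex_vector \<Rightarrow> complex) \<Rightarrow> ('a::complex_vector, 'b) tensor \<Rightarrow> 'a" where
  "slice_snd f \<equiv> tensor_lift (\<lambda>x y. f y *\<^sub>C x)"

lemma
  assumes "clinear f"
  shows cbilinear_slice_fst: "cbilinear (\<lambda>x y. f x *\<^sub>C y)"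
    and cbilinear_slice_snd: "cbilinear (\<lambda>x y. f y *\<^sub>C x)"
  by (intro cbilinearI clin assms)+

lemma
  assumes "clinear f"
  shows slice_fst_tensor: "slice_fst f (a \<otimes>\<^sub>C b) = f a *\<^sub>C b"
    and slice_snd_tensor: "slice_snd f (b \<otimes>\<^sub>C a) = f a *\<^sub>C b"
    and clinear_slice_fst: "clinear (slice_fst f)"
    and clinear_slice_snd: "clinear (slice_snd f)"
  using assms
  by (auto intro!: tensor_lift_apply clinear_tensor_lift cbilinear_slice_fst cbilinear_slice_snd)

lemma tensor_sum_right: "a \<otimes>\<^sub>C (\<Sum>i\<in>I. f i) = (\<Sum>i\<in>I. a \<otimes>\<^sub>C f i)"
  by (rule clinear_sum) (rule clin)+

text \<open>With a basis of the second space and its coordinate functionals \<open>r j\<close>,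
  every tensor is the sum of its slices by \<open>r j\<close> tensored with the basis vectors j.
  Vanishing slices therefore leave nothing.\<close>

lemma slice_snd_separates:
  fixes t :: "('a::complex_vector, 'b::complex_vector) tensor"
  assumes "\<And>g :: 'b \<Rightarrow> complex. clinear g \<Longrightarrow> slice_snd g t = 0"
  shows "t = 0"
proof -
  define X :: "'b set" where "X = cvec.extend_basis {}"
  define r where "r j b = cvec.representation X b j" for j b
  have X: "cvec.independent X" "cvec.span X = UNIV"
    unfolding X_def by (simp_all add: cvec.independent_extend_basis cvec.independent_empty)
  have r: "clinear (r j)" for j
    unfolding r_def clinear_iff
    using X by (simp add: cvec.representation_add cvec.representation_scale scaleC_complex_def)
  \<comment> \<open>The expansion is claimed over every finite index set above \<open>J0\<close>, so
    that the expansions of two summands can be read over the union of their index sets.\<close>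
  have "\<exists>J0. finite J0 \<and> (\<forall>J. finite J \<longrightarrow> J0 \<subseteq> J \<longrightarrow> t = (\<Sum>j\<in>J. slice_snd (r j) t \<otimes>\<^sub>C j))" for t :: "('a, 'b) tensor"
  proof (induction t)
    case zero
    show ?case
      by (intro exI[of _ "{}"]) (simp add: clinear_zero[OF clinear_slice_snd[OF r]] tensor_zero)
  next
    case (add s t)
    from add.IH(1) obtain J1 where J1: "finite J1"
      "\<forall>J. finite J \<longrightarrow> J1 \<subseteq> J \<longrightarrow> s = (\<Sum>j\<in>J. slice_snd (r j) s \<otimes>\<^sub>C j)"
      by (elim exE conjE)
    from add.IH(2) obtain J2 where J2: "finite J2"
      "\<forall>J. finite J \<longrightarrow> J2 \<subseteq> J \<longrightarrow> t = (\<Sum>j\<in>J. slice_snd (r j) t \<otimes>\<^sub>C j)"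
      by (elim exE conjE)
    have "s + t = (\<Sum>j\<in>J. slice_snd (r j) (s + t) \<otimes>\<^sub>C j)" if "finite J" "J1 \<union> J2 \<subseteq> J" for J
    proof -
      have "(\<Sum>j\<in>J. slice_snd (r j) (s + t) \<otimes>\<^sub>C j) =
          (\<Sum>j\<in>J. slice_snd (r j) s \<otimes>\<^sub>C j) + (\<Sum>j\<in>J. slice_snd (r j) t \<otimes>\<^sub>C j)"
        by (simp add: clinear_add[OF clinear_slice_snd[OF r]] tensor_add_left sum.distrib)
      with that J1(2)[rule_format, of J] J2(2)[rule_format, of J] show ?thesis
        by (simp only: Un_subset_iff)
    qed
    with J1(1) J2(1) show ?case by (intro exI[of _ "J1 \<union> J2"]) blast
  next
    case (tensor a b)
    have "a \<otimes>\<^sub>C b = (\<Sum>j\<in>J. slice_snd (r j) (a \<otimes>\<^sub>C b) \<otimes>\<^sub>C j)"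
      if "finite J" "{j. r j b \<noteq> 0} \<subseteq> J" for J
    proof -
      have "b = (\<Sum>j\<in>J. r j b *\<^sub>C j)"
        unfolding r_def using that
        by (subst cvec.sum_nonzero_representation_eq[of X b, symmetric])
          (auto simp: X r_def intro!: sum.mono_neutral_left)
      then have "a \<otimes>\<^sub>C b = (\<Sum>j\<in>J. a \<otimes>\<^sub>C (r j b *\<^sub>C j))"
        by (metis tensor_sum_right)
      also have "\<dots> = (\<Sum>j\<in>J. slice_snd (r j) (a \<otimes>\<^sub>C b) \<otimes>\<^sub>C j)"
        by (simp add: slice_snd_tensor[OF r] tensor_scaleC_left tensor_scaleC_right)
      finally show ?thesis .
    qed
    moreover have "finite {j. r j b \<noteq> 0}"
      unfolding r_def by (rule cvec.finite_representation)
    ultimately show ?case by blast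
  qed
  then obtain J0 where "finite J0" "t = (\<Sum>j\<in>J0. slice_snd (r j) t \<otimes>\<^sub>C j)" by blast
  moreover have "(\<Sum>j\<in>J0. slice_snd (r j) t \<otimes>\<^sub>C j) = 0"
    by (rule sum.neutral) (simp add: assms[OF r] tensor_zero)
  ultimately show "t = 0" by simp
qed

lemma slice_fst_separates:
  fixes t :: "('a::complex_vector, 'b::complex_vector) tensor"
  assumes "\<And>g :: 'a \<Rightarrow> complex. clinear g \<Longrightarrow> slice_fst g t = 0"
  shows "t = 0"
proof -
  have "slice_snd g (tensor_flip t) = slice_fst g t" if "clinear g" for g
  proof -
    have "slice_snd g \<circ> tensor_flip = slice_fst g"
      by (rule tensor_ext) (simp_all add: clin that clinear_slice_fst clinear_slice_snd slice_fst_tensor slice_snd_tensor)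
    then show ?thesis by (metis comp_apply)
  qed
  with assms have "tensor_flip t = 0" by (intro slice_snd_separates) simp
  then show ?thesis
    using tensor_flip_flip by (metis clinear_tensor_flip clinear_zero comp_apply id_apply)
qed

lemma subspace_range: "clinear f \<Longrightarrow> cvec.subspace (range f)"
  unfolding cvec.subspace_def
  by (auto simp: clinear_add[symmetric] clinear_scale[symmetric] image_iff intro: exI[of _ 0] clinear_zero)

lemma span_tensor_image:
  assumes f: "clinear f"
  shows "cvec.span {f (h \<otimes>\<^sub>C k) | h k. True} = range f"
proof
  show "cvec.span {f (h \<otimes>\<^sub>C k) | h k. True} \<subseteq> range f"
    by (rule cvec.span_minimal[OF _ subspace_range[OF f]]) auto
  have "f t \<in> cvec.span {f (h \<otimes>\<^sub>C k) | h k. True}" for t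
  proof (induction t)
    case (tensor h k)
    show ?case by (rule cvec.span_base) blast
  qed (simp_all add: clinear_zero[OF f] clinear_add[OF f] cvec.span_zero cvec.span_add)
  then show "range f \<subseteq> cvec.span {f (h \<otimes>\<^sub>C k) | h k. True}" by blast
qed

text \<open>Suppose t annihilates everything from the left. Slicing t(x \<otimes> 1) in the first
  leg and multiplying by y gives a slice of t(x \<otimes> y) = 0, so non-degeneracy of the second
  algebra and separation by slices yield t(x \<otimes> 1) = 0. Slicing in the second leg and
  non-degeneracy of the first algebra then give t = 0. The other side is symmetric.\<close>

instance tensor :: (nondegenerate_complex_algebra, nondegenerate_complex_algebra)
  nondegenerate_complex_algebra
proof
  fix t :: "('a, 'b) tensor"
  show "t = 0" if *: "\<And>s. t * s = 0"
  proof (rule slice_snd_separates)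
    fix g :: "'b \<Rightarrow> complex"
    assume g: "clinear g"
    show "slice_snd g t = 0"
    proof (rule nondegenerate_left)
      fix x :: 'a
      let ?t = "tensor_map (\<lambda>a. a * x) id t"
      have lin: "clinear (\<lambda>a. a * x)" by (intro clin)
      have "?t = 0"
      proof (rule slice_fst_separates)
        fix f :: "'a \<Rightarrow> complex"
        assume f: "clinear f"
        show "slice_fst f ?t = 0"
        proof (rule nondegenerate_left)
          fix y :: 'b
          have "(\<lambda>t. slice_fst f (tensor_map (\<lambda>a. a * x) id t) * y) = (\<lambda>t. slice_fst f (t * (x \<otimes>\<^sub>C y)))"
            by (rule tensor_ext)
              (auto intro!: clin clinear_compose[OF clinear_slice_fst[OF f]]
                simp: tensor_map_tensor slice_fst_tensor[OF f] tensor_mult_tensor lin clin)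
          then have "slice_fst f ?t * y = slice_fst f (t * (x \<otimes>\<^sub>C y))"
            by metis
          then show "slice_fst f ?t * y = 0"
            by (simp add: * clinear_zero[OF clinear_slice_fst[OF f]])
        qed
      qed
      moreover have "slice_snd g \<circ> tensor_map (\<lambda>a. a * x) id = (\<lambda>t. slice_snd g t * x)"
        by (rule tensor_ext)
          (auto intro!: clin clinear_slice_snd[OF g]
            simp: tensor_map_tensor slice_snd_tensor[OF g] lin clin)
      ultimately show "slice_snd g t * x = 0"
        by (metis clinear_slice_snd[OF g] clinear_zero comp_apply)
    qed
  qed
  show "t = 0" if *: "\<And>s. s * t = 0"
  proof (rule slice_snd_separates)
    fix g :: "'b \<Rightarrow> complex"
    assume g: "clinear g"
    show "slice_snd g t = 0"
    proof (rule nondegenerate_right)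
      fix x :: 'a
      let ?t = "tensor_map (\<lambda>a. x * a) id t"
      have lin: "clinear (\<lambda>a. x * a)" by (intro clin)
      have "?t = 0"
      proof (rule slice_fst_separates)
        fix f :: "'a \<Rightarrow> complex"
        assume f: "clinear f"
        show "slice_fst f ?t = 0"
        proof (rule nondegenerate_right)
          fix y :: 'b
          have "(\<lambda>t. y * slice_fst f (tensor_map (\<lambda>a. x * a) id t)) = (\<lambda>t. slice_fst f ((x \<otimes>\<^sub>C y) * t))"
            by (rule tensor_ext)
              (auto intro!: clin clinear_compose[OF clinear_slice_fst[OF f]]
                simp: tensor_map_tensor slice_fst_tensor[OF f] tensor_mult_tensor lin clin)
          then have "y * slice_fst f ?t = slice_fst f ((x \<otimes>\<^sub>C y) * t)"
            by metis
          then show "y * slice_fst f ?t = 0"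
            by (simp add: * clinear_zero[OF clinear_slice_fst[OF f]])
        qed
      qed
      moreover have "slice_snd g \<circ> tensor_map (\<lambda>a. x * a) id = (\<lambda>t. x * slice_snd g t)"
        by (rule tensor_ext)
          (auto intro!: clin clinear_slice_snd[OF g]
            simp: tensor_map_tensor slice_snd_tensor[OF g] lin clin)
      ultimately show "x * slice_snd g t = 0"
        by (metis clinear_slice_snd[OF g] clinear_zero comp_apply)
    qed
  qed
qed

section \<open>Multipliers\<close>

lemma mult_left_linear: "clinear (mult_left m)"
  and mult_right_linear: "clinear (mult_right m)"
  using double_centralizer_mult[of m] by (simp_all add: double_centralizer_def)

lemma clinear_mult_left [clin]: "clinear f \<Longrightarrow> clinear (\<lambda>x. mult_left m (f x))"
  and clinear_mult_right [clin]: "clinear f \<Longrightarrow> clinear (\<lambda>x. mult_right m (f x))"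
  using clinear_compose[OF mult_left_linear] clinear_compose[OF mult_right_linear] by blast+

lemma mult_left_mult: "mult_left m (a * b) = mult_left m a * b"
  and mult_right_mult: "mult_right m (a * b) = a * mult_right m b"
  and mult_left_right: "a * mult_left m b = mult_right m a * b"
  using double_centralizer_mult[of m] by (simp_all add: double_centralizer_def)

lemma mult_left_zero_right [simp]: "mult_left m 0 = 0"
  and mult_right_zero_right [simp]: "mult_right m 0 = 0"
  by (rule clinear_zero, rule mult_left_linear mult_right_linear)+

lemma mult_left_simps [simp]:
  "mult_left 0 x = 0" "mult_left 1 x = x"
  "mult_left (m * n) x = mult_left m (mult_left n x)"
  "mult_left (embed a) x = a * x"
  by (transfer; auto)+

lemma mult_right_simps [simp]:
  "mult_right 0 x = 0" "mult_right 1 x = x"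
  "mult_right (m * n) x = mult_right n (mult_right m x)"
  "mult_right (embed a) x = x * a"
  by (transfer; auto)+

lemma mult_left_add: "mult_left (m + n) x = mult_left m x + mult_left n x"
  and mult_right_add: "mult_right (m + n) x = mult_right m x + mult_right n x"
  and mult_left_scale: "mult_left (c *\<^sub>C m) x = c *\<^sub>C mult_left m x"
  and mult_right_scale: "mult_right (c *\<^sub>C m) x = c *\<^sub>C mult_right m x"
  by (transfer; auto)+

lemma mult_left_Abs: "double_centralizer L R \<Longrightarrow> mult_left (Abs_multiplier (L, R)) = L"
  and mult_right_Abs: "double_centralizer L R \<Longrightarrow> mult_right (Abs_multiplier (L, R)) = R"
  by (simp_all add: mult_left.rep_eq mult_right.rep_eq Abs_multiplier_inverse)

lemma Abs_multiplier_mult: "Abs_multiplier (mult_left m, mult_right m) = m"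
  by (simp add: mult_left.rep_eq mult_right.rep_eq Rep_multiplier_inverse)

text \<open>The left action determines the right one, because (xm)y = x(my) and the algebra is
  non-degenerate. Equality of multipliers can therefore be tested on one side.\<close>

lemma multiplier_eqI:
  fixes m n :: "'a::nondegenerate_complex_algebra multiplier"
  assumes "\<And>x. mult_left m x = mult_left n x"
  shows "m = n"
proof -
  have "mult_right m x = mult_right n x" for x
  proof -
    have "(mult_right m x - mult_right n x) * y = 0" for y
      using mult_left_right[of x m y] mult_left_right[of x n y] assms
      by (simp add: left_diff_distrib)
    then show ?thesis
      using nondegenerate_left[of "mult_right m x - mult_right n x"] by simp
  qed
  with assms show ?thesis
    by (metis Abs_multiplier_mult ext)
qed

lemma multiplier_eqI_right:
  fixes m n :: "'a::nondegenerate_complex_algebra multiplier"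
  assumes "\<And>x. mult_right m x = mult_right n x"
  shows "m = n"
proof (rule multiplier_eqI)
  fix x
  have "y * (mult_left m x - mult_left n x) = 0" for y
    using mult_left_right[of y m x] mult_left_right[of y n x] assms
    by (simp add: right_diff_distrib)
  then show "mult_left m x = mult_left n x"
    using nondegenerate_right[of "mult_left m x - mult_left n x"] by simp
qed

lemma clinear_embed [clin]: "clinear f \<Longrightarrow> clinear (\<lambda>x. embed (f x))"
  unfolding clinear_iff
  by (intro conjI allI; simp; transfer) (auto simp: distrib_left distrib_right)

lemma embed_mult: "embed (a * b) = embed a * embed b"
  by transfer (auto simp: mult.assoc)

lemma mult_embed: "m * embed a = embed (mult_left m a)"
  and embed_mult_right: "embed a * m = embed (mult_right m a)"
  by (transfer; auto simp: double_centralizer_def)+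

lemma inj_embed: "inj (embed :: 'a::nondegenerate_complex_algebra \<Rightarrow> 'a multiplier)"
proof (rule injI)
  fix a b :: 'a
  assume "embed a = embed b"
  then have "a * x = b * x" for x
    by (metis mult_left_simps(4))
  then have "(a - b) * x = 0" for x
    by (simp add: left_diff_distrib)
  then show "a = b"
    using nondegenerate_left[of "a - b"] by simp
qed

lemma unembed_embed [simp]: "unembed (embed (a :: 'a::nondegenerate_complex_algebra)) = a"
  unfolding unembed_def by (rule inv_f_f[OF inj_embed])

lemma embed_unembed: "m \<in> range embed \<Longrightarrow> embed (unembed m) = m"
  unfolding unembed_def by (rule f_inv_into_f)

lemma embed_inject [simp]:
  "embed a = embed b \<longleftrightarrow> a = (b :: 'a::nondegenerate_complex_algebra)"
  using inj_embed by (auto dest: injD)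

lemma mult_left_unembed: "m \<in> range embed \<Longrightarrow> unembed m * x = mult_left m x"
  and mult_right_unembed: "m \<in> range embed \<Longrightarrow> x * unembed m = mult_right m x"
  for m :: "'a::nondegenerate_complex_algebra multiplier"
  by auto

text \<open>This is associativity of m x n in the multiplier algebra.\<close>

lemma mult_left_right_commute:
  "mult_left m (mult_right n x) = mult_right n (mult_left m (x :: 'a::nondegenerate_complex_algebra))"
proof -
  have "m * (embed x * n) = (m * embed x) * n" by (simp only: mult.assoc)
  then show ?thesis by (simp only: mult_embed embed_mult_right embed_inject)
qed

text \<open>Off \<open>range embed\<close> the value of \<open>unembed\<close> is an arbitrary
  choice, so linearity is available only along maps into that range.\<close>

lemma clinear_unembed:
  fixes f :: "'b::complex_vector \<Rightarrow> 'a::nondegenerate_complex_algebra multiplier"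
  assumes "clinear f" "\<And>x. f x \<in> range embed"
  shows "clinear (\<lambda>x. unembed (f x))"
proof -
  have e: "embed (unembed (f x)) = f x" for x
    by (rule embed_unembed[OF assms(2)])
  have "embed (unembed (f (x + y))) = embed (unembed (f x) + unembed (f y))"
    "embed (unembed (f (c *\<^sub>C x))) = embed (c *\<^sub>C unembed (f x))" for x y c
    unfolding e clinear_add[OF clinear_embed[OF clinear_id(1)]]
      clinear_scale[OF clinear_embed[OF clinear_id(1)]]
    by (simp_all add: assms(1) clinear_add clinear_scale)
  then show ?thesis
    by (simp add: clinear_iff)
qed

lemma clinear_mult_multiplier [clin]:
  "clinear f \<Longrightarrow> clinear (\<lambda>x. mult_left (f x) y)"
  "clinear f \<Longrightarrow> clinear (\<lambda>x. mult_right (f x) y)"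
  by (simp_all add: clinear_iff mult_left_add mult_right_add mult_left_scale mult_right_scale)

lemma mult_left_tensor [simp]:
  "mult_left (m \<otimes>\<^sub>M n) (x \<otimes>\<^sub>C y) = mult_left m x \<otimes>\<^sub>C mult_left n y"
proof -
  have "mult_left (m \<otimes>\<^sub>M n) = tensor_map (mult_left m) (mult_left n)"
    by transfer auto
  then show ?thesis by (simp add: tensor_map_tensor mult_left_linear)
qed

lemma mult_right_tensor [simp]:
  "mult_right (m \<otimes>\<^sub>M n) (x \<otimes>\<^sub>C y) = mult_right m x \<otimes>\<^sub>C mult_right n y"
proof -
  have "mult_right (m \<otimes>\<^sub>M n) = tensor_map (mult_right m) (mult_right n)"
    by transfer auto
  then show ?thesis by (simp add: tensor_map_tensor mult_right_linear)
qed

lemma multiplier_tensor_eqI: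
  fixes m n :: "('a::nondegenerate_complex_algebra, 'b::nondegenerate_complex_algebra) tensor multiplier"
  assumes "\<And>x y. mult_left m (x \<otimes>\<^sub>C y) = mult_left n (x \<otimes>\<^sub>C y)"
  shows "m = n"
proof -
  have "mult_left m = mult_left n"
    by (rule tensor_ext) (simp_all add: assms mult_left_linear)
  then show ?thesis by (simp add: multiplier_eqI)
qed

lemma multiplier_tensor_eqI3:
  fixes m n :: "(('a::nondegenerate_complex_algebra, 'b::nondegenerate_complex_algebra) tensor,
     'c::nondegenerate_complex_algebra) tensor multiplier"
  assumes "\<And>x y z. mult_left m ((x \<otimes>\<^sub>C y) \<otimes>\<^sub>C z) = mult_left n ((x \<otimes>\<^sub>C y) \<otimes>\<^sub>C z)"
  shows "m = n"
proof -
  have "mult_left m = mult_left n"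
    by (rule tensor_ext3) (simp_all add: assms mult_left_linear)
  then show ?thesis by (simp add: multiplier_eqI)
qed

lemma mult_tensor_mult:
  fixes m m' :: "'a::nondegenerate_complex_algebra multiplier"
    and n n' :: "'b::nondegenerate_complex_algebra multiplier"
  shows "(m \<otimes>\<^sub>M n) * (m' \<otimes>\<^sub>M n') = (m * m') \<otimes>\<^sub>M (n * n')"
  by (rule multiplier_tensor_eqI) simp

lemma mult_tensor_one:
  "(1 :: 'a::nondegenerate_complex_algebra multiplier) \<otimes>\<^sub>M (1 :: 'b::nondegenerate_complex_algebra multiplier) = 1"
  by (rule multiplier_tensor_eqI) simp

lemma embed_tensor:
  "embed (a \<otimes>\<^sub>C b) = embed (a::'a::nondegenerate_complex_algebra) \<otimes>\<^sub>M embed (b::'b::nondegenerate_complex_algebra)"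
  by (rule multiplier_tensor_eqI) (simp add: tensor_mult_tensor)

lemma mult_tensor_add:
  fixes m m' :: "'a::nondegenerate_complex_algebra multiplier"
    and n n' :: "'b::nondegenerate_complex_algebra multiplier"
  shows "(m + m') \<otimes>\<^sub>M n = m \<otimes>\<^sub>M n + m' \<otimes>\<^sub>M n"
    and "m \<otimes>\<^sub>M (n + n') = m \<otimes>\<^sub>M n + m \<otimes>\<^sub>M n'"
    and "(c *\<^sub>C m) \<otimes>\<^sub>M n = c *\<^sub>C (m \<otimes>\<^sub>M n)"
    and "m \<otimes>\<^sub>M (c *\<^sub>C n) = c *\<^sub>C (m \<otimes>\<^sub>M n)"
  by (rule multiplier_tensor_eqI; simp add: mult_left_add mult_left_scale tensor_add_left
      tensor_add_right tensor_scaleC_left tensor_scaleC_right)+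

lemma clinear_mult_tensor [clin]:
  fixes f :: "'v::complex_vector \<Rightarrow> 'a::nondegenerate_complex_algebra multiplier"
    and g :: "'v::complex_vector \<Rightarrow> 'b::nondegenerate_complex_algebra multiplier"
    and m :: "'a multiplier" and n :: "'b multiplier"
  shows "clinear f \<Longrightarrow> clinear (\<lambda>x. f x \<otimes>\<^sub>M n)" "clinear g \<Longrightarrow> clinear (\<lambda>x. m \<otimes>\<^sub>M g x)"
  by (simp_all add: clinear_iff mult_tensor_add)

section \<open>Extension of algebra isomorphisms to multipliers\<close>

lemma mult_left_map:
  assumes "algebra_hom \<gamma>" "bij \<gamma>"
  shows "mult_left (mult_map \<gamma> m) (\<gamma> x) = \<gamma> (mult_left m x)"
    and "mult_right (mult_map \<gamma> m) (\<gamma> x) = \<gamma> (mult_right m x)"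
  unfolding mult_map_def
  by (subst mult_left_Abs mult_right_Abs, rule double_centralizer_mult_map[OF assms],
      simp add: assms(2) bij_is_inj)+

text \<open>A transported multiplier is recognised by intertwining with \<gamma>; the inverse in the
  definition of \<open>mult_map\<close> then never has to be computed.\<close>

lemma mult_map_eqI:
  fixes n :: "'b::nondegenerate_complex_algebra multiplier"
  assumes "algebra_hom \<gamma>" "bij \<gamma>" "\<And>x. mult_left n (\<gamma> x) = \<gamma> (mult_left m x)"
  shows "mult_map \<gamma> m = n"
proof (rule multiplier_eqI)
  fix y
  obtain x where "y = \<gamma> x" using assms(2) by (metis bij_pointE)
  then show "mult_left (mult_map \<gamma> m) y = mult_left n y"
    using assms by (simp add: mult_left_map)
qed

lemma
  fixes \<gamma> :: "'a::nondegenerate_complex_algebra \<Rightarrow> 'b::nondegenerate_complex_algebra"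
  assumes "algebra_hom \<gamma>" "bij \<gamma>"
  shows mult_map_mult: "mult_map \<gamma> (m * n) = mult_map \<gamma> m * mult_map \<gamma> n"
    and mult_map_one [simp]: "mult_map \<gamma> 1 = 1"
    and clinear_mult_map: "clinear (mult_map \<gamma>)"
    and algebra_hom_mult_map: "algebra_hom (mult_map \<gamma>)"
proof -
  show *: "mult_map \<gamma> (m * n) = mult_map \<gamma> m * mult_map \<gamma> n" for m n
    by (rule mult_map_eqI) (simp_all add: assms mult_left_map)
  show "mult_map \<gamma> 1 = 1"
    by (rule mult_map_eqI) (simp_all add: assms)
  have lin: "\<gamma> (x + y) = \<gamma> x + \<gamma> y" "\<gamma> (c *\<^sub>C x) = c *\<^sub>C \<gamma> x" for x y c
    using assms(1) by (simp_all add: algebra_hom_def clinear_iff)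
  show "clinear (mult_map \<gamma>)"
    unfolding clinear_iff
    by (intro conjI allI mult_map_eqI)
      (simp_all add: assms mult_left_map mult_left_add mult_left_scale lin)
  with * show "algebra_hom (mult_map \<gamma>)"
    by (simp add: algebra_hom_def)
qed

lemma mult_map_compose:
  fixes \<gamma> :: "'b::nondegenerate_complex_algebra \<Rightarrow> 'c::nondegenerate_complex_algebra"
    and \<delta> :: "'a::nondegenerate_complex_algebra \<Rightarrow> 'b::nondegenerate_complex_algebra"
  assumes "algebra_hom \<gamma>" "bij \<gamma>" "algebra_hom \<delta>" "bij \<delta>"
  shows "mult_map \<gamma> (mult_map \<delta> m) = mult_map (\<gamma> \<circ> \<delta>) m"
  by (rule sym, rule mult_map_eqI)
    (simp_all add: assms algebra_hom_compose bij_comp mult_left_map)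

lemma mult_map_id [simp]: "mult_map id m = m"
  by (simp add: mult_map_def Abs_multiplier_mult)

lemma mult_map_tensor_map:
  fixes f :: "'a::nondegenerate_complex_algebra \<Rightarrow> 'c::nondegenerate_complex_algebra"
    and g :: "'b::nondegenerate_complex_algebra \<Rightarrow> 'd::nondegenerate_complex_algebra"
  assumes "algebra_hom f" "bij f" "algebra_hom g" "bij g"
  shows "mult_map (tensor_map f g) (m \<otimes>\<^sub>M n) = mult_map f m \<otimes>\<^sub>M mult_map g n"
proof (rule mult_map_eqI)
  note lin = assms(1,3)[THEN algebra_hom_clinear]
  fix x
  have "mult_left (mult_map f m \<otimes>\<^sub>M mult_map g n) \<circ> tensor_map f g =
      tensor_map f g \<circ> mult_left (m \<otimes>\<^sub>M n)"
    by (rule tensor_ext)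
      (simp_all add: clin lin mult_left_linear tensor_map_tensor mult_left_map assms)
  then show "mult_left (mult_map f m \<otimes>\<^sub>M mult_map g n) (tensor_map f g x) =
      tensor_map f g (mult_left (m \<otimes>\<^sub>M n) x)"
    by (metis comp_apply)
qed (simp_all add: assms algebra_hom_tensor_map bij_tensor_map algebra_hom_clinear)

lemma mult_map_flip:
  fixes m :: "'a::nondegenerate_complex_algebra multiplier"
    and n :: "'b::nondegenerate_complex_algebra multiplier"
  shows "mult_map tensor_flip (m \<otimes>\<^sub>M n) = n \<otimes>\<^sub>M m"
proof (rule mult_map_eqI)
  fix x
  have "mult_left (n \<otimes>\<^sub>M m) \<circ> tensor_flip = tensor_flip \<circ> mult_left (m \<otimes>\<^sub>M n)"
    by (rule tensor_ext) (simp_all add: clin mult_left_linear)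
  then show "mult_left (n \<otimes>\<^sub>M m) (tensor_flip x) = tensor_flip (mult_left (m \<otimes>\<^sub>M n) x)"
    by (metis comp_apply)
qed (simp_all add: algebra_hom_tensor_flip bij_tensor_flip)

lemma mult_map_assoc:
  fixes m :: "'a::nondegenerate_complex_algebra multiplier"
    and n :: "'b::nondegenerate_complex_algebra multiplier"
    and k :: "'c::nondegenerate_complex_algebra multiplier"
  shows "mult_map tensor_assoc (m \<otimes>\<^sub>M (n \<otimes>\<^sub>M k)) = (m \<otimes>\<^sub>M n) \<otimes>\<^sub>M k"
proof (rule mult_map_eqI)
  fix x
  have "mult_left ((m \<otimes>\<^sub>M n) \<otimes>\<^sub>M k) \<circ> tensor_assoc = tensor_assoc \<circ> mult_left (m \<otimes>\<^sub>M (n \<otimes>\<^sub>M k))"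
    by (rule tensor_ext3') (simp_all add: clin mult_left_linear)
  then show "mult_left ((m \<otimes>\<^sub>M n) \<otimes>\<^sub>M k) (tensor_assoc x) = tensor_assoc (mult_left (m \<otimes>\<^sub>M (n \<otimes>\<^sub>M k)) x)"
    by (metis comp_apply)
qed (simp_all add: algebra_hom_tensor_assoc bij_tensor_assoc)

lemma mult_map_flip3:
  fixes m :: "('a::nondegenerate_complex_algebra, 'b::nondegenerate_complex_algebra) tensor multiplier"
    and n :: "'c::nondegenerate_complex_algebra multiplier"
  shows "mult_map tensor_flip3 (m \<otimes>\<^sub>M n) = mult_map tensor_assoc (n \<otimes>\<^sub>M mult_map tensor_flip m)"
    (is "?L = ?R")
proof -
  note homs = algebra_hom_tensor_flip bij_tensor_flip algebra_hom_tensor_assoc bij_tensor_assoc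
    algebra_hom_id bij_id
  have *: "algebra_hom (tensor_map (id :: 'c \<Rightarrow> 'c) (tensor_flip :: ('a, 'b) tensor \<Rightarrow> _))"
    "bij (tensor_map (id :: 'c \<Rightarrow> 'c) (tensor_flip :: ('a, 'b) tensor \<Rightarrow> _))"
    by (simp_all add: homs algebra_hom_tensor_map bij_tensor_map algebra_hom_clinear)
  show ?thesis
    unfolding tensor_flip3_def comp_assoc
    by (simp add: mult_map_compose[symmetric] homs * algebra_hom_compose bij_comp mult_map_flip
        mult_map_tensor_map)
qed

text \<open>Such a \<open>Q\<close> is a central multiplier.\<close>

lemma mult_left_central:
  fixes m :: "'a::nondegenerate_complex_algebra multiplier"
  assumes "\<And>a b. Q (a * b) = Q a * b" "\<And>a b. Q (a * b) = a * Q b"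
  shows "mult_left m (Q a) = Q (mult_left m a)" "mult_right m (Q a) = Q (mult_right m a)"
proof -
  have "b * (mult_left m (Q a) - Q (mult_left m a)) = 0" for b
    using assms by (simp add: right_diff_distrib mult_left_right) (metis mult_left_right)
  then show "mult_left m (Q a) = Q (mult_left m a)"
    using nondegenerate_right[of "mult_left m (Q a) - Q (mult_left m a)"] by simp
  have "(mult_right m (Q a) - Q (mult_right m a)) * b = 0" for b
    using assms by (simp add: left_diff_distrib mult_left_right[symmetric]) (metis mult_left_right)
  then show "mult_right m (Q a) = Q (mult_right m a)"
    using nondegenerate_left[of "mult_right m (Q a) - Q (mult_right m a)"] by simp
qed

section \<open>Regular multiplier Hopf algebras\<close>

text \<open>Together with \<open>can1\<close> and \<open>can2\<close> these are all four one-sided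
  products. Up to the flip, \<open>can3\<close> and \<open>can4\<close> are the canonical products
  of the opposite comultiplication, so they express regularity.\<close>

definition can3 ::
    "('a::complex_algebra \<Rightarrow> ('a, 'a) tensor multiplier) \<Rightarrow> 'a \<Rightarrow> 'a \<Rightarrow> ('a, 'a) tensor multiplier" where
  "can3 \<Delta> a b = \<Delta> a * (embed b \<otimes>\<^sub>M 1)"

definition can4 ::
    "('a::complex_algebra \<Rightarrow> ('a, 'a) tensor multiplier) \<Rightarrow> 'a \<Rightarrow> 'a \<Rightarrow> ('a, 'a) tensor multiplier" where
  "can4 \<Delta> a b = (1 \<otimes>\<^sub>M embed a) * \<Delta> b"

definition galois ::
    "('a::complex_algebra \<Rightarrow> 'a \<Rightarrow> ('a, 'a) tensor multiplier) \<Rightarrow> ('a, 'a) tensor \<Rightarrow> ('a, 'a) tensor" where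
  "galois T = tensor_lift (\<lambda>a b. unembed (T a b))"

definition comult_fst ::
    "('a::complex_algebra \<Rightarrow> ('a, 'a) tensor multiplier) \<Rightarrow> ('a, 'a) tensor \<Rightarrow>
     (('a, 'a) tensor, 'a) tensor multiplier" where
  "comult_fst \<Delta> = tensor_lift (\<lambda>x y. \<Delta> x \<otimes>\<^sub>M embed y)"

definition comult_snd ::
    "('a::complex_algebra \<Rightarrow> ('a, 'a) tensor multiplier) \<Rightarrow> ('a, 'a) tensor \<Rightarrow>
     ('a, ('a, 'a) tensor) tensor multiplier" where
  "comult_snd \<Delta> = tensor_lift (\<lambda>x y. embed x \<otimes>\<^sub>M \<Delta> y)"

lemma
  fixes \<Delta> :: "'a::nondegenerate_complex_algebra \<Rightarrow> ('a, 'a) tensor multiplier"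
  assumes "clinear \<Delta>"
  shows clinear_comult_fst: "clinear (comult_fst \<Delta>)"
    and clinear_comult_snd: "clinear (comult_snd \<Delta>)"
    and comult_fst_tensor [simp]: "comult_fst \<Delta> (x \<otimes>\<^sub>C y) = \<Delta> x \<otimes>\<^sub>M embed y"
    and comult_snd_tensor [simp]: "comult_snd \<Delta> (x \<otimes>\<^sub>C y) = embed x \<otimes>\<^sub>M \<Delta> y"
proof -
  have *: "cbilinear (\<lambda>x (y :: 'a). \<Delta> x \<otimes>\<^sub>M embed y)" "cbilinear (\<lambda>(x :: 'a) y. embed x \<otimes>\<^sub>M \<Delta> y)"
    by (intro cbilinearI clin assms)+
  show "clinear (comult_fst \<Delta>)" "clinear (comult_snd \<Delta>)"
    unfolding comult_fst_def comult_snd_def by (intro clin *)+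
  show "comult_fst \<Delta> (x \<otimes>\<^sub>C y) = \<Delta> x \<otimes>\<^sub>M embed y" "comult_snd \<Delta> (x \<otimes>\<^sub>C y) = embed x \<otimes>\<^sub>M \<Delta> y"
    unfolding comult_fst_def comult_snd_def by (simp_all add: tensor_lift_apply *)
qed

lemma
  fixes \<Delta> :: "'a::nondegenerate_complex_algebra \<Rightarrow> ('a, 'a) tensor multiplier"
  assumes "clinear \<Delta>"
  shows cbilinear_can1: "cbilinear (can1 \<Delta>)" and cbilinear_can2: "cbilinear (can2 \<Delta>)"
    and cbilinear_can3: "cbilinear (can3 \<Delta>)" and cbilinear_can4: "cbilinear (can4 \<Delta>)"
  unfolding can1_def can2_def can3_def can4_def
  by (intro cbilinearI clin assms)+

lemma
  fixes T :: "'a::nondegenerate_complex_algebra \<Rightarrow> 'a \<Rightarrow> ('a, 'a) tensor multiplier"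
  assumes "cbilinear T" "\<And>a b. T a b \<in> range embed"
  shows clinear_galois: "clinear (galois T)"
    and galois_tensor: "galois T (a \<otimes>\<^sub>C b) = unembed (T a b)"
    and embed_galois: "embed (galois T (a \<otimes>\<^sub>C b)) = T a b"
proof -
  have *: "cbilinear (\<lambda>a b. unembed (T a b))"
    using assms by (intro cbilinearI clinear_unembed) (auto simp: cbilinear_def)
  show "clinear (galois T)"
    unfolding galois_def by (intro clin *)
  show "galois T (a \<otimes>\<^sub>C b) = unembed (T a b)"
    unfolding galois_def by (rule tensor_lift_apply[OF *])
  then show "embed (galois T (a \<otimes>\<^sub>C b)) = T a b"
    by (simp add: embed_unembed assms)
qed

text \<open>Both sides agree after multiplication by \<open>x \<otimes> 1 \<otimes> 1\<close> from the left and by \<open>1 \<otimes> 1 \<otimes> y\<close>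
  from the right, because then the assumption applies; non-degeneracy cancels these factors.\<close>

lemma coassociativity_op:
  fixes \<Delta> :: "'a::nondegenerate_complex_algebra \<Rightarrow> ('a, 'a) tensor multiplier"
  assumes lin: "clinear \<Delta>"
    and range: "\<And>a b. can1 \<Delta> a b \<in> range embed" "\<And>a b. can2 \<Delta> a b \<in> range embed"
      "\<And>a b. can3 \<Delta> a b \<in> range embed" "\<And>a b. can4 \<Delta> a b \<in> range embed"
    and coassoc: "\<And>a b c. ((embed a \<otimes>\<^sub>M 1) \<otimes>\<^sub>M 1) * comult_fst \<Delta> (unembed (can1 \<Delta> b c)) =
        mult_map tensor_assoc (comult_snd \<Delta> (unembed (can2 \<Delta> a b))) * (1 \<otimes>\<^sub>M embed c)"
  shows "(1 \<otimes>\<^sub>M embed a) * mult_map tensor_assoc (comult_snd \<Delta> (unembed (can3 \<Delta> b c))) =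
      comult_fst \<Delta> (unembed (can4 \<Delta> a b)) * ((embed c \<otimes>\<^sub>M 1) \<otimes>\<^sub>M 1)"
    (is "?Y = ?X")
proof -
  let ?A = "mult_map (tensor_assoc :: ('a, ('a, 'a) tensor) tensor \<Rightarrow> _)"
  have A: "?A (m * n) = ?A m * ?A n" for m n
    by (rule mult_map_mult) (rule algebra_hom_tensor_assoc bij_tensor_assoc)+
  have A1: "?A (embed x \<otimes>\<^sub>M 1) = (embed x \<otimes>\<^sub>M 1) \<otimes>\<^sub>M 1" for x
    unfolding mult_tensor_one[symmetric, where 'a = 'a and 'b = 'a] by (rule mult_map_assoc)
  have fst_left: "comult_fst \<Delta> (mult_left (1 \<otimes>\<^sub>M embed d) t) = (1 \<otimes>\<^sub>M embed d) * comult_fst \<Delta> t" for d t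
    by (rule fun_cong[OF tensor_ext])
      (auto intro!: clin clinear_compose[OF clinear_comult_fst[OF lin]] clinear_comult_fst[OF lin]
        simp: lin mult_tensor_mult embed_mult)
  have fst_right: "comult_fst \<Delta> (mult_right (1 \<otimes>\<^sub>M embed d) t) = comult_fst \<Delta> t * (1 \<otimes>\<^sub>M embed d)" for d t
    by (rule fun_cong[OF tensor_ext])
      (auto intro!: clin clinear_compose[OF clinear_comult_fst[OF lin]] clinear_comult_fst[OF lin]
        simp: lin mult_tensor_mult embed_mult)
  have snd_left: "comult_snd \<Delta> (mult_left (embed d \<otimes>\<^sub>M 1) t) = (embed d \<otimes>\<^sub>M 1) * comult_snd \<Delta> t" for d t
    by (rule fun_cong[OF tensor_ext])
      (auto intro!: clin clinear_compose[OF clinear_comult_snd[OF lin]] clinear_comult_snd[OF lin]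
        simp: lin mult_tensor_mult embed_mult)
  have snd_right: "comult_snd \<Delta> (mult_right (embed d \<otimes>\<^sub>M 1) t) = comult_snd \<Delta> t * (embed d \<otimes>\<^sub>M 1)" for d t
    by (rule fun_cong[OF tensor_ext])
      (auto intro!: clin clinear_compose[OF clinear_comult_snd[OF lin]] clinear_comult_snd[OF lin]
        simp: lin mult_tensor_mult embed_mult)
  note unem = embed_unembed[OF range(1)] embed_unembed[OF range(2)] embed_unembed[OF range(3)]
    embed_unembed[OF range(4)]
  \<comment> \<open>Both sides are (1 \<otimes> a)\<Delta>(b)(1 \<otimes> y). In the same way
    \<open>t23\<close> reads (x \<otimes> 1)\<Delta>(b)(c \<otimes> 1) in two ways. These identities
    exchange the products in the goal for those in the assumption.\<close>
  have t14: "mult_right (1 \<otimes>\<^sub>M embed y) (unembed (can4 \<Delta> a b)) =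
      mult_left (1 \<otimes>\<^sub>M embed a) (unembed (can1 \<Delta> b y))" for y
    by (subst embed_inject[symmetric], subst embed_mult_right[symmetric], subst mult_embed[symmetric])
      (simp add: unem, simp add: can1_def can4_def mult.assoc)
  have t23: "mult_right (embed c \<otimes>\<^sub>M 1) (unembed (can2 \<Delta> x b)) =
      mult_left (embed x \<otimes>\<^sub>M 1) (unembed (can3 \<Delta> b c))" for x
    by (subst embed_inject[symmetric], subst embed_mult_right[symmetric], subst mult_embed[symmetric])
      (simp add: unem, simp add: can2_def can3_def mult.assoc)
  have key: "((embed x \<otimes>\<^sub>M 1) \<otimes>\<^sub>M 1) * ?X * (1 \<otimes>\<^sub>M embed y) = ((embed x \<otimes>\<^sub>M 1) \<otimes>\<^sub>M 1) * ?Y * (1 \<otimes>\<^sub>M embed y)" for x y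
  proof -
    have "((embed x \<otimes>\<^sub>M 1) \<otimes>\<^sub>M 1) * ?X * (1 \<otimes>\<^sub>M embed y) =
        ((embed x \<otimes>\<^sub>M 1) \<otimes>\<^sub>M 1) * (comult_fst \<Delta> (unembed (can4 \<Delta> a b)) * (1 \<otimes>\<^sub>M embed y)) *
          ((embed c \<otimes>\<^sub>M 1) \<otimes>\<^sub>M 1)"
      by (simp add: mult.assoc mult_tensor_mult)
    also have "\<dots> = (((embed x \<otimes>\<^sub>M 1) \<otimes>\<^sub>M 1) * (1 \<otimes>\<^sub>M embed a)) * comult_fst \<Delta> (unembed (can1 \<Delta> b y)) *
          ((embed c \<otimes>\<^sub>M 1) \<otimes>\<^sub>M 1)"
      unfolding fst_right[symmetric] t14 fst_left by (simp add: mult.assoc)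
    also have "\<dots> = (1 \<otimes>\<^sub>M embed a) * (((embed x \<otimes>\<^sub>M 1) \<otimes>\<^sub>M 1) * comult_fst \<Delta> (unembed (can1 \<Delta> b y))) *
          ((embed c \<otimes>\<^sub>M 1) \<otimes>\<^sub>M 1)"
      by (simp add: mult.assoc[symmetric] mult_tensor_mult)
    also have "\<dots> = (1 \<otimes>\<^sub>M embed a) * ?A (comult_snd \<Delta> (unembed (can2 \<Delta> x b))) *
          ((1 \<otimes>\<^sub>M embed y) * ((embed c \<otimes>\<^sub>M 1) \<otimes>\<^sub>M 1))"
      unfolding coassoc by (simp add: mult.assoc)
    also have "(1 \<otimes>\<^sub>M embed y) * ((embed c \<otimes>\<^sub>M (1 :: 'a multiplier)) \<otimes>\<^sub>M 1) = ((embed c \<otimes>\<^sub>M 1) \<otimes>\<^sub>M 1) * (1 \<otimes>\<^sub>M embed y)"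
      by (simp add: mult_tensor_mult)
    also have "(1 \<otimes>\<^sub>M embed a) * ?A (comult_snd \<Delta> (unembed (can2 \<Delta> x b))) *
          (((embed c \<otimes>\<^sub>M 1) \<otimes>\<^sub>M 1) * (1 \<otimes>\<^sub>M embed y)) =
        (1 \<otimes>\<^sub>M embed a) * ?A (comult_snd \<Delta> (unembed (can2 \<Delta> x b)) * (embed c \<otimes>\<^sub>M 1)) * (1 \<otimes>\<^sub>M embed y)"
      by (simp add: A A1 mult.assoc)
    also have "\<dots> = ((1 \<otimes>\<^sub>M embed a) * ((embed x \<otimes>\<^sub>M 1) \<otimes>\<^sub>M 1)) *
        ?A (comult_snd \<Delta> (unembed (can3 \<Delta> b c))) * (1 \<otimes>\<^sub>M embed y)"
      unfolding snd_right[symmetric] t23 snd_left by (simp add: A A1 mult.assoc)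
    also have "(1 \<otimes>\<^sub>M embed a) * ((embed x \<otimes>\<^sub>M (1 :: 'a multiplier)) \<otimes>\<^sub>M 1) = ((embed x \<otimes>\<^sub>M 1) \<otimes>\<^sub>M 1) * (1 \<otimes>\<^sub>M embed a)"
      by (simp add: mult_tensor_mult)
    finally show ?thesis by (simp add: mult.assoc)
  qed
  show "?Y = ?X"
  proof (rule multiplier_tensor_eqI3)
    fix x y z :: 'a
    \<comment> \<open>The elementary tensors are factored so that the pieces next to m are x' in the
      first leg and z in the third, which is where \<open>key\<close> applies.\<close>
    have *: "embed ((x' \<otimes>\<^sub>C y') \<otimes>\<^sub>C z') * (m * embed ((x \<otimes>\<^sub>C y) \<otimes>\<^sub>C z)) =
        ((1 \<otimes>\<^sub>M embed y') \<otimes>\<^sub>M embed z') * (((embed x' \<otimes>\<^sub>M 1) \<otimes>\<^sub>M 1) * m * (1 \<otimes>\<^sub>M embed z)) *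
          embed (x \<otimes>\<^sub>C y) \<otimes>\<^sub>M 1" for m x' y' z'
    proof -
      have l: "embed ((x' \<otimes>\<^sub>C y') \<otimes>\<^sub>C z') = ((1 \<otimes>\<^sub>M embed y') \<otimes>\<^sub>M embed z') * ((embed x' \<otimes>\<^sub>M 1) \<otimes>\<^sub>M 1)"
        by (simp add: embed_tensor mult_tensor_mult)
      have r: "embed ((x \<otimes>\<^sub>C y) \<otimes>\<^sub>C z) = (1 \<otimes>\<^sub>M embed z) * (embed (x \<otimes>\<^sub>C y) \<otimes>\<^sub>M 1)"
        by (simp add: embed_tensor mult_tensor_mult)
      show ?thesis unfolding l r by (simp only: mult.assoc)
    qed
    have "embed ((x' \<otimes>\<^sub>C y') \<otimes>\<^sub>C z') * (?Y * embed ((x \<otimes>\<^sub>C y) \<otimes>\<^sub>C z)) =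
        embed ((x' \<otimes>\<^sub>C y') \<otimes>\<^sub>C z') * (?X * embed ((x \<otimes>\<^sub>C y) \<otimes>\<^sub>C z))" for x' y' z'
      unfolding * key ..
    then have eq: "((x' \<otimes>\<^sub>C y') \<otimes>\<^sub>C z') * mult_left ?Y ((x \<otimes>\<^sub>C y) \<otimes>\<^sub>C z) =
        ((x' \<otimes>\<^sub>C y') \<otimes>\<^sub>C z') * mult_left ?X ((x \<otimes>\<^sub>C y) \<otimes>\<^sub>C z)" for x' y' z'
      by (simp only: mult_embed embed_inject mult_left_simps(4))
    have "(\<lambda>t. t * mult_left ?Y ((x \<otimes>\<^sub>C y) \<otimes>\<^sub>C z)) = (\<lambda>t. t * mult_left ?X ((x \<otimes>\<^sub>C y) \<otimes>\<^sub>C z))"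
      by (rule tensor_ext3) (simp_all only: eq clin)
    then have "t * (mult_left ?Y ((x \<otimes>\<^sub>C y) \<otimes>\<^sub>C z) - mult_left ?X ((x \<otimes>\<^sub>C y) \<otimes>\<^sub>C z)) = 0" for t
      by (simp add: right_diff_distrib fun_eq_iff)
    then show "mult_left ?Y ((x \<otimes>\<^sub>C y) \<otimes>\<^sub>C z) = mult_left ?X ((x \<otimes>\<^sub>C y) \<otimes>\<^sub>C z)"
      using nondegenerate_right eq_iff_diff_eq_0 by blast
  qed
qed

lemma can_op:
  fixes \<Delta> :: "'a::nondegenerate_complex_algebra \<Rightarrow> ('a, 'a) tensor multiplier"
  shows "can1 (mult_map tensor_flip \<circ> \<Delta>) a b = mult_map tensor_flip (can3 \<Delta> a b)"
    and "can2 (mult_map tensor_flip \<circ> \<Delta>) a b = mult_map tensor_flip (can4 \<Delta> a b)"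
  unfolding can1_def can2_def can3_def can4_def
  by (simp_all add: mult_map_mult algebra_hom_tensor_flip bij_tensor_flip mult_map_flip)

lemma mult_map_range_embed:
  fixes \<gamma> :: "'a::nondegenerate_complex_algebra \<Rightarrow> 'b::nondegenerate_complex_algebra"
  assumes "algebra_hom \<gamma>" "bij \<gamma>"
  shows "mult_map \<gamma> m \<in> range embed \<longleftrightarrow> m \<in> range embed"
    and "m \<in> range embed \<Longrightarrow> unembed (mult_map \<gamma> m) = \<gamma> (unembed m)"
proof
  assume "mult_map \<gamma> m \<in> range embed"
  then obtain y where y: "mult_map \<gamma> m = embed y" by blast
  obtain x where x: "y = \<gamma> x" using assms(2) by (metis bij_pointE)
  have "\<gamma> (mult_left m z) = \<gamma> (x * z)" for z
    using mult_left_map(1)[OF assms, of m z] by (simp add: y x algebra_hom_mult[OF assms(1)])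
  then have "m = embed x"
    by (intro multiplier_eqI) (simp add: bij_is_inj[OF assms(2), THEN injD])
  then show "m \<in> range embed" by blast
qed (auto simp: mult_map_embed[OF assms])

text \<open>The canonical maps of the opposite comultiplication are the third and fourth ones of
  \<Delta> followed by the flip, so bijectivity transfers. Its coassociativity comes for free: it is
  \<open>coassociativity_op\<close> with the three legs reversed. Regularity of the deformation is
  later proved through this criterion.\<close>

theorem regular_multiplier_hopf_iff:
  fixes \<Delta> :: "'a::nondegenerate_complex_algebra \<Rightarrow> ('a, 'a) tensor multiplier"
  shows "regular_multiplier_hopf \<Delta> \<longleftrightarrow> multiplier_hopf \<Delta> \<and>
    (\<forall>a b. can3 \<Delta> a b \<in> range embed \<and> can4 \<Delta> a b \<in> range embed) \<and>
    bij (galois (can3 \<Delta>)) \<and> bij (galois (can4 \<Delta>))"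
    (is "_ \<longleftrightarrow> ?rhs")
proof -
  let ?F = "mult_map (tensor_flip :: ('a, 'a) tensor \<Rightarrow> _)"
  let ?op = "?F \<circ> \<Delta>"
  note flip = algebra_hom_tensor_flip[where 'a = 'a and 'b = 'a] bij_tensor_flip[where 'a = 'a and 'b = 'a]
  note flip3 = algebra_hom_tensor_flip3[where 'a = 'a and 'b = 'a and 'c = 'a]
    bij_tensor_flip3[where 'a = 'a and 'b = 'a and 'c = 'a]
  note assoc = algebra_hom_tensor_assoc[where 'a = 'a and 'b = 'a and 'c = 'a]
    bij_tensor_assoc[where 'a = 'a and 'b = 'a and 'c = 'a]
  have op_range: "can1 ?op a b \<in> range embed \<longleftrightarrow> can3 \<Delta> a b \<in> range embed"
    "can2 ?op a b \<in> range embed \<longleftrightarrow> can4 \<Delta> a b \<in> range embed" for a b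
    by (simp_all only: can_op mult_map_range_embed[OF flip])
  have op_galois: "galois (can1 ?op) = tensor_flip \<circ> galois (can3 \<Delta>)"
      "galois (can2 ?op) = tensor_flip \<circ> galois (can4 \<Delta>)"
    if lin: "clinear \<Delta>" and range: "\<And>a b. can3 \<Delta> a b \<in> range embed" "\<And>a b. can4 \<Delta> a b \<in> range embed"
  proof -
    have op: "clinear ?op"
      by (intro clinear_comp clinear_mult_map flip lin)
    note c = cbilinear_can1[OF op] cbilinear_can2[OF op] cbilinear_can3[OF lin] cbilinear_can4[OF lin]
    have r: "\<And>a b. can1 ?op a b \<in> range embed" "\<And>a b. can2 ?op a b \<in> range embed"
      using range by (simp_all only: op_range)
    show "galois (can1 ?op) = tensor_flip \<circ> galois (can3 \<Delta>)"
      by (rule tensor_ext)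
        (simp_all add: clin clinear_galois[OF c(1) r(1)] clinear_galois[OF c(3) range(1)]
          galois_tensor[OF c(1) r(1)] galois_tensor[OF c(3) range(1)],
         simp only: can_op mult_map_range_embed(2)[OF flip range(1)])
    show "galois (can2 ?op) = tensor_flip \<circ> galois (can4 \<Delta>)"
      by (rule tensor_ext)
        (simp_all add: clin clinear_galois[OF c(2) r(2)] clinear_galois[OF c(4) range(2)]
          galois_tensor[OF c(2) r(2)] galois_tensor[OF c(4) range(2)],
         simp only: can_op mult_map_range_embed(2)[OF flip range(2)])
  qed
  have bij_flip_comp: "bij (tensor_flip \<circ> f) \<longleftrightarrow> bij f" for f :: "('a, 'a) tensor \<Rightarrow> ('a, 'a) tensor"
    by (metis bij_comp bij_tensor_flip comp_assoc id_comp tensor_flip_flip)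
  have bijs: "bij (tensor_lift (\<lambda>a b. unembed (can1 D a b))) = bij (galois (can1 D))"
    "bij (tensor_lift (\<lambda>a b. unembed (can2 D a b))) = bij (galois (can2 D))" for D :: "'a \<Rightarrow> _"
    by (simp_all add: galois_def)
  show ?thesis
  proof
    assume *: "regular_multiplier_hopf \<Delta>"
    then have lin: "clinear \<Delta>"
      by (auto simp: regular_multiplier_hopf_def multiplier_hopf_def comultiplication_def algebra_hom_clinear)
    have range: "\<And>a b. can3 \<Delta> a b \<in> range embed" "\<And>a b. can4 \<Delta> a b \<in> range embed"
      using * unfolding regular_multiplier_hopf_def multiplier_hopf_def comultiplication_def op_range
      by blast+
    have "bij (galois (can1 ?op))" "bij (galois (can2 ?op))"
      using * unfolding regular_multiplier_hopf_def multiplier_hopf_def bijs by blast+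
    then show ?rhs
      using * range unfolding op_galois[OF lin range] bij_flip_comp regular_multiplier_hopf_def by blast
  next
    assume rhs: ?rhs
    then have com: "comultiplication \<Delta>"
      by (simp add: multiplier_hopf_def)
    then have hom: "algebra_hom \<Delta>"
      and range: "\<And>a b. can1 \<Delta> a b \<in> range embed" "\<And>a b. can2 \<Delta> a b \<in> range embed"
      and coassoc: "\<And>a b c. ((embed a \<otimes>\<^sub>M 1) \<otimes>\<^sub>M 1) * comult_fst \<Delta> (unembed (can1 \<Delta> b c)) =
        mult_map tensor_assoc (comult_snd \<Delta> (unembed (can2 \<Delta> a b))) * (1 \<otimes>\<^sub>M embed c)"
      unfolding comultiplication_def comult_fst_def comult_snd_def by blast+
    have range': "\<And>a b. can3 \<Delta> a b \<in> range embed" "\<And>a b. can4 \<Delta> a b \<in> range embed"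
      using rhs by blast+
    have lin: "clinear \<Delta>" using hom by (rule algebra_hom_clinear)
    have hom_op: "algebra_hom ?op"
      by (intro algebra_hom_compose algebra_hom_mult_map flip hom)
    define D where "D = ?op"
    have D: "D x = ?F (\<Delta> x)" for x by (simp add: D_def)
    have lin_op: "clinear D" unfolding D_def using hom_op by (rule algebra_hom_clinear)
    \<comment> \<open>After a flip, applying the opposite comultiplication to the first leg is the
      three-leg reversal of applying \<Delta> to the second; \<open>snd_op\<close> is the mirror
      image.\<close>
    have fst_op: "comult_fst D (tensor_flip t) =
        mult_map tensor_flip3 (mult_map tensor_assoc (comult_snd \<Delta> t))" for t
    proof -
      have aux: "mult_map tensor_flip3 (mult_map tensor_assoc (embed x \<otimes>\<^sub>M m)) = ?F m \<otimes>\<^sub>M embed x"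
        for x :: 'a and m
      proof -
        have "mult_map tensor_flip3 (?F m \<otimes>\<^sub>M embed x) = mult_map tensor_assoc (embed x \<otimes>\<^sub>M m)"
          unfolding mult_map_flip3 by (simp add: mult_map_compose flip tensor_flip_flip)
        then show ?thesis
          by (metis mult_map_compose[OF flip3 flip3] mult_map_id tensor_flip3_flip3)
      qed
      note aux' = aux[of _ "\<Delta> _", folded D]
      show ?thesis
        by (rule fun_cong[OF tensor_ext])
          (auto intro!: clin clinear_compose[OF clinear_comult_fst[OF lin_op]] clinear_comult_snd[OF lin]
            clinear_compose[OF clinear_mult_map[OF flip3]] clinear_compose[OF clinear_mult_map[OF assoc]]
            simp: lin lin_op aux')
    qed
    have snd_op: "mult_map tensor_assoc (comult_snd D (tensor_flip t)) =
        mult_map tensor_flip3 (comult_fst \<Delta> t)" for t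
      by (rule fun_cong[OF tensor_ext])
        (auto intro!: clin clinear_compose[OF clinear_comult_snd[OF lin_op]] clinear_comult_fst[OF lin]
          clinear_compose[OF clinear_mult_map[OF flip3]] clinear_compose[OF clinear_mult_map[OF assoc]]
          simp: lin lin_op mult_map_flip3[of "\<Delta> _", folded D])
    have one: "mult_map tensor_flip3 ((1 :: ('a, 'a) tensor multiplier) \<otimes>\<^sub>M embed a) = (embed a \<otimes>\<^sub>M 1) \<otimes>\<^sub>M 1"
      "mult_map tensor_flip3 ((embed a \<otimes>\<^sub>M (1 :: 'a multiplier)) \<otimes>\<^sub>M (1 :: 'a multiplier)) = 1 \<otimes>\<^sub>M embed a" for a :: 'a
    proof -
      have "mult_map tensor_flip3 ((1 :: ('a, 'a) tensor multiplier) \<otimes>\<^sub>M embed a) =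
          mult_map tensor_assoc (embed a \<otimes>\<^sub>M (1 \<otimes>\<^sub>M 1))"
        by (simp only: mult_map_flip3 mult_map_one[OF flip] mult_tensor_one)
      then show "mult_map tensor_flip3 ((1 :: ('a, 'a) tensor multiplier) \<otimes>\<^sub>M embed a) = (embed a \<otimes>\<^sub>M 1) \<otimes>\<^sub>M 1"
        by (simp only: mult_map_assoc)
      show "mult_map tensor_flip3 ((embed a \<otimes>\<^sub>M (1 :: 'a multiplier)) \<otimes>\<^sub>M (1 :: 'a multiplier)) = 1 \<otimes>\<^sub>M embed a"
        by (simp only: mult_map_flip3 mult_map_flip mult_map_assoc mult_tensor_one)
    qed
    have "((embed a \<otimes>\<^sub>M 1) \<otimes>\<^sub>M 1) * comult_fst ?op (unembed (can1 ?op b c)) =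
        mult_map tensor_assoc (comult_snd ?op (unembed (can2 ?op a b))) * (1 \<otimes>\<^sub>M embed c)" for a b c
      unfolding can_op mult_map_range_embed(2)[OF flip range'(1)] mult_map_range_embed(2)[OF flip range'(2)]
        fst_op[unfolded D_def] snd_op[unfolded D_def]
      using arg_cong[OF coassociativity_op[OF lin range range' coassoc, of a b c], of "mult_map tensor_flip3"]
      by (simp only: mult_map_mult[OF flip3] one)
    then have "comultiplication ?op"
      using hom_op range' op_range unfolding comultiplication_def comult_fst_def comult_snd_def by blast
    moreover have "bij (galois (can1 ?op))" "bij (galois (can2 ?op))"
      unfolding op_galois[OF lin range'] bij_flip_comp using rhs by blast+
    ultimately show "regular_multiplier_hopf \<Delta>"
      using rhs unfolding regular_multiplier_hopf_def multiplier_hopf_def bijs by blast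
  qed
qed

lemma is_antipode_clinear:
  fixes S :: "'a::nondegenerate_complex_algebra \<Rightarrow> 'a multiplier"
  assumes "clinear S"
  shows "clinear (\<lambda>t. tensor_lift (*) (tensor_map S embed t))"
    and "clinear (\<lambda>t. tensor_lift (*) (tensor_map embed S t))"
    and "tensor_lift (*) (tensor_map S embed (x \<otimes>\<^sub>C y)) = S x * embed y"
    and "tensor_lift (*) (tensor_map embed S (x \<otimes>\<^sub>C y)) = embed x * S y"
proof -
  have *: "cbilinear ((*) :: 'a multiplier \<Rightarrow> _)"
    by (intro cbilinearI clin)
  have e: "clinear (embed :: 'a \<Rightarrow> 'a multiplier)"
    using clinear_embed[OF clinear_id(1)] .
  show "clinear (\<lambda>t. tensor_lift (*) (tensor_map S embed t))"
    "clinear (\<lambda>t. tensor_lift (*) (tensor_map embed S t))"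
    by (intro clinear_compose[OF clinear_tensor_lift] * tensor_map_clinear assms e)+
  show "tensor_lift (*) (tensor_map S embed (x \<otimes>\<^sub>C y)) = S x * embed y"
    "tensor_lift (*) (tensor_map embed S (x \<otimes>\<^sub>C y)) = embed x * S y"
    by (simp_all add: tensor_map_tensor assms e tensor_lift_apply[OF *])
qed

section \<open>Uniqueness of counit and antipode, and invariance read off from canonical
  products\<close>

locale regular_hopf =
  fixes \<Delta> :: "'a::nondegenerate_complex_algebra \<Rightarrow> ('a, 'a) tensor multiplier"
  assumes regular: "regular_multiplier_hopf \<Delta>"
begin

lemma hopf: "multiplier_hopf \<Delta>"
  using regular by (simp add: regular_multiplier_hopf_def)

lemma hom: "algebra_hom \<Delta>"
  using hopf by (simp add: multiplier_hopf_def comultiplication_def)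

lemma lin: "clinear \<Delta>"
  by (rule algebra_hom_clinear[OF hom])

lemma range1: "can1 \<Delta> a b \<in> range embed" and range2: "can2 \<Delta> a b \<in> range embed"
  using hopf by (simp_all add: multiplier_hopf_def comultiplication_def)

lemma range3: "can3 \<Delta> a b \<in> range embed" and range4: "can4 \<Delta> a b \<in> range embed"
  using regular by (simp_all add: regular_multiplier_hopf_iff)

lemma coassoc:
  "((embed a \<otimes>\<^sub>M 1) \<otimes>\<^sub>M 1) * comult_fst \<Delta> (unembed (can1 \<Delta> b c)) =
    mult_map tensor_assoc (comult_snd \<Delta> (unembed (can2 \<Delta> a b))) * (1 \<otimes>\<^sub>M embed c)"
  using hopf by (simp add: multiplier_hopf_def comultiplication_def comult_fst_def comult_snd_def)

lemma
  shows clinear_galois1: "clinear (galois (can1 \<Delta>))"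
    and clinear_galois2: "clinear (galois (can2 \<Delta>))"
    and clinear_galois3: "clinear (galois (can3 \<Delta>))"
    and clinear_galois4: "clinear (galois (can4 \<Delta>))"
  by (intro clinear_galois cbilinear_can1 cbilinear_can2 cbilinear_can3 cbilinear_can4
      lin range1 range2 range3 range4)+

lemma
  shows galois1_tensor: "galois (can1 \<Delta>) (a \<otimes>\<^sub>C b) = unembed (can1 \<Delta> a b)"
    and galois2_tensor: "galois (can2 \<Delta>) (a \<otimes>\<^sub>C b) = unembed (can2 \<Delta> a b)"
    and galois3_tensor: "galois (can3 \<Delta>) (a \<otimes>\<^sub>C b) = unembed (can3 \<Delta> a b)"
    and galois4_tensor: "galois (can4 \<Delta>) (a \<otimes>\<^sub>C b) = unembed (can4 \<Delta> a b)"
  by (intro galois_tensor cbilinear_can1 cbilinear_can2 cbilinear_can3 cbilinear_can4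
      lin range1 range2 range3 range4)+

lemma
  shows bij_galois1: "bij (galois (can1 \<Delta>))" and bij_galois2: "bij (galois (can2 \<Delta>))"
    and bij_galois3: "bij (galois (can3 \<Delta>))" and bij_galois4: "bij (galois (can4 \<Delta>))"
  using hopf regular by (simp_all add: multiplier_hopf_def galois_def regular_multiplier_hopf_iff)

lemmas embed_can1 = embed_unembed[OF range1, unfolded can1_def]
lemmas embed_can2 = embed_unembed[OF range2, unfolded can2_def]
lemmas embed_can3 = embed_unembed[OF range3, unfolded can3_def]
lemmas embed_can4 = embed_unembed[OF range4, unfolded can4_def]

text \<open>Surjectivity of the first canonical map: the elements \<Delta>(a)(1 \<otimes> b) span
  the tensor square.\<close>

lemma galois1_induct [consumes 0, case_names zero add galois]:
  assumes "P 0" "\<And>s t. P s \<Longrightarrow> P t \<Longrightarrow> P (s + t)" "\<And>a b. P (unembed (can1 \<Delta> a b))"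
  shows "P t"
proof -
  have "P (galois (can1 \<Delta>) s)" for s
    by (induction s)
      (simp_all add: clinear_zero[OF clinear_galois1] clinear_add[OF clinear_galois1] galois1_tensor assms)
  then show ?thesis
    by (metis bij_galois1 bij_pointE)
qed

lemma galois1_ext:
  assumes "clinear f" "clinear g" "\<And>a b. f (unembed (can1 \<Delta> a b)) = g (unembed (can1 \<Delta> a b))"
  shows "f = g"
proof
  fix t
  show "f t = g t"
    by (induction t rule: galois1_induct)
      (simp_all add: clinear_zero[OF assms(1)] clinear_zero[OF assms(2)] clinear_add[OF assms(1)]
        clinear_add[OF assms(2)] assms(3))
qed

text \<open>The identity fixes \<epsilon> \<otimes> \<iota> on the spanning elements \<Delta>(a)(1
  \<otimes> b), hence on a \<otimes> y, where its value is \<epsilon>(a) y.\<close>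

lemma counit_unique:
  assumes "clinear \<epsilon>" "clinear \<epsilon>'"
    and eq: "\<And>a b. slice_fst \<epsilon> (unembed (can1 \<Delta> a b)) = a * b"
      "\<And>a b. slice_fst \<epsilon>' (unembed (can1 \<Delta> a b)) = a * b"
  shows "\<epsilon> = \<epsilon>'"
proof
  fix a
  have slice: "(slice_fst \<epsilon> :: ('a, 'a) tensor \<Rightarrow> 'a) = slice_fst \<epsilon>'"
    by (rule galois1_ext) (simp_all add: clinear_slice_fst assms(1,2) eq)
  show "\<epsilon> a = \<epsilon>' a"
  proof (cases "\<exists>y :: 'a. y \<noteq> 0")
    case True
    then obtain y :: 'a where "y \<noteq> 0" by blast
    moreover have "\<epsilon> a *\<^sub>C y = \<epsilon>' a *\<^sub>C y"
      using fun_cong[OF slice, of "a \<otimes>\<^sub>C y"] by (simp add: slice_fst_tensor assms(1,2))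
    ultimately show ?thesis
      by (simp add: cvec.scale_right_imp_eq)
  next
    \<comment> \<open>The zero algebra is non-degenerate as well and has to be treated here.\<close>
    case False
    then have "a = 0" by blast
    then show ?thesis by (simp add: clinear_zero assms(1,2))
  qed
qed

text \<open>As for the counit: m(S \<otimes> \<iota>) is fixed on a spanning set, hence on a
  \<otimes> y, and this gives the left action of S(a).\<close>

lemma antipode_unique:
  assumes "clinear S" "clinear S'"
    and eq: "\<And>a b. tensor_lift (*) (tensor_map S embed (unembed (can1 \<Delta> a b))) = embed (\<epsilon> a *\<^sub>C b)"
      "\<And>a b. tensor_lift (*) (tensor_map S' embed (unembed (can1 \<Delta> a b))) = embed (\<epsilon> a *\<^sub>C b)"
  shows "S = S'"
proof
  fix a
  have *: "(\<lambda>t. tensor_lift (*) (tensor_map S embed t)) = (\<lambda>t. tensor_lift (*) (tensor_map S' embed t))"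
    by (rule galois1_ext) (simp_all add: is_antipode_clinear assms(1,2) eq)
  have "S a * embed y = S' a * embed y" for y
    using fun_cong[OF *, of "a \<otimes>\<^sub>C y"] by (simp add: is_antipode_clinear assms(1,2))
  then show "S a = S' a"
    by (intro multiplier_eqI) (simp add: mult_embed)
qed

lemma slice_snd_mult:
  fixes t :: "('a, 'a) tensor"
  assumes "clinear f"
  shows "slice_snd f (mult_left (embed b \<otimes>\<^sub>M 1) t) = b * slice_snd f t"
    and "slice_snd f (mult_right (embed b \<otimes>\<^sub>M 1) t) = slice_snd f t * b"
proof -
  show "slice_snd f (mult_left (embed b \<otimes>\<^sub>M 1) t) = b * slice_snd f t"
    by (rule fun_cong[OF tensor_ext])
      (auto intro!: clin clinear_compose[OF clinear_slice_snd] clinear_slice_snd simp: assms slice_snd_tensor)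
  show "slice_snd f (mult_right (embed b \<otimes>\<^sub>M 1) t) = slice_snd f t * b"
    by (rule fun_cong[OF tensor_ext])
      (auto intro!: clin clinear_compose[OF clinear_slice_snd] clinear_slice_snd simp: assms slice_snd_tensor)
qed

lemma slice_fst_mult:
  fixes t :: "('a, 'a) tensor"
  assumes "clinear f"
  shows "slice_fst f (mult_left (1 \<otimes>\<^sub>M embed b) t) = b * slice_fst f t"
    and "slice_fst f (mult_right (1 \<otimes>\<^sub>M embed b) t) = slice_fst f t * b"
proof -
  show "slice_fst f (mult_left (1 \<otimes>\<^sub>M embed b) t) = b * slice_fst f t"
    by (rule fun_cong[OF tensor_ext])
      (auto intro!: clin clinear_compose[OF clinear_slice_fst] clinear_slice_fst simp: assms slice_fst_tensor)
  show "slice_fst f (mult_right (1 \<otimes>\<^sub>M embed b) t) = slice_fst f t * b"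
    by (rule fun_cong[OF tensor_ext])
      (auto intro!: clin clinear_compose[OF clinear_slice_fst] clinear_slice_fst simp: assms slice_fst_tensor)
qed

text \<open>A slice of \<Delta>(a) is introduced through \<open>Abs_multiplier\<close>, so its two
  actions must first be shown to form a double centralizer. Equality with a scalar is then tested on
  the right action alone, which involves (b \<otimes> 1)\<Delta>(a).\<close>

lemma left_invariant_iff:
  "left_invariant \<Delta> f \<longleftrightarrow>
     clinear f \<and> (\<forall>a b. slice_snd f (unembed (can2 \<Delta> b a)) = f a *\<^sub>C b)"
proof (cases "clinear f")
  case f: True
  let ?L = "\<lambda>a b. slice_snd f (unembed (\<Delta> a * (embed b \<otimes>\<^sub>M 1)))"
  let ?R = "\<lambda>a b. slice_snd f (unembed ((embed b \<otimes>\<^sub>M 1) * \<Delta> a))"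
  have "double_centralizer (?L a) (?R a)" for a
    unfolding double_centralizer_def
  proof (intro conjI allI)
    show "clinear (?L a)" "clinear (?R a)"
      using range2[of _ a] range3[of a] unfolding can2_def can3_def
      by (intro clinear_compose[OF clinear_slice_snd[OF f]] clinear_unembed clin; blast)+
    fix b c
    have "unembed (\<Delta> a * (embed (b * c) \<otimes>\<^sub>M 1)) =
        mult_right (embed c \<otimes>\<^sub>M 1) (unembed (\<Delta> a * (embed b \<otimes>\<^sub>M 1)))"
      unfolding embed_inject[symmetric] embed_mult_right[symmetric] embed_can3
      by (simp add: mult.assoc mult_tensor_mult embed_mult)
    then show "?L a (b * c) = ?L a b * c"
      by (simp add: slice_snd_mult f)
    have "unembed ((embed (b * c) \<otimes>\<^sub>M 1) * \<Delta> a) =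
        mult_left (embed b \<otimes>\<^sub>M 1) (unembed ((embed c \<otimes>\<^sub>M 1) * \<Delta> a))"
      unfolding embed_inject[symmetric] mult_embed[symmetric] embed_can2
      by (simp add: mult.assoc[symmetric] mult_tensor_mult embed_mult)
    then show "?R a (b * c) = b * ?R a c"
      by (simp add: slice_snd_mult f)
    have "mult_left (embed b \<otimes>\<^sub>M 1) (unembed (\<Delta> a * (embed c \<otimes>\<^sub>M 1))) =
        mult_right (embed c \<otimes>\<^sub>M 1) (unembed ((embed b \<otimes>\<^sub>M 1) * \<Delta> a))"
      unfolding embed_inject[symmetric] mult_embed[symmetric] embed_mult_right[symmetric]
        embed_can2 embed_can3
      by (simp add: mult.assoc)
    then show "b * ?L a c = ?R a b * c"
      by (metis slice_snd_mult f)
  qed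
  then have "mult_right (slice_right \<Delta> f a) = ?R a" for a
    unfolding slice_right_def by (rule mult_right_Abs)
  then have "slice_right \<Delta> f a = f a *\<^sub>C 1 \<longleftrightarrow> (\<forall>b. ?R a b = f a *\<^sub>C b)" for a
    by (metis multiplier_eqI_right mult_right_scale mult_right_simps(2))
  then show ?thesis
    by (simp add: left_invariant_def f can2_def)
qed (simp add: left_invariant_def)

text \<open>The argument for left invariance with the legs exchanged, tested on the left action
  because \<open>can1\<close> multiplies from the right.\<close>

lemma right_invariant_iff:
  "right_invariant \<Delta> f \<longleftrightarrow>
     clinear f \<and> (\<forall>a b. slice_fst f (unembed (can1 \<Delta> a b)) = f a *\<^sub>C b)"
proof (cases "clinear f")
  case f: True
  let ?L = "\<lambda>a b. slice_fst f (unembed (\<Delta> a * (1 \<otimes>\<^sub>M embed b)))"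
  let ?R = "\<lambda>a b. slice_fst f (unembed ((1 \<otimes>\<^sub>M embed b) * \<Delta> a))"
  have "double_centralizer (?L a) (?R a)" for a
    unfolding double_centralizer_def
  proof (intro conjI allI)
    show "clinear (?L a)" "clinear (?R a)"
      using range1[of a] range4[of _ a] unfolding can1_def can4_def
      by (intro clinear_compose[OF clinear_slice_fst[OF f]] clinear_unembed clin; blast)+
    fix b c
    have "unembed (\<Delta> a * (1 \<otimes>\<^sub>M embed (b * c))) =
        mult_right (1 \<otimes>\<^sub>M embed c) (unembed (\<Delta> a * (1 \<otimes>\<^sub>M embed b)))"
      unfolding embed_inject[symmetric] embed_mult_right[symmetric] embed_can1
      by (simp add: mult.assoc mult_tensor_mult embed_mult)
    then show "?L a (b * c) = ?L a b * c"
      by (simp add: slice_fst_mult f)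
    have "unembed ((1 \<otimes>\<^sub>M embed (b * c)) * \<Delta> a) =
        mult_left (1 \<otimes>\<^sub>M embed b) (unembed ((1 \<otimes>\<^sub>M embed c) * \<Delta> a))"
      unfolding embed_inject[symmetric] mult_embed[symmetric] embed_can4
      by (simp add: mult.assoc[symmetric] mult_tensor_mult embed_mult)
    then show "?R a (b * c) = b * ?R a c"
      by (simp add: slice_fst_mult f)
    have "mult_left (1 \<otimes>\<^sub>M embed b) (unembed (\<Delta> a * (1 \<otimes>\<^sub>M embed c))) =
        mult_right (1 \<otimes>\<^sub>M embed c) (unembed ((1 \<otimes>\<^sub>M embed b) * \<Delta> a))"
      unfolding embed_inject[symmetric] mult_embed[symmetric] embed_mult_right[symmetric]
        embed_can1 embed_can4
      by (simp add: mult.assoc)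
    then show "b * ?L a c = ?R a b * c"
      by (metis slice_fst_mult f)
  qed
  then have "mult_left (slice_left \<Delta> f a) = ?L a" for a
    unfolding slice_left_def by (rule mult_left_Abs)
  then have "slice_left \<Delta> f a = f a *\<^sub>C 1 \<longleftrightarrow> (\<forall>b. ?L a b = f a *\<^sub>C b)" for a
    by (metis multiplier_eqI mult_left_scale mult_left_simps(2))
  then show ?thesis
    by (simp add: right_invariant_def f can1_def)
qed (simp add: right_invariant_def)

end

section \<open>Graded algebras\<close>

locale graded_algebra = group G for G :: "('g, 'm) monoid_scheme" (structure) +
  fixes B :: "'g \<Rightarrow> 'b::nondegenerate_complex_algebra set"
  assumes subspace: "p \<in> carrier G \<Longrightarrow> cvec.subspace (B p)"
    and closed: "p \<in> carrier G \<Longrightarrow> x \<in> B p \<Longrightarrow> y \<in> B p \<Longrightarrow> x * y \<in> B p"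
    and decomposition_unique: "\<exists>!f. decomposition G B b f"
    and orthogonal: "p \<in> carrier G \<Longrightarrow> q \<in> carrier G \<Longrightarrow> p \<noteq> q \<Longrightarrow> x \<in> B p \<Longrightarrow> y \<in> B q \<Longrightarrow> x * y = 0"
begin

lemma decomposition_component: "decomposition G B b (component G B b)"
  unfolding component_def by (rule theI'[OF decomposition_unique])

lemma component_eqI: "decomposition G B b f \<Longrightarrow> component G B b = f"
  using decomposition_component decomposition_unique by blast

lemma component_mem [simp]: "p \<in> carrier G \<Longrightarrow> component G B b p \<in> B p"
  and component_outside: "p \<notin> carrier G \<Longrightarrow> component G B b p = 0"
  and finite_component: "finite {p. component G B b p \<noteq> 0}"
  and sum_component: "(\<Sum>p | component G B b p \<noteq> 0. component G B b p) = b"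
  using decomposition_component[of b] unfolding decomposition_def by auto

lemma component_mem_carrier: "component G B b p \<noteq> 0 \<Longrightarrow> p \<in> carrier G"
  using component_outside by blast

lemma zero_mem [simp]: "p \<in> carrier G \<Longrightarrow> 0 \<in> B p"
  by (rule cvec.subspace_0[OF subspace])

lemma component_homogeneous:
  assumes "p \<in> carrier G" "b \<in> B p"
  shows "component G B b = (\<lambda>q. if q = p then b else 0)"
proof (rule component_eqI)
  have "{q. (if q = p then b else 0) \<noteq> 0} = (if b = 0 then {} else {p})" by auto
  then show "decomposition G B b (\<lambda>q. if q = p then b else 0)"
    using assms unfolding decomposition_def by auto
qed

lemma graded_induct [case_names zero add homogeneous]:
  assumes "P 0" "\<And>x y. P x \<Longrightarrow> P y \<Longrightarrow> P (x + y)" "\<And>p x. p \<in> carrier G \<Longrightarrow> x \<in> B p \<Longrightarrow> P x"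
  shows "P b"
proof -
  have "P (\<Sum>p\<in>K. component G B b p)" if "finite K" "K \<subseteq> carrier G" for K
    using that by (induction K) (use assms in auto)
  from this[OF finite_component[of b]] show ?thesis
    unfolding sum_component by (auto intro: component_mem_carrier)
qed

lemma graded_ext:
  assumes "clinear f" "clinear g" "\<And>p x. p \<in> carrier G \<Longrightarrow> x \<in> B p \<Longrightarrow> f x = g x"
  shows "f = g"
proof
  fix b
  show "f b = g b"
  proof (induction b rule: graded_induct)
    case (homogeneous p x)
    then show ?case by (rule assms(3))
  qed (simp_all add: clinear_zero[OF assms(1)] clinear_zero[OF assms(2)]
        clinear_add[OF assms(1)] clinear_add[OF assms(2)])
qed

section \<open>Linear maps defined degree by degree\<close>

definition glue :: "('g \<Rightarrow> 'b \<Rightarrow> 'v::complex_vector) \<Rightarrow> 'b \<Rightarrow> 'v" where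
  "glue f b = (\<Sum>p | component G B b p \<noteq> 0. f p (component G B b p))"

text \<open>Cancellation can shrink the support, whereas \<open>decomposition\<close> sums over
  exactly the nonzero values. The sums are therefore compared over a common finite index
  set.\<close>

lemma component_add: "component G B (x + y) p = component G B x p + component G B y p"
  and component_scale: "component G B (c *\<^sub>C x) p = c *\<^sub>C component G B x p"
proof -
  let ?S = "\<lambda>b. {p. component G B b p \<noteq> 0}"
  have eq: "b = (\<Sum>p\<in>K. component G B b p)" if "finite K" "?S b \<subseteq> K" for b K
    by (subst sum_component[symmetric]) (use that in \<open>auto intro!: sum.mono_neutral_left\<close>)
  let ?f = "\<lambda>p. component G B x p + component G B y p"
  have fin: "finite (?S x \<union> ?S y)" by (simp add: finite_component)
  have "x + y = (\<Sum>p\<in>?S x \<union> ?S y. ?f p)"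
    using eq[OF fin, of x] eq[OF fin, of y] by (simp add: sum.distrib)
  also have "\<dots> = (\<Sum>p | ?f p \<noteq> 0. ?f p)"
    by (rule sum.mono_neutral_right) (use fin in auto)
  finally have "decomposition G B (x + y) ?f"
    unfolding decomposition_def
    by (auto intro: cvec.subspace_add[OF subspace] finite_subset[OF _ fin] simp: component_outside)
  then show "component G B (x + y) p = component G B x p + component G B y p"
    by (simp add: component_eqI)
  let ?g = "\<lambda>p. c *\<^sub>C component G B x p"
  have "c *\<^sub>C x = (\<Sum>p\<in>?S x. ?g p)"
    by (subst (1) sum_component[of x, symmetric]) (rule cvec.scale_sum_right)
  also have "\<dots> = (\<Sum>p | ?g p \<noteq> 0. ?g p)"
    by (rule sum.mono_neutral_right) (auto simp: finite_component)
  finally have "decomposition G B (c *\<^sub>C x) ?g"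
    unfolding decomposition_def
    by (auto intro: cvec.subspace_scale[OF subspace] finite_subset[OF _ finite_component[of x]]
        simp: component_outside)
  then show "component G B (c *\<^sub>C x) p = c *\<^sub>C component G B x p"
    by (simp add: component_eqI)
qed

lemma clinear_component: "clinear (\<lambda>b. component G B b p)"
  by (simp add: clinear_iff component_add component_scale)

lemma
  assumes "\<And>p. p \<in> carrier G \<Longrightarrow> clinear (f p)"
  shows clinear_glue: "clinear (glue f)"
    and glue_homogeneous: "p \<in> carrier G \<Longrightarrow> b \<in> B p \<Longrightarrow> glue f b = f p b"
proof -
  let ?S = "\<lambda>b. {p. component G B b p \<noteq> 0}"
  have eq: "glue f b = (\<Sum>p\<in>K. f p (component G B b p))"
    if "finite K" "?S b \<subseteq> K" "K \<subseteq> carrier G" for b K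
    unfolding glue_def
    by (rule sum.mono_neutral_left) (use that assms in \<open>auto intro!: clinear_zero\<close>)
  have S: "finite (?S b)" "?S b \<subseteq> carrier G" for b
    using finite_component component_mem_carrier by auto
  have "glue f (x + y) = glue f x + glue f y" for x y
  proof -
    let ?K = "?S x \<union> ?S y \<union> ?S (x + y)"
    have K: "finite ?K" "?K \<subseteq> carrier G" using S by auto
    have "f p (component G B (x + y) p) = f p (component G B x p) + f p (component G B y p)"
      if "p \<in> ?K" for p
    proof -
      have "clinear (f p)" using assms that K(2) by blast
      then show ?thesis by (simp add: component_add clinear_add)
    qed
    then show ?thesis
      using eq[OF K(1) _ K(2), of x] eq[OF K(1) _ K(2), of y] eq[OF K(1) _ K(2), of "x + y"]
      by (simp add: sum.distrib[symmetric] Un_upper1 Un_upper2 le_supI1)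
  qed
  moreover have "glue f (c *\<^sub>C x) = c *\<^sub>C glue f x" for c x
  proof -
    let ?K = "?S x \<union> ?S (c *\<^sub>C x)"
    have K: "finite ?K" "?K \<subseteq> carrier G" using S by auto
    have "f p (component G B (c *\<^sub>C x) p) = c *\<^sub>C f p (component G B x p)" if "p \<in> ?K" for p
    proof -
      have "clinear (f p)" using assms that K(2) by blast
      then show ?thesis by (simp add: component_scale clinear_scale)
    qed
    then show ?thesis
      using eq[OF K(1) _ K(2), of x] eq[OF K(1) _ K(2), of "c *\<^sub>C x"]
      by (simp add: cvec.scale_sum_right)
  qed
  ultimately show "clinear (glue f)"
    by (simp add: clinear_iff)
  show "glue f b = f p b" if "p \<in> carrier G" "b \<in> B p"
  proof -
    have "{q. component G B b q \<noteq> 0} \<subseteq> {p}"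
      using that by (auto simp: component_homogeneous)
    then show ?thesis
      using eq[of "{p}" b] that by (simp add: component_homogeneous)
  qed
qed

text \<open>On homogeneous factors of degrees r and s everything vanishes unless r = s. Hence the
  projection onto a summand is a central multiplier, and it commutes with all multipliers by
  \<open>mult_left_central\<close>.\<close>

lemma component_mult_left: "component G B (x * y) p = component G B x p * y"
  and component_mult_right: "component G B (x * y) p = x * component G B y p"
proof -
  have hom: "component G B (x * y) p = component G B x p * y \<and> component G B (x * y) p = x * component G B y p"
    if "r \<in> carrier G" "s \<in> carrier G" "x \<in> B r" "y \<in> B s" for r s x y
  proof (cases "r = s")
    case True
    then have "x * y \<in> B r" using that closed by simp
    with True that show ?thesis by (simp add: component_homogeneous)
  next
    case False
    with that show ?thesis
      by (auto simp: orthogonal component_homogeneous[of r] component_homogeneous[of s]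
          clinear_zero[OF clinear_component])
  qed
  have "component G B (x * y) p = component G B x p * y \<and> component G B (x * y) p = x * component G B y p"
  proof (induction x rule: graded_induct)
    case (homogeneous r x)
    then show ?case
    proof (induction y rule: graded_induct)
      case (add y z)
      then have "component G B (x * y) p = component G B x p * y" "component G B (x * z) p = component G B x p * z"
        "component G B (x * y) p = x * component G B y p" "component G B (x * z) p = x * component G B z p"
        by blast+
      then show ?case by (simp only: distrib_left component_add)
    next
      case (homogeneous s y)
      then show ?case using hom by blast
    qed (simp add: clinear_zero[OF clinear_component])
  next
    case (add x z)
    then have "component G B (x * y) p = component G B x p * y" "component G B (z * y) p = component G B z p * y"
      "component G B (x * y) p = x * component G B y p" "component G B (z * y) p = z * component G B y p"
      by blast+
    then show ?case by (simp only: distrib_right component_add)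
  qed (simp add: clinear_zero[OF clinear_component])
  then show "component G B (x * y) p = component G B x p * y"
    "component G B (x * y) p = x * component G B y p" by blast+
qed

lemma tensor_graded_ext:
  fixes f g :: "('v::complex_vector, 'b) tensor \<Rightarrow> 'w::complex_vector"
  assumes "clinear f" "clinear g"
    "\<And>q v y. q \<in> carrier G \<Longrightarrow> y \<in> B q \<Longrightarrow> f (v \<otimes>\<^sub>C y) = g (v \<otimes>\<^sub>C y)"
  shows "f = g"
proof (rule tensor_ext[OF assms(1,2)])
  fix v y
  have "(\<lambda>y. f (v \<otimes>\<^sub>C y)) = (\<lambda>y. g (v \<otimes>\<^sub>C y))"
    by (rule graded_ext) (use assms in \<open>auto intro!: clinear_compose[of f] clinear_compose[of g] clin\<close>)
  then show "f (v \<otimes>\<^sub>C y) = g (v \<otimes>\<^sub>C y)" by metis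
qed

lemma tensor_graded_ext2:
  fixes f g :: "('b, 'b) tensor \<Rightarrow> 'w::complex_vector"
  assumes "clinear f" "clinear g"
    "\<And>p q x y. p \<in> carrier G \<Longrightarrow> q \<in> carrier G \<Longrightarrow> x \<in> B p \<Longrightarrow> y \<in> B q \<Longrightarrow> f (x \<otimes>\<^sub>C y) = g (x \<otimes>\<^sub>C y)"
  shows "f = g"
proof (rule tensor_graded_ext[OF assms(1,2)])
  fix q v y assume "q \<in> carrier G" "y \<in> B q"
  then have "(\<lambda>v. f (v \<otimes>\<^sub>C y)) = (\<lambda>v. g (v \<otimes>\<^sub>C y))"
    by (intro graded_ext) (use assms in \<open>auto intro!: clinear_compose[of f] clinear_compose[of g] clin\<close>)
  then show "f (v \<otimes>\<^sub>C y) = g (v \<otimes>\<^sub>C y)" by metis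
qed

text \<open>The map which is \<open>\<tau> q \<otimes> \<iota>\<close> on \<open>V \<otimes> B\<^sub>q\<close>.\<close>

definition twist :: "('g \<Rightarrow> 'v::complex_vector \<Rightarrow> 'w::complex_vector) \<Rightarrow> ('v, 'b) tensor \<Rightarrow> ('w, 'b) tensor" where
  "twist \<tau> = tensor_lift (\<lambda>v. glue (\<lambda>q y. \<tau> q v \<otimes>\<^sub>C y))"

context
  fixes \<tau> :: "'g \<Rightarrow> 'v::complex_vector \<Rightarrow> 'w::complex_vector"
  assumes \<tau>: "\<And>q. q \<in> carrier G \<Longrightarrow> clinear (\<tau> q)"
begin

lemma cbilinear_twist: "cbilinear (\<lambda>v. glue (\<lambda>q y. \<tau> q v \<otimes>\<^sub>C y))"
proof
  fix b :: 'b
  have g: "clinear (glue (\<lambda>q y. \<tau> q v \<otimes>\<^sub>C y))" for v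
    by (rule clinear_glue) (rule clin)+
  show "clinear (\<lambda>v. glue (\<lambda>q y. \<tau> q v \<otimes>\<^sub>C y) b)"
  proof (induction b rule: graded_induct)
    case zero
    show ?case by (simp add: clinear_zero[OF g] clin)
  next
    case (add x y)
    then show ?case by (simp add: clinear_add[OF g] clin)
  next
    case (homogeneous q y)
    then show ?case
      by (subst glue_homogeneous) (auto intro!: clin \<tau>)
  qed
qed (intro clinear_glue clin)

lemma clinear_twist: "clinear (twist \<tau>)"
  unfolding twist_def by (intro clin cbilinear_twist)

lemma twist_tensor: "q \<in> carrier G \<Longrightarrow> y \<in> B q \<Longrightarrow> twist \<tau> (v \<otimes>\<^sub>C y) = \<tau> q v \<otimes>\<^sub>C y"
  unfolding twist_def tensor_lift_apply[OF cbilinear_twist]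
  by (rule glue_homogeneous) (rule clin)+

end

lemma bij_twist:
  fixes \<tau> :: "'g \<Rightarrow> 'w::complex_vector \<Rightarrow> 'u::complex_vector"
  assumes "\<And>q. q \<in> carrier G \<Longrightarrow> clinear (\<tau> q)" "\<And>q. q \<in> carrier G \<Longrightarrow> bij (\<tau> q)"
  shows "bij (twist \<tau>)"
proof (rule o_bij)
  let ?\<sigma> = "\<lambda>q. inv_into UNIV (\<tau> q)"
  have \<sigma>: "q \<in> carrier G \<Longrightarrow> clinear (?\<sigma> q)" for q
    by (intro clinear_inv assms)
  show "twist ?\<sigma> \<circ> twist \<tau> = id"
    by (rule tensor_graded_ext)
      (simp_all add: assms \<sigma> clinear_twist twist_tensor clin bij_is_inj)
  show "twist \<tau> \<circ> twist ?\<sigma> = id"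
    by (rule tensor_graded_ext)
      (simp_all add: assms \<sigma> clinear_twist twist_tensor clin bij_is_surj surj_f_inv_f)
qed

context
  fixes \<tau> :: "'g \<Rightarrow> 'v::nondegenerate_complex_algebra \<Rightarrow> 'w::nondegenerate_complex_algebra"
  assumes \<tau>: "\<And>q. q \<in> carrier G \<Longrightarrow> algebra_hom (\<tau> q)" "\<And>q. q \<in> carrier G \<Longrightarrow> bij (\<tau> q)"
begin

text \<open>The maps \<tau> p and \<tau> q for different degrees never have to be compatible:
  products across degrees are zero on both sides.\<close>

lemma algebra_hom_twist: "algebra_hom (twist \<tau>)"
proof -
  note lin = algebra_hom_clinear[OF \<tau>(1)]
  have z: "twist \<tau> 0 = 0" by (simp add: clinear_zero clinear_twist lin)
  have a: "twist \<tau> (s + t) = twist \<tau> s + twist \<tau> t" for s t by (simp add: clinear_add clinear_twist lin)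
  show ?thesis
  proof (rule algebra_hom_tensorI)
    fix u v x y
    show "twist \<tau> ((u * v) \<otimes>\<^sub>C (x * y)) = twist \<tau> (u \<otimes>\<^sub>C x) * twist \<tau> (v \<otimes>\<^sub>C y)"
    proof (induction x rule: graded_induct)
      case (homogeneous p x)
      then show ?case
      proof (induction y rule: graded_induct)
        case (homogeneous q y)
        show ?case
        proof (cases "p = q")
          case True
          then have "x * y \<in> B q" using homogeneous closed by simp
          with True homogeneous show ?thesis
            by (simp add: twist_tensor lin tensor_mult_tensor algebra_hom_mult[OF \<tau>(1)])
        next
          case False
          with homogeneous show ?thesis
            by (simp add: orthogonal[of p q] tensor_zero z twist_tensor lin tensor_mult_tensor)
        qed
      qed (simp_all add: z a tensor_zero tensor_add_right distrib_left)
    qed (simp_all add: z a tensor_zero tensor_add_right distrib_right)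
  qed (simp add: clinear_twist lin)
qed

lemma bij_twist_hom: "bij (twist \<tau>)"
  by (intro bij_twist algebra_hom_clinear \<tau>)

text \<open>For y of degree q the multiplier m \<otimes> y annihilates every summand whose second
  leg has another degree, so only \<tau> q is seen.\<close>

lemma mult_map_twist:
  assumes "q \<in> carrier G" "y \<in> B q"
  shows "mult_map (twist \<tau>) (m \<otimes>\<^sub>M embed y) = mult_map (\<tau> q) m \<otimes>\<^sub>M embed y"
proof (rule mult_map_eqI[OF algebra_hom_twist bij_twist_hom])
  note lin = algebra_hom_clinear[OF \<tau>(1)]
  fix t
  have "mult_left (mult_map (\<tau> q) m \<otimes>\<^sub>M embed y) \<circ> twist \<tau> = twist \<tau> \<circ> mult_left (m \<otimes>\<^sub>M embed y)"
  proof (rule tensor_graded_ext)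
    fix p v z assume p: "p \<in> carrier G" "z \<in> B p"
    show "(mult_left (mult_map (\<tau> q) m \<otimes>\<^sub>M embed y) \<circ> twist \<tau>) (v \<otimes>\<^sub>C z) =
        (twist \<tau> \<circ> mult_left (m \<otimes>\<^sub>M embed y)) (v \<otimes>\<^sub>C z)"
    proof (cases "p = q")
      case True
      then have "y * z \<in> B q" using p assms closed by simp
      with True p assms show ?thesis
        by (simp add: twist_tensor lin mult_left_map \<tau>)
    next
      case False
      with p assms show ?thesis
        by (simp add: orthogonal[of q p] tensor_zero twist_tensor lin clinear_zero[OF clinear_twist])
    qed
  qed (intro clin clinear_twist lin mult_left_linear; assumption)+
  then show "mult_left (mult_map (\<tau> q) m \<otimes>\<^sub>M embed y) (twist \<tau> t) = twist \<tau> (mult_left (m \<otimes>\<^sub>M embed y) t)"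
    by (metis comp_apply)
qed

text \<open>Extended isomorphisms preserve 1, whatever the degree of y. This is why a factor 1
  \<otimes> y passes through the twist unchanged.\<close>

lemma mult_map_twist_one: "mult_map (twist \<tau>) (1 \<otimes>\<^sub>M embed y) = 1 \<otimes>\<^sub>M embed y"
proof -
  have "(\<lambda>y. mult_map (twist \<tau>) (1 \<otimes>\<^sub>M embed y)) = (\<lambda>y. 1 \<otimes>\<^sub>M embed y)"
    by (rule graded_ext)
      (auto intro!: clinear_compose[OF clinear_mult_map] algebra_hom_twist bij_twist_hom clin
        simp: mult_map_twist \<tau>)
  then show ?thesis by metis
qed

end

end

lemma graded_algebra_cograded:
  assumes "group G" "cograded_multiplier_hopf G B \<Delta>"
  shows "graded_algebra G B"
proof -
  have 1: "\<forall>p \<in> carrier G. cvec.subspace (B p) \<and> (\<forall>x \<in> B p. \<forall>y \<in> B p. x * y \<in> B p)"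
    and 2: "\<forall>b. \<exists>!f. decomposition G B b f"
    and 3: "\<forall>p \<in> carrier G. \<forall>q \<in> carrier G. p \<noteq> q \<longrightarrow> (\<forall>x \<in> B p. \<forall>y \<in> B q. x * y = 0)"
    by (insert assms(2), unfold cograded_multiplier_hopf_def, elim conjE, assumption)+
  show ?thesis
  proof (intro graded_algebra.intro graded_algebra_axioms.intro assms(1))
    show "\<exists>!f. decomposition G B b f" for b by (rule 2[rule_format])
  qed (use 1 3 in auto)
qed

section \<open>The deformed comultiplication\<close>

locale deformation = graded_algebra G B + regular_hopf \<Delta>
  for G :: "('g, 'm) monoid_scheme" (structure)
    and B :: "'g \<Rightarrow> 'b::nondegenerate_complex_algebra set"
    and \<Delta> :: "'b \<Rightarrow> ('b, 'b) tensor multiplier" +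
  fixes \<pi> :: "'g \<Rightarrow> 'b \<Rightarrow> 'b"
  assumes cograded: "cograded_multiplier_hopf G B \<Delta>"
    and admissible: "admissible_action G B \<Delta> \<pi>"
begin

section \<open>Consequences of admissibility\<close>

lemma pi_hom: "p \<in> carrier G \<Longrightarrow> algebra_hom (\<pi> p)"
  and pi_bij: "p \<in> carrier G \<Longrightarrow> bij (\<pi> p)"
  and pi_mult: "p \<in> carrier G \<Longrightarrow> q \<in> carrier G \<Longrightarrow> \<pi> (p \<otimes> q) x = \<pi> p (\<pi> q x)"
  and comult_pi: "p \<in> carrier G \<Longrightarrow> \<Delta> (\<pi> p b) = mult_map (tensor_map (\<pi> p) (\<pi> p)) (\<Delta> b)"
  using admissible by (auto simp: admissible_action_def hopf_action_def)

lemma pi_one [simp]: "\<pi> \<one> x = x"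
  using pi_mult[of \<one> \<one> x] pi_bij[of \<one>] by (simp add: bij_is_inj inj_eq)

lemma pi_cancel [simp]:
  "p \<in> carrier G \<Longrightarrow> \<pi> (inv p) (\<pi> p x) = x"
  "p \<in> carrier G \<Longrightarrow> \<pi> p (\<pi> (inv p) x) = x"
  using pi_mult[of "inv p" p x] pi_mult[of p "inv p" x] by simp_all

lemma pi_clinear: "p \<in> carrier G \<Longrightarrow> clinear (\<pi> p)"
  by (rule algebra_hom_clinear[OF pi_hom])

text \<open>Admissibility yields equalities between automorphisms and not between group elements, so
  inverses must be compared on that level too.\<close>

lemma pi_inv_cong:
  assumes "p \<in> carrier G" "q \<in> carrier G" "\<pi> p = \<pi> q"
  shows "\<pi> (inv p) = \<pi> (inv q)"
proof
  fix x
  have "\<pi> (inv p) x = \<pi> (inv p) (\<pi> q (\<pi> (inv q) x))" using assms by simp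
  also have "\<dots> = \<pi> (inv q) x" using assms(1,2) by (simp flip: assms(3))
  finally show "\<pi> (inv p) x = \<pi> (inv q) x" .
qed

text \<open>The form in which admissibility is used throughout: s need not be p q p^-1, but it acts
  like it.\<close>

lemma pi_homogeneous:
  assumes "p \<in> carrier G" "q \<in> carrier G"
  obtains s where "s \<in> carrier G" "\<And>x. x \<in> B q \<Longrightarrow> \<pi> p x \<in> B s" "\<pi> s = \<pi> (p \<otimes> q \<otimes> inv p)"
proof -
  obtain \<rho> where \<rho>: "\<rho> \<in> hom G (AutoGroup G)"
    "\<And>p q. p \<in> carrier G \<Longrightarrow> q \<in> carrier G \<Longrightarrow> \<pi> p ` B q = B (\<rho> p q) \<and> \<pi> (\<rho> p q) = \<pi> (p \<otimes> q \<otimes> inv p)"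
    using admissible by (auto simp: admissible_action_def)
  \<comment> \<open>Elements of \<open>AutoGroup G\<close> are automorphisms, so \<rho>_p keeps
    degrees inside the carrier.\<close>
  have "\<rho> p \<in> hom G G"
    using hom_in_carrier[OF \<rho>(1) assms(1)] by (simp add: AutoGroup_def auto_def BijGroup_def)
  then have "\<rho> p q \<in> carrier G"
    using assms(2) by (rule hom_in_carrier)
  with that[of "\<rho> p q"] \<rho>(2)[OF assms] show ?thesis by blast
qed

section \<open>Homogeneous tensors and the support of the comultiplication\<close>

abbreviation pi2 :: "'g \<Rightarrow> ('b, 'b) tensor \<Rightarrow> ('b, 'b) tensor" where
  "pi2 p \<equiv> tensor_map (\<pi> p) (\<pi> p)"

lemma pi2_hom: "p \<in> carrier G \<Longrightarrow> algebra_hom (pi2 p)"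
  and pi2_bij: "p \<in> carrier G \<Longrightarrow> bij (pi2 p)"
  and pi2_tensor: "p \<in> carrier G \<Longrightarrow> pi2 p (x \<otimes>\<^sub>C y) = \<pi> p x \<otimes>\<^sub>C \<pi> p y"
  by (simp_all add: algebra_hom_tensor_map bij_tensor_map pi_hom pi_bij pi_clinear tensor_map_tensor)

abbreviation homogeneous_tensors :: "'g \<Rightarrow> 'g \<Rightarrow> ('b, 'b) tensor set" where
  "homogeneous_tensors p q \<equiv> {x \<otimes>\<^sub>C y | x y. x \<in> B p \<and> y \<in> B q}"

lemma can1_homogeneous:
  assumes "r \<in> carrier G" "q \<in> carrier G" "b \<in> B r" "b' \<in> B q"
  shows "unembed (can1 \<Delta> b b') \<in> cvec.span (homogeneous_tensors (r \<otimes> inv q) q)"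
proof -
  have r: "r \<otimes> inv q \<otimes> q = r" using assms(1,2) by (simp add: m_assoc)
  have "\<Delta> b * (1 \<otimes>\<^sub>M embed b') \<in> cvec.span {\<Delta> b * (1 \<otimes>\<^sub>M embed b') | b b'. b \<in> B (r \<otimes> inv q \<otimes> q) \<and> b' \<in> B q}"
    using assms by (intro cvec.span_base) (auto simp: r)
  moreover have "cvec.span {\<Delta> b * (1 \<otimes>\<^sub>M embed b') | b b'. b \<in> B (r \<otimes> inv q \<otimes> q) \<and> b' \<in> B q} =
      embed ` cvec.span (homogeneous_tensors (r \<otimes> inv q) q)"
    using cograded assms(1,2) unfolding cograded_multiplier_hopf_def by (simp del: r)
  ultimately show ?thesis
    unfolding can1_def by auto
qed

lemma can2_homogeneous:
  assumes "p \<in> carrier G" "r \<in> carrier G" "b \<in> B p" "b' \<in> B r"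
  shows "unembed (can2 \<Delta> b b') \<in> cvec.span (homogeneous_tensors p (inv p \<otimes> r))"
proof -
  have r: "p \<otimes> (inv p \<otimes> r) = r" using assms(1,2) by (simp add: m_assoc[symmetric])
  have "(embed b \<otimes>\<^sub>M 1) * \<Delta> b' \<in> cvec.span {(embed b' \<otimes>\<^sub>M 1) * \<Delta> b | b b'. b \<in> B (p \<otimes> (inv p \<otimes> r)) \<and> b' \<in> B p}"
    using assms by (intro cvec.span_base) (auto simp: r)
  moreover have "cvec.span {(embed b' \<otimes>\<^sub>M 1) * \<Delta> b | b b'. b \<in> B (p \<otimes> (inv p \<otimes> r)) \<and> b' \<in> B p} =
      embed ` cvec.span (homogeneous_tensors p (inv p \<otimes> r))"
    using cograded assms(1,2) unfolding cograded_multiplier_hopf_def by (simp del: r)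
  ultimately show ?thesis
    unfolding can2_def by auto
qed

text \<open>The cograding axiom read backwards: B_p \<otimes> B_q is spanned by the products
  \<Delta>(b)(1 \<otimes> b') with b of degree pq and b' of degree q.\<close>

lemma can1_homogeneous_ext:
  assumes "clinear f" "clinear g" "p \<in> carrier G" "q \<in> carrier G" "x \<in> B p" "y \<in> B q"
    and eq: "\<And>b b'. b \<in> B (p \<otimes> q) \<Longrightarrow> b' \<in> B q \<Longrightarrow> f (unembed (can1 \<Delta> b b')) = g (unembed (can1 \<Delta> b b'))"
  shows "f (x \<otimes>\<^sub>C y) = g (x \<otimes>\<^sub>C y)"
proof -
  let ?X = "{\<Delta> b * (1 \<otimes>\<^sub>M embed b') | b b'. b \<in> B (p \<otimes> q) \<and> b' \<in> B q}"
  have "embed (x \<otimes>\<^sub>C y) \<in> embed ` cvec.span (homogeneous_tensors p q)"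
    using assms(5,6) by (intro imageI cvec.span_base) blast
  also have "embed ` cvec.span (homogeneous_tensors p q) = cvec.span ?X"
    using cograded assms(3,4) unfolding cograded_multiplier_hopf_def by simp
  finally have x: "embed (x \<otimes>\<^sub>C y) \<in> cvec.span ?X" .
  \<comment> \<open>The span is taken among multipliers while f and g live on the tensor square; the
    existential carries the preimage along the induction.\<close>
  have "\<exists>t. m = embed t \<and> f t = g t" if "m \<in> cvec.span ?X" for m
    using that
  proof (induction rule: cvec.span_induct_alt)
    case base
    show ?case
      by (intro exI[of _ 0]) (simp add: clinear_zero[OF clinear_embed[OF clinear_id(1)]] clinear_zero assms(1,2))
  next
    case (step c m n)
    then obtain b b' t where *: "m = can1 \<Delta> b b'" "b \<in> B (p \<otimes> q)" "b' \<in> B q" "n = embed t" "f t = g t"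
      by (auto simp: can1_def)
    show ?case
      by (intro exI[of _ "c *\<^sub>C unembed (can1 \<Delta> b b') + t"])
        (use * eq in \<open>simp add: clinear_add[OF clinear_embed[OF clinear_id(1)]] clinear_scale[OF clinear_embed[OF clinear_id(1)]]
          embed_unembed range1 clinear_add[OF assms(1)] clinear_add[OF assms(2)]
          clinear_scale[OF assms(1)] clinear_scale[OF assms(2)]\<close>)
  qed
  from this[OF x] show ?thesis by auto
qed

text \<open>Membership in B_p \<otimes> B_q is expressed as being fixed by this central projection,
  which makes it stable under multipliers and usable in equations between linear maps.\<close>

definition proj2 :: "'g \<Rightarrow> 'g \<Rightarrow> ('b, 'b) tensor \<Rightarrow> ('b, 'b) tensor" where
  "proj2 p q = tensor_map (\<lambda>b. component G B b p) (\<lambda>b. component G B b q)"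

lemma proj2_tensor: "proj2 p q (x \<otimes>\<^sub>C y) = component G B x p \<otimes>\<^sub>C component G B y q"
  and clinear_proj2: "clinear (proj2 p q)"
  by (simp_all add: proj2_def tensor_map_tensor clinear_component clin)

lemma proj2_mult: "proj2 p q (s * t) = proj2 p q s * t" "proj2 p q (s * t) = s * proj2 p q t"
proof -
  note z = clinear_zero[OF clinear_proj2] and a = clinear_add[OF clinear_proj2]
  show "proj2 p q (s * t) = proj2 p q s * t"
  proof (induction s)
    case (tensor x y)
    show ?case
      by (induction t)
        (simp_all add: z a distrib_left tensor_mult_tensor proj2_tensor component_mult_left)
  qed (simp_all add: z a distrib_right)
  show "proj2 p q (s * t) = s * proj2 p q t"
  proof (induction s)
    case (tensor x y)
    show ?case
      by (induction t)
        (simp_all add: z a distrib_left tensor_mult_tensor proj2_tensor component_mult_right)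
  qed (simp_all add: z a distrib_right)
qed

lemma proj2_homogeneous:
  "p \<in> carrier G \<Longrightarrow> q \<in> carrier G \<Longrightarrow> x \<in> B p \<Longrightarrow> y \<in> B q \<Longrightarrow> proj2 p q (x \<otimes>\<^sub>C y) = x \<otimes>\<^sub>C y"
  by (simp add: proj2_tensor component_homogeneous)

lemma proj2_mult_left:
  assumes "p \<in> carrier G" "q \<in> carrier G" "x \<in> B p" "y \<in> B q"
  shows "proj2 p q (mult_left m (x \<otimes>\<^sub>C y)) = mult_left m (x \<otimes>\<^sub>C y)"
    and "proj2 p q (mult_right m (x \<otimes>\<^sub>C y)) = mult_right m (x \<otimes>\<^sub>C y)"
  using mult_left_central[of "proj2 p q" m "x \<otimes>\<^sub>C y", OF proj2_mult]
  by (simp_all add: proj2_homogeneous assms)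

text \<open>\<Delta>(b)(1 \<otimes> y) lies in degrees (r q^-1, q), and its first leg annihilates
  B_s when s differs from r q^-1. This settles the left action.\<close>

lemma comult_support:
  assumes "r \<in> carrier G" "s \<in> carrier G" "q \<in> carrier G" "b \<in> B r" "x \<in> B s" "y \<in> B q" "s \<otimes> q \<noteq> r"
  shows "mult_left (\<Delta> b) (x \<otimes>\<^sub>C y) = 0" and "mult_right (\<Delta> b) (x \<otimes>\<^sub>C y) = 0"
proof -
  have *: "mult_left (\<Delta> b) (x \<otimes>\<^sub>C y) = 0" if "x \<in> B s" "y \<in> B q" for x y
  proof (rule nondegenerate_left)
    fix t
    let ?w = "mult_left (\<Delta> b) (x \<otimes>\<^sub>C y)"
    have ne: "r \<otimes> inv q \<noteq> s" using assms(1-3,7) by (auto simp: m_assoc)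
    have "?w * (u \<otimes>\<^sub>C v) = 0" for u v
    proof -
      have "?w * (u \<otimes>\<^sub>C v) = mult_left (can1 \<Delta> b y) ((x * u) \<otimes>\<^sub>C v)"
        by (simp add: mult_left_mult[symmetric] tensor_mult_tensor can1_def)
      also have "\<dots> = unembed (can1 \<Delta> b y) * ((x * u) \<otimes>\<^sub>C v)"
        by (rule mult_left_unembed[OF range1, symmetric])
      also have "\<dots> = 0"
      proof (rule clinear_eq_on_span[OF _ clinear_const_zero _ can1_homogeneous])
        fix t assume "t \<in> homogeneous_tensors (r \<otimes> inv q) q"
        then obtain x' y' where t: "t = x' \<otimes>\<^sub>C y'" "x' \<in> B (r \<otimes> inv q)" by blast
        have "x' * (x * u) = 0"
          using orthogonal[OF _ assms(2) ne t(2) that(1)] assms(1,3) by (simp add: mult.assoc[symmetric])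
        then show "t * ((x * u) \<otimes>\<^sub>C v) = 0" by (simp add: t tensor_mult_tensor tensor_zero)
      qed (use assms that in \<open>auto intro!: clin\<close>)
      finally show ?thesis .
    qed
    then have "(\<lambda>t. ?w * t) = (\<lambda>t. 0)"
      by (intro tensor_ext) (auto intro!: clin)
    then show "?w * t = 0" by metis
  qed
  show "mult_left (\<Delta> b) (x \<otimes>\<^sub>C y) = 0" by (rule *[OF assms(5,6)])
  show "mult_right (\<Delta> b) (x \<otimes>\<^sub>C y) = 0"
  proof (rule nondegenerate_left)
    fix t
    let ?w = "mult_right (\<Delta> b) (x \<otimes>\<^sub>C y)"
    \<comment> \<open>The right action is moved to the other factor of a product with a homogeneous
      test element. Different degrees annihilate each other, and equal degrees fall under the case
      of the left action.\<close>
    have "(\<lambda>t. ?w * t) = (\<lambda>t. 0)"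
    proof (rule tensor_graded_ext2)
      fix s' q' u v assume h: "s' \<in> carrier G" "q' \<in> carrier G" "u \<in> B s'" "v \<in> B q'"
      have "?w * (u \<otimes>\<^sub>C v) = (x \<otimes>\<^sub>C y) * proj2 s' q' (mult_left (\<Delta> b) (u \<otimes>\<^sub>C v))"
        by (simp add: mult_left_right[symmetric] proj2_mult_left h)
      also have "\<dots> = proj2 s' q' (x \<otimes>\<^sub>C y) * mult_left (\<Delta> b) (u \<otimes>\<^sub>C v)"
        by (simp only: proj2_mult[symmetric])
      also have "\<dots> = 0"
      proof (cases "s' = s \<and> q' = q")
        case True
        with * h show ?thesis by simp
      next
        case False
        then have "proj2 s' q' (x \<otimes>\<^sub>C y) = 0"
          using assms by (auto simp: proj2_tensor component_homogeneous[of s] component_homogeneous[of q] tensor_zero)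
        then show ?thesis by simp
      qed
      finally show "?w * (u \<otimes>\<^sub>C v) = 0" .
    qed (intro clin)+
    then show "?w * t = 0" by metis
  qed
qed

section \<open>The twisting automorphism and its interplay with one-sided products\<close>

definition Theta :: "('b, 'b) tensor \<Rightarrow> ('b, 'b) tensor" where
  "Theta = twist (\<lambda>q. \<pi> (inv q))"

lemma Theta_hom: "algebra_hom Theta" and Theta_bij: "bij Theta"
  unfolding Theta_def by (intro algebra_hom_twist bij_twist_hom pi_hom pi_bij inv_closed; assumption)+

lemma Theta_clinear: "clinear Theta"
  by (rule algebra_hom_clinear[OF Theta_hom])

lemma Theta_tensor: "q \<in> carrier G \<Longrightarrow> y \<in> B q \<Longrightarrow> Theta (x \<otimes>\<^sub>C y) = \<pi> (inv q) x \<otimes>\<^sub>C y"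
  unfolding Theta_def by (rule twist_tensor) (simp_all add: pi_clinear)

text \<open>A concrete candidate. It is identified with the comultiplication given by definite
  description only in \<open>deformed_comult_eq\<close>.\<close>

definition comult' :: "'b \<Rightarrow> ('b, 'b) tensor multiplier" where
  "comult' b = mult_map Theta (\<Delta> b)"

lemma comult'_hom: "algebra_hom comult'"
  using algebra_hom_compose[OF algebra_hom_mult_map[OF Theta_hom Theta_bij] hom]
  by (simp add: comp_def comult'_def[abs_def])

lemma comult'_clinear: "clinear comult'"
  by (rule algebra_hom_clinear[OF comult'_hom])

text \<open>Cancelling \<pi>_q^-1 on the right of \<pi>_r \<pi>_q^-1 = \<pi>_q \<pi>_p \<pi>_q^-1
  gives \<pi>_r = \<pi>_q \<pi>_p, which is solved for \<pi>_q.\<close>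

lemma pi_conjugate:
  assumes "p \<in> carrier G" "q \<in> carrier G" "r \<in> carrier G"
    "\<pi> (r \<otimes> inv q) = \<pi> (q \<otimes> p \<otimes> inv q)"
  shows "\<pi> (r \<otimes> inv p) x = \<pi> q x"
proof -
  have "\<pi> (r \<otimes> inv q) (\<pi> q (\<pi> (inv p) x)) = \<pi> (q \<otimes> p \<otimes> inv q) (\<pi> q (\<pi> (inv p) x))"
    by (simp only: assms(4))
  then show ?thesis
    using assms(1-3) by (simp add: pi_mult)
qed

text \<open>If one of the two elements \<open>\<pi> (r \<otimes> inv p) a\<close> and
  \<open>\<pi> q a\<close> has degree r q^-1, admissibility makes the two elements equal. Otherwise
  orthogonality makes all products with u vanish.\<close>

lemma pi_homogeneous_mult:
  assumes "p \<in> carrier G" "q \<in> carrier G" "r \<in> carrier G" "a \<in> B p" "u \<in> B (r \<otimes> inv q)"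
  shows "\<pi> (r \<otimes> inv p) a * u = \<pi> q a * u" and "u * \<pi> (r \<otimes> inv p) a = u * \<pi> q a"
proof -
  obtain s where s: "s \<in> carrier G" "\<pi> q a \<in> B s" "\<pi> s = \<pi> (q \<otimes> p \<otimes> inv q)"
    using pi_homogeneous[OF assms(2,1)] assms(4) by blast
  obtain s' where s': "s' \<in> carrier G" "\<pi> (r \<otimes> inv p) a \<in> B s'"
      "\<pi> s' = \<pi> ((r \<otimes> inv p) \<otimes> p \<otimes> inv (r \<otimes> inv p))"
    using pi_homogeneous[of "r \<otimes> inv p" p] assms by blast
  consider "s = r \<otimes> inv q" | "s' = r \<otimes> inv q" | "s \<noteq> r \<otimes> inv q" "s' \<noteq> r \<otimes> inv q" by blast
  then have "\<pi> (r \<otimes> inv p) a * u = \<pi> q a * u \<and> u * \<pi> (r \<otimes> inv p) a = u * \<pi> q a"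
  proof cases
    case 1
    then show ?thesis using s pi_conjugate[OF assms(1-3)] by simp
  next
    case 2
    have "\<pi> (r \<otimes> inv q) x = \<pi> (r \<otimes> p \<otimes> inv r) x" for x
      using fun_cong[OF s'(3)[unfolded 2], of x] assms(1-3)
      by (simp add: pi_mult inv_mult_group)
    then have *: "\<pi> (inv q) x = \<pi> p (\<pi> (inv r) x)" for x
      using assms(1-3) pi_cancel(1)[of r] by (simp add: pi_mult) (metis pi_cancel(1))
    have "\<pi> q (\<pi> (inv q) (\<pi> (r \<otimes> inv p) a)) = \<pi> q a"
      unfolding * using assms(1-3) by (simp add: pi_mult)
    then show ?thesis using assms(1-3) by simp
  next
    case 3
    with s s' assms show ?thesis
      by (simp add: orthogonal[of s "r \<otimes> inv q"] orthogonal[of s' "r \<otimes> inv q"]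
          orthogonal[of "r \<otimes> inv q" s] orthogonal[of "r \<otimes> inv q" s'])
  qed
  then show "\<pi> (r \<otimes> inv p) a * u = \<pi> q a * u" "u * \<pi> (r \<otimes> inv p) a = u * \<pi> q a" by blast+
qed

text \<open>On tensors of degrees (r q^-1, q) the twist is \<pi>_q^-1 on the first leg, and
  multiplying by a outside means multiplying by \<pi>_q(a) inside.
  \<open>pi_homogeneous_mult\<close> replaces this by an element that no longer mentions q.\<close>

lemma Theta_mult_unit:
  assumes "p \<in> carrier G" "q \<in> carrier G" "r \<in> carrier G" "a \<in> B p" "proj2 (r \<otimes> inv q) q w = w"
  shows "mult_left (embed a \<otimes>\<^sub>M 1) (Theta w) = Theta (mult_left (embed (\<pi> (r \<otimes> inv p) a) \<otimes>\<^sub>M 1) w)"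
    and "mult_right (embed a \<otimes>\<^sub>M 1) (Theta w) = Theta (mult_right (embed (\<pi> (r \<otimes> inv p) a) \<otimes>\<^sub>M 1) w)"
proof -
  let ?a = "\<pi> (r \<otimes> inv p) a"
  note hom = algebra_hom_mult[OF pi_hom, of "inv q"]
  have h: "\<pi> (inv q) (?a * u) = a * \<pi> (inv q) u" "\<pi> (inv q) (u * ?a) = \<pi> (inv q) u * a"
    if "u \<in> B (r \<otimes> inv q)" for u
    using that assms by (simp_all add: pi_homogeneous_mult hom)
  have "mult_left (embed a \<otimes>\<^sub>M 1) \<circ> Theta \<circ> proj2 (r \<otimes> inv q) q =
      Theta \<circ> mult_left (embed ?a \<otimes>\<^sub>M 1) \<circ> proj2 (r \<otimes> inv q) q"
    by (rule tensor_ext)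
      (use assms in \<open>auto intro!: clin mult_left_linear Theta_clinear clinear_proj2 simp: proj2_tensor Theta_tensor h\<close>)
  then show "mult_left (embed a \<otimes>\<^sub>M 1) (Theta w) = Theta (mult_left (embed ?a \<otimes>\<^sub>M 1) w)"
    by (metis assms(5) comp_apply)
  have "mult_right (embed a \<otimes>\<^sub>M 1) \<circ> Theta \<circ> proj2 (r \<otimes> inv q) q =
      Theta \<circ> mult_right (embed ?a \<otimes>\<^sub>M 1) \<circ> proj2 (r \<otimes> inv q) q"
    by (rule tensor_ext)
      (use assms in \<open>auto intro!: clin mult_right_linear Theta_clinear clinear_proj2 simp: proj2_tensor Theta_tensor h\<close>)
  then show "mult_right (embed a \<otimes>\<^sub>M 1) (Theta w) = Theta (mult_right (embed ?a \<otimes>\<^sub>M 1) w)"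
    by (metis assms(5) comp_apply)
qed

lemma Theta_ext:
  fixes f g :: "('b, 'b) tensor \<Rightarrow> 'w::complex_vector"
  assumes "\<And>t. f (Theta t) = g (Theta t)"
  shows "f = g"
  by (rule ext) (metis Theta_bij assms bij_pointE)

text \<open>Since the substituted element depends only on p and r, the identity on each pair of
  degrees (s, q) with sq = r adds up to one about multipliers; the remaining pairs contribute
  nothing by \<open>comult_support\<close>.\<close>

lemma comult'_mult_unit:
  assumes "p \<in> carrier G" "r \<in> carrier G" "a \<in> B p" "b \<in> B r"
  shows "(embed a \<otimes>\<^sub>M 1) * comult' b = mult_map Theta ((embed (\<pi> (r \<otimes> inv p) a) \<otimes>\<^sub>M 1) * \<Delta> b)"
    and "comult' b * (embed a \<otimes>\<^sub>M 1) = mult_map Theta (\<Delta> b * (embed (\<pi> (r \<otimes> inv p) a) \<otimes>\<^sub>M 1))"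
proof -
  let ?a = "\<pi> (r \<otimes> inv p) a"
  have *: "mult_left (embed a \<otimes>\<^sub>M 1) (Theta (mult_left (\<Delta> b) (x \<otimes>\<^sub>C y))) =
        Theta (mult_left (embed ?a \<otimes>\<^sub>M 1) (mult_left (\<Delta> b) (x \<otimes>\<^sub>C y))) \<and>
      mult_right (embed a \<otimes>\<^sub>M 1) (Theta (mult_right (\<Delta> b) (x \<otimes>\<^sub>C y))) =
        Theta (mult_right (embed ?a \<otimes>\<^sub>M 1) (mult_right (\<Delta> b) (x \<otimes>\<^sub>C y)))"
    if "s \<in> carrier G" "q \<in> carrier G" "x \<in> B s" "y \<in> B q" for s q x y
  proof (cases "s \<otimes> q = r")
    case True
    then have "s = r \<otimes> inv q" using that by (auto simp: m_assoc)
    then show ?thesis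
      using Theta_mult_unit[OF assms(1) that(2) assms(2,3)]
        proj2_mult_left[OF that, of "\<Delta> b"] by blast
  next
    case False
    with that assms show ?thesis
      by (simp add: comult_support clinear_zero[OF Theta_clinear])
  qed
  have l: "mult_left (embed a \<otimes>\<^sub>M 1) (Theta (mult_left (\<Delta> b) t)) =
      Theta (mult_left (embed ?a \<otimes>\<^sub>M 1) (mult_left (\<Delta> b) t))" for t
    by (rule fun_cong[OF tensor_graded_ext2];
        (intro clinear_mult_left clinear_compose[OF Theta_clinear] clinear_id
          | rule *[THEN conjunct1]))
  have r: "mult_right (embed a \<otimes>\<^sub>M 1) (Theta (mult_right (\<Delta> b) t)) =
      Theta (mult_right (embed ?a \<otimes>\<^sub>M 1) (mult_right (\<Delta> b) t))" for t
    by (rule fun_cong[OF tensor_graded_ext2];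
        (intro clinear_mult_right clinear_compose[OF Theta_clinear] clinear_id
          | rule *[THEN conjunct2]))
  show "(embed a \<otimes>\<^sub>M 1) * comult' b = mult_map Theta ((embed ?a \<otimes>\<^sub>M 1) * \<Delta> b)"
    by (rule multiplier_eqI, rule fun_cong[OF Theta_ext], simp add: comult'_def mult_left_map Theta_hom Theta_bij l)
  show "comult' b * (embed a \<otimes>\<^sub>M 1) = mult_map Theta (\<Delta> b * (embed ?a \<otimes>\<^sub>M 1))"
    by (rule multiplier_eqI_right, rule fun_cong[OF Theta_ext], simp add: comult'_def mult_left_map Theta_hom Theta_bij r)
qed

end

section \<open>Canonical maps of the deformed comultiplication\<close>

context deformation
begin

lemma Theta_one: "mult_map Theta (1 \<otimes>\<^sub>M embed y) = 1 \<otimes>\<^sub>M embed y"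
  unfolding Theta_def by (intro mult_map_twist_one pi_hom pi_bij inv_closed; assumption)

lemma can1_comult': "can1 comult' a b = mult_map Theta (can1 \<Delta> a b)"
  and can4_comult': "can4 comult' a b = mult_map Theta (can4 \<Delta> a b)"
  by (simp_all add: can1_def can4_def comult'_def mult_map_mult Theta_hom Theta_bij Theta_one)

lemma can2_comult':
  assumes "p \<in> carrier G" "r \<in> carrier G" "a \<in> B p" "b \<in> B r"
  shows "can2 comult' a b = mult_map Theta (can2 \<Delta> (\<pi> (r \<otimes> inv p) a) b)"
  unfolding can2_def by (rule comult'_mult_unit[OF assms])

lemma can3_comult':
  assumes "p \<in> carrier G" "r \<in> carrier G" "a \<in> B p" "b \<in> B r"
  shows "can3 comult' b a = mult_map Theta (can3 \<Delta> b (\<pi> (r \<otimes> inv p) a))"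
  unfolding can3_def by (rule comult'_mult_unit[OF assms])

lemma range_embed_bilinear:
  fixes T :: "'b \<Rightarrow> 'b \<Rightarrow> ('b, 'b) tensor multiplier"
  assumes T: "cbilinear T"
    and hom: "\<And>p r a b. p \<in> carrier G \<Longrightarrow> r \<in> carrier G \<Longrightarrow> a \<in> B p \<Longrightarrow> b \<in> B r \<Longrightarrow> T a b \<in> range embed"
  shows "T a b \<in> range embed"
proof -
  have lin: "clinear (\<lambda>a. T a b)" "clinear (T a)" for a b
    using T by (simp_all add: cbilinear_def)
  note embed_linear = clinear_embed[OF clinear_id(1)]
  have zero: "0 \<in> range embed"
    by (rule range_eqI[of _ _ 0]) (simp add: clinear_zero[OF embed_linear])
  have add: "m + n \<in> range embed" if "m \<in> range embed" "n \<in> range embed" for m n :: "('b, 'b) tensor multiplier"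
    using that by (auto simp: clinear_add[OF embed_linear, symmetric])
  show ?thesis
  proof (induction a rule: graded_induct)
    case (homogeneous p a)
    then show ?case
      by (induction b rule: graded_induct)
        (simp_all only: clinear_zero[OF lin(2)] clinear_add[OF lin(2)] zero add hom)
  qed (simp_all only: clinear_zero[OF lin(1)] clinear_add[OF lin(1)] zero add)
qed

lemma range_comult':
  "can1 comult' a b \<in> range embed" "can2 comult' a b \<in> range embed"
  "can3 comult' a b \<in> range embed" "can4 comult' a b \<in> range embed"
proof -
  show "can1 comult' a b \<in> range embed" "can4 comult' a b \<in> range embed"
    unfolding can1_comult' can4_comult' mult_map_range_embed[OF Theta_hom Theta_bij]
    by (rule range1 range4)+
  show "can2 comult' a b \<in> range embed"
    by (rule range_embed_bilinear[OF cbilinear_can2[OF comult'_clinear]])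
      (simp only: can2_comult' mult_map_range_embed[OF Theta_hom Theta_bij] range2)
  show "can3 comult' a b \<in> range embed"
    by (rule range_embed_bilinear[OF cbilinear_can3[OF comult'_clinear]])
      (simp only: can3_comult' mult_map_range_embed[OF Theta_hom Theta_bij] range3)
qed

lemma unembed_can1_comult': "unembed (can1 comult' a b) = Theta (unembed (can1 \<Delta> a b))"
  and unembed_can4_comult': "unembed (can4 comult' a b) = Theta (unembed (can4 \<Delta> a b))"
  unfolding can1_comult' can4_comult'
  by (rule mult_map_range_embed[OF Theta_hom Theta_bij], rule range1 range4)+

lemma unembed_can2_comult':
  assumes "p \<in> carrier G" "r \<in> carrier G" "a \<in> B p" "b \<in> B r"
  shows "unembed (can2 comult' a b) = Theta (unembed (can2 \<Delta> (\<pi> (r \<otimes> inv p) a) b))"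
  unfolding can2_comult'[OF assms]
  by (rule mult_map_range_embed[OF Theta_hom Theta_bij], rule range2)

lemma unembed_can3_comult':
  assumes "p \<in> carrier G" "r \<in> carrier G" "a \<in> B p" "b \<in> B r"
  shows "unembed (can3 comult' b a) = Theta (unembed (can3 \<Delta> b (\<pi> (r \<otimes> inv p) a)))"
  unfolding can3_comult'[OF assms]
  by (rule mult_map_range_embed[OF Theta_hom Theta_bij], rule range3)

definition Psi :: "('b, 'b) tensor \<Rightarrow> ('b, 'b) tensor" where
  "Psi = twist (\<lambda>r. glue (\<lambda>p. \<pi> (r \<otimes> inv p)))"

lemma clinear_glue_pi:
  "r \<in> carrier G \<Longrightarrow> clinear (glue (\<lambda>p. \<pi> (r \<otimes> inv p)))"
  "r \<in> carrier G \<Longrightarrow> clinear (glue (\<lambda>s. \<pi> (inv r \<otimes> s)))"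
  by (intro clinear_glue pi_clinear; simp)+

lemma glue_pi:
  "a \<in> B p \<Longrightarrow> p \<in> carrier G \<Longrightarrow> r \<in> carrier G \<Longrightarrow> glue (\<lambda>p. \<pi> (r \<otimes> inv p)) a = \<pi> (r \<otimes> inv p) a"
  "a \<in> B p \<Longrightarrow> p \<in> carrier G \<Longrightarrow> r \<in> carrier G \<Longrightarrow> glue (\<lambda>s. \<pi> (inv r \<otimes> s)) a = \<pi> (inv r \<otimes> p) a"
  by (intro glue_homogeneous pi_clinear; simp)+

text \<open>For a of degree p the element \<open>\<pi> (r \<otimes> inv p) a\<close> has a degree s
  acting like r p r^-1. Hence \<pi>_{r^-1 s} = \<pi>_{p r^-1} undoes the map, and this inverse is
  again defined degree by degree.\<close>

lemma bij_glue_pi: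
  assumes r: "r \<in> carrier G"
  shows "bij (glue (\<lambda>p. \<pi> (r \<otimes> inv p)))"
proof (rule o_bij)
  show "glue (\<lambda>s. \<pi> (inv r \<otimes> s)) \<circ> glue (\<lambda>p. \<pi> (r \<otimes> inv p)) = id"
  proof (rule graded_ext)
    fix p x assume p: "p \<in> carrier G" "x \<in> B p"
    obtain s where s: "s \<in> carrier G" "\<pi> (r \<otimes> inv p) x \<in> B s"
      "\<pi> s = \<pi> ((r \<otimes> inv p) \<otimes> p \<otimes> inv (r \<otimes> inv p))"
      using pi_homogeneous[of "r \<otimes> inv p" p] p r by (metis inv_closed m_closed)
    have "\<pi> s y = \<pi> r (\<pi> p (\<pi> (inv r) y))" for y
      unfolding s(3) using p r by (simp add: pi_mult inv_mult_group)
    then show "(glue (\<lambda>s. \<pi> (inv r \<otimes> s)) \<circ> glue (\<lambda>p. \<pi> (r \<otimes> inv p))) x = id x"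
      using p r s by (simp add: glue_pi pi_mult)
  qed (intro clin clinear_glue_pi r)+
  show "glue (\<lambda>p. \<pi> (r \<otimes> inv p)) \<circ> glue (\<lambda>s. \<pi> (inv r \<otimes> s)) = id"
  proof (rule graded_ext)
    fix s x assume s: "s \<in> carrier G" "x \<in> B s"
    obtain p where p: "p \<in> carrier G" "\<pi> (inv r \<otimes> s) x \<in> B p"
      "\<pi> p = \<pi> ((inv r \<otimes> s) \<otimes> s \<otimes> inv (inv r \<otimes> s))"
      using pi_homogeneous[of "inv r \<otimes> s" s] s r by (metis inv_closed m_closed)
    have "\<pi> (inv p) = \<pi> (inv ((inv r \<otimes> s) \<otimes> s \<otimes> inv (inv r \<otimes> s)))"
      by (rule pi_inv_cong) (use p r s in simp_all)
    then have "\<pi> (inv p) y = \<pi> (inv r) (\<pi> (inv s) (\<pi> r y))" for y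
      using s r by (simp add: pi_mult inv_mult_group)
    then show "(glue (\<lambda>p. \<pi> (r \<otimes> inv p)) \<circ> glue (\<lambda>s. \<pi> (inv r \<otimes> s))) x = id x"
      using p r s by (simp add: glue_pi pi_mult)
  qed (intro clin clinear_glue_pi r)+
qed

lemma Psi_bij: "bij Psi" and Psi_clinear: "clinear Psi"
  unfolding Psi_def by (intro bij_twist clinear_twist clinear_glue_pi bij_glue_pi; assumption)+

lemma Psi_tensor:
  "p \<in> carrier G \<Longrightarrow> r \<in> carrier G \<Longrightarrow> a \<in> B p \<Longrightarrow> b \<in> B r \<Longrightarrow> Psi (a \<otimes>\<^sub>C b) = \<pi> (r \<otimes> inv p) a \<otimes>\<^sub>C b"
  unfolding Psi_def
  by (subst twist_tensor[of _ r]) (simp_all only: clinear_glue_pi glue_pi(1)[of a p r])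

text \<open>Each deformed canonical map is the original one composed with bijections. In the third
  one the multiplied element sits in the second leg, whence the flips around
  \<open>Psi\<close>.\<close>

lemma
  shows galois1_comult': "galois (can1 comult') = Theta \<circ> galois (can1 \<Delta>)"
    and galois2_comult': "galois (can2 comult') = Theta \<circ> galois (can2 \<Delta>) \<circ> Psi"
    and galois3_comult': "galois (can3 comult') = Theta \<circ> galois (can3 \<Delta>) \<circ> (tensor_flip \<circ> Psi \<circ> tensor_flip)"
    and galois4_comult': "galois (can4 comult') = Theta \<circ> galois (can4 \<Delta>)"
proof -
  note c = cbilinear_can1[OF comult'_clinear] cbilinear_can2[OF comult'_clinear]
    cbilinear_can3[OF comult'_clinear] cbilinear_can4[OF comult'_clinear]
  note lin' = clinear_galois[OF c(1) range_comult'(1)] clinear_galois[OF c(2) range_comult'(2)]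
    clinear_galois[OF c(3) range_comult'(3)] clinear_galois[OF c(4) range_comult'(4)]
    clinear_galois1 clinear_galois2 clinear_galois3 clinear_galois4 Theta_clinear Psi_clinear
    clinear_tensor_flip clinear_comp
  note ten = galois_tensor[OF c(1) range_comult'(1)] galois_tensor[OF c(2) range_comult'(2)]
    galois_tensor[OF c(3) range_comult'(3)] galois_tensor[OF c(4) range_comult'(4)]
    galois1_tensor galois2_tensor galois3_tensor galois4_tensor
  show "galois (can1 comult') = Theta \<circ> galois (can1 \<Delta>)" "galois (can4 comult') = Theta \<circ> galois (can4 \<Delta>)"
    by (rule tensor_ext; simp add: lin' ten unembed_can1_comult' unembed_can4_comult')+
  show "galois (can2 comult') = Theta \<circ> galois (can2 \<Delta>) \<circ> Psi"
    by (rule tensor_graded_ext2) (simp_all add: lin' ten Psi_tensor unembed_can2_comult')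
  show "galois (can3 comult') = Theta \<circ> galois (can3 \<Delta>) \<circ> (tensor_flip \<circ> Psi \<circ> tensor_flip)"
    by (rule tensor_graded_ext2) (simp_all add: lin' ten Psi_tensor unembed_can3_comult')
qed

text \<open>Both iterated deformed comultiplications are \<open>\<Theta>\<^sub>3\<close> applied to the iterated original one.\<close>

definition Theta3 :: "(('b, 'b) tensor, 'b) tensor \<Rightarrow> (('b, 'b) tensor, 'b) tensor" where
  "Theta3 = twist (\<lambda>q. Theta \<circ> pi2 (inv q))"

section \<open>Coassociativity of the deformation\<close>

lemma Theta_pi2_hom: "q \<in> carrier G \<Longrightarrow> algebra_hom (Theta \<circ> pi2 (inv q))"
  and Theta_pi2_bij: "q \<in> carrier G \<Longrightarrow> bij (Theta \<circ> pi2 (inv q))"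
  by (intro algebra_hom_compose bij_comp Theta_hom Theta_bij pi2_hom pi2_bij inv_closed; assumption)+

lemma Theta3_hom: "algebra_hom Theta3" and Theta3_bij: "bij Theta3"
  unfolding Theta3_def by (intro algebra_hom_twist bij_twist_hom Theta_pi2_hom Theta_pi2_bij; assumption)+

lemma mult_map_Theta3:
  assumes "q \<in> carrier G" "y \<in> B q"
  shows "mult_map Theta3 (m \<otimes>\<^sub>M embed y) = mult_map Theta (mult_map (pi2 (inv q)) m) \<otimes>\<^sub>M embed y"
proof -
  have "mult_map Theta3 (m \<otimes>\<^sub>M embed y) = mult_map (Theta \<circ> pi2 (inv q)) m \<otimes>\<^sub>M embed y"
    unfolding Theta3_def by (rule mult_map_twist) (simp_all add: Theta_pi2_hom Theta_pi2_bij assms)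
  then show ?thesis
    using assms by (simp add: mult_map_compose Theta_hom Theta_bij pi2_hom pi2_bij)
qed

lemma Theta3_one: "mult_map Theta3 (1 \<otimes>\<^sub>M embed y) = 1 \<otimes>\<^sub>M embed y"
  unfolding Theta3_def by (intro mult_map_twist_one Theta_pi2_hom Theta_pi2_bij; assumption)

text \<open>The inner twist uses the degree w of \<pi>_t^-1(v), and \<pi>_w^-1 \<pi>_t^-1 =
  \<pi>_{st}^-1 by admissibility. So the first leg sees only the total degree of the other
  two.\<close>

lemma Theta3_tensor:
  assumes "s \<in> carrier G" "t \<in> carrier G" "v \<in> B s" "z \<in> B t"
  shows "Theta3 ((u \<otimes>\<^sub>C v) \<otimes>\<^sub>C z) = (\<pi> (inv (s \<otimes> t)) u \<otimes>\<^sub>C \<pi> (inv t) v) \<otimes>\<^sub>C z"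
proof -
  obtain w where w: "w \<in> carrier G" "\<pi> (inv t) v \<in> B w" "\<pi> w = \<pi> (inv t \<otimes> s \<otimes> inv (inv t))"
    using pi_homogeneous[of "inv t" s] assms by (metis inv_closed)
  have "\<pi> (inv w) = \<pi> (inv (inv t \<otimes> s \<otimes> inv (inv t)))"
    by (rule pi_inv_cong) (use w assms in simp_all)
  then have "\<pi> (inv w) (\<pi> (inv t) u) = \<pi> (inv (s \<otimes> t)) u"
    using assms by (simp add: pi_mult inv_mult_group)
  moreover have "Theta3 ((u \<otimes>\<^sub>C v) \<otimes>\<^sub>C z) = (Theta (\<pi> (inv t) u \<otimes>\<^sub>C \<pi> (inv t) v)) \<otimes>\<^sub>C z"
    unfolding Theta3_def
    using assms by (simp add: twist_tensor algebra_hom_clinear[OF Theta_pi2_hom] pi2_tensor)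
  ultimately show ?thesis
    using w by (simp add: Theta_tensor)
qed

text \<open>Because \<Delta> commutes with the action, deforming \<pi>_q^-1(v) gives the twist of
  (\<pi>_q^-1 \<otimes> \<pi>_q^-1)\<Delta>(v), which is how \<open>Theta3\<close> was
  defined.\<close>

lemma comult_fst_Theta: "comult_fst comult' (Theta t) = mult_map Theta3 (comult_fst \<Delta> t)"
proof (rule fun_cong[OF tensor_graded_ext])
  fix q v y assume q: "q \<in> carrier G" "y \<in> B q"
  then show "comult_fst comult' (Theta (v \<otimes>\<^sub>C y)) = mult_map Theta3 (comult_fst \<Delta> (v \<otimes>\<^sub>C y))"
    by (simp add: Theta_tensor comult_fst_tensor comult'_clinear lin mult_map_Theta3 comult'_def comult_pi)
qed (intro clinear_compose[OF clinear_comult_fst] clinear_compose[OF clinear_mult_map]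
    clinear_comult_fst comult'_clinear lin Theta_clinear Theta3_hom Theta3_bij)+

text \<open>On the left the first leg is moved by the degree r of y, on the right by the total
  degree st of the two legs of \<Delta>(y). These agree wherever \<Delta>(y) acts
  nontrivially.\<close>

lemma comult_snd_Theta:
  "mult_map tensor_assoc (comult_snd comult' (Theta t)) =
    mult_map Theta3 (mult_map tensor_assoc (comult_snd \<Delta> t))"
proof (rule fun_cong[OF tensor_graded_ext])
  note assoc = algebra_hom_tensor_assoc[where 'a = 'b and 'b = 'b and 'c = 'b]
    bij_tensor_assoc[where 'a = 'b and 'b = 'b and 'c = 'b]
  note Theta3 = Theta3_hom Theta3_bij
  show "clinear (\<lambda>t. mult_map tensor_assoc (comult_snd comult' (Theta t)))"
    "clinear (\<lambda>t. mult_map Theta3 (mult_map tensor_assoc (comult_snd \<Delta> t)))"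
    by (intro clinear_compose[OF clinear_comult_snd] clinear_compose[OF clinear_mult_map]
        clinear_comult_snd comult'_clinear lin Theta_clinear Theta3 assoc)+
  fix r x y assume r: "r \<in> carrier G" "y \<in> B r"
  \<comment> \<open>The comparison is one of linear maps on right-bracketed tensors, whereas
    \<open>Theta3\<close> acts on left-bracketed ones, so \<open>Theta3\<close> is conjugated by the
    rebracketing.\<close>
  have eq: "Theta3 \<circ> tensor_assoc \<circ> mult_left (embed x \<otimes>\<^sub>M \<Delta> y) =
      tensor_assoc \<circ> mult_left (embed (\<pi> (inv r) x) \<otimes>\<^sub>M comult' y) \<circ> (inv_into UNIV tensor_assoc \<circ> Theta3 \<circ> tensor_assoc)"
  proof (rule tensor_ext[OF _ _ fun_cong[OF tensor_graded_ext2]])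
    fix u s t v z assume h: "s \<in> carrier G" "t \<in> carrier G" "v \<in> B s" "z \<in> B t"
    have inv_assoc: "inv_into UNIV tensor_assoc ((a \<otimes>\<^sub>C b) \<otimes>\<^sub>C c) = a \<otimes>\<^sub>C (b \<otimes>\<^sub>C c)" for a b c :: 'b
      by (metis bij_inv_eq_iff bij_tensor_assoc tensor_assoc_tensor)
    let ?w = "mult_left (\<Delta> y) (v \<otimes>\<^sub>C z)"
    have D: "mult_left (comult' y) (\<pi> (inv t) v \<otimes>\<^sub>C z) = Theta ?w"
      using h by (simp add: Theta_tensor[symmetric] comult'_def mult_left_map Theta_hom Theta_bij)
    have "Theta3 (tensor_assoc ((x * u) \<otimes>\<^sub>C ?w)) =
        tensor_assoc ((\<pi> (inv r) x * \<pi> (inv (s \<otimes> t)) u) \<otimes>\<^sub>C Theta ?w)"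
    proof (cases "s \<otimes> t = r")
      case True
      \<comment> \<open>Inserting \<open>proj2 s t\<close> makes the identity true for every tensor
        w, so that it can be checked on elementary ones; \<open>?w\<close> itself is fixed by the
        projection.\<close>
      have "(\<lambda>w. Theta3 (tensor_assoc ((x * u) \<otimes>\<^sub>C proj2 s t w))) =
          (\<lambda>w. tensor_assoc ((\<pi> (inv r) x * \<pi> (inv (s \<otimes> t)) u) \<otimes>\<^sub>C Theta (proj2 s t w)))"
        by (rule tensor_ext)
          (use h r in \<open>auto intro!: clin clinear_compose[OF algebra_hom_clinear[OF Theta3_hom]]
            clinear_compose[OF clinear_tensor_assoc] clinear_compose[OF Theta_clinear] clinear_proj2
            simp: proj2_tensor Theta3_tensor Theta_tensor True algebra_hom_mult[OF pi_hom]\<close>)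
      then show ?thesis
        using h by (metis proj2_mult_left(1))
    next
      case False
      then have "?w = 0" using r h by (simp add: comult_support)
      then show ?thesis
        by (simp add: clinear_zero[OF Theta_clinear] tensor_zero clinear_zero[OF clinear_tensor_assoc]
            clinear_zero[OF algebra_hom_clinear[OF Theta3_hom]])
    qed
    then show "(Theta3 \<circ> tensor_assoc \<circ> mult_left (embed x \<otimes>\<^sub>M \<Delta> y)) (u \<otimes>\<^sub>C (v \<otimes>\<^sub>C z)) =
      (tensor_assoc \<circ> mult_left (embed (\<pi> (inv r) x) \<otimes>\<^sub>M comult' y) \<circ>
        (inv_into UNIV tensor_assoc \<circ> Theta3 \<circ> tensor_assoc)) (u \<otimes>\<^sub>C (v \<otimes>\<^sub>C z))"
      using h by (simp add: Theta3_tensor inv_assoc D)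
  qed (intro clinear_comp clinear_inv bij_tensor_assoc clinear_tensor_assoc mult_left_linear
      algebra_hom_clinear[OF Theta3_hom] clinear_compose[OF clinear_comp] clin)+
  show "mult_map tensor_assoc (comult_snd comult' (Theta (x \<otimes>\<^sub>C y))) =
      mult_map Theta3 (mult_map tensor_assoc (comult_snd \<Delta> (x \<otimes>\<^sub>C y)))"
  proof (rule mult_map_eqI[OF assoc])
    fix t
    obtain t' where t: "tensor_assoc t = Theta3 (tensor_assoc t')"
      by (metis Theta3_bij bij_pointE bij_tensor_assoc)
    then have t': "inv_into UNIV tensor_assoc (Theta3 (tensor_assoc t')) = t"
      by (metis bij_inv_eq_iff bij_tensor_assoc)
    show "mult_left (mult_map Theta3 (mult_map tensor_assoc (comult_snd \<Delta> (x \<otimes>\<^sub>C y)))) (tensor_assoc t) =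
        tensor_assoc (mult_left (comult_snd comult' (Theta (x \<otimes>\<^sub>C y))) t)"
      using fun_cong[OF eq, of t'] r
      by (simp add: t mult_left_map Theta3 assoc t' Theta_tensor lin comult'_clinear)
  qed
qed

text \<open>For homogeneous arguments both sides are the image under \<open>Theta3\<close> of the
  coassociativity identity of \<Delta> for \<open>?a\<close>, b and c: pulling a through the twist
  on the left produces the same substitution \<open>?a\<close> as the second canonical product on
  the right.\<close>

lemma coassoc_comult':
  "((embed a \<otimes>\<^sub>M 1) \<otimes>\<^sub>M 1) * comult_fst comult' (unembed (can1 comult' b c)) =
    mult_map tensor_assoc (comult_snd comult' (unembed (can2 comult' a b))) * (1 \<otimes>\<^sub>M embed c)"
proof -
  let ?E = "\<lambda>a :: 'b. (embed a \<otimes>\<^sub>M (1 :: 'b multiplier)) \<otimes>\<^sub>M (1 :: 'b multiplier)"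
  let ?L = "\<lambda>a b c. ?E a * comult_fst comult' (unembed (can1 comult' b c))"
  let ?R = "\<lambda>a b c. mult_map tensor_assoc (comult_snd comult' (unembed (can2 comult' a b))) * (1 \<otimes>\<^sub>M embed c)"
  note assoc = algebra_hom_tensor_assoc[where 'a = 'b and 'b = 'b and 'c = 'b]
    bij_tensor_assoc[where 'a = 'b and 'b = 'b and 'c = 'b]
  have lin1: "clinear (\<lambda>c. unembed (can1 comult' b c))" "clinear (\<lambda>b. unembed (can1 comult' b c))" for b c
    by (intro clinear_unembed range_comult';
        use cbilinear_can1[OF comult'_clinear] in \<open>simp add: cbilinear_def\<close>)+
  have lin2: "clinear (\<lambda>c. unembed (can2 comult' b c))" "clinear (\<lambda>b. unembed (can2 comult' b c))" for b c
    by (intro clinear_unembed range_comult';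
        use cbilinear_can2[OF comult'_clinear] in \<open>simp add: cbilinear_def\<close>)+
  note comp = clinear_compose[OF clinear_comult_fst[OF comult'_clinear]]
    clinear_compose[OF clinear_comult_snd[OF comult'_clinear]] clinear_compose[OF clinear_mult_map[OF assoc]]
  have linL: "clinear (\<lambda>a. ?L a b c)" "clinear (\<lambda>b. ?L a b c)" "clinear (\<lambda>c. ?L a b c)" for a b c
    by (intro clin comp lin1)+
  have linR: "clinear (\<lambda>a. ?R a b c)" "clinear (\<lambda>b. ?R a b c)" "clinear (\<lambda>c. ?R a b c)" for a b c
    by (intro clin comp lin2)+
  have hom: "?L a b c = ?R a b c"
    if h: "p \<in> carrier G" "r \<in> carrier G" "t \<in> carrier G" "a \<in> B p" "b \<in> B r" "c \<in> B t" for p r t a b c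
  proof -
    let ?a = "\<pi> (r \<otimes> inv p) a"
    have pure: "?E a * mult_map Theta3 (\<Delta> x \<otimes>\<^sub>M embed y) = mult_map Theta3 (?E ?a * (\<Delta> x \<otimes>\<^sub>M embed y))"
      if x: "x \<in> B (r \<otimes> inv t)" and y: "y \<in> B t" for x y
    proof -
      obtain r' where r': "r' \<in> carrier G" "\<pi> (inv t) x \<in> B r'"
        "\<pi> r' = \<pi> (inv t \<otimes> (r \<otimes> inv t) \<otimes> inv (inv t))"
        using pi_homogeneous[of "inv t" "r \<otimes> inv t"] h x by (metis inv_closed m_closed)
      \<comment> \<open>The degree r' acts like t^-1 r, so the substitution for \<pi>_t^-1(x) is
        \<pi>_t^-1 applied to the one for b.\<close>
      have pr': "\<pi> (r' \<otimes> inv p) a = \<pi> (inv t) ?a"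
        using r' h by (simp add: pi_mult)
      have "(embed a \<otimes>\<^sub>M 1) * comult' (\<pi> (inv t) x) =
          mult_map Theta ((embed (\<pi> (inv t) ?a) \<otimes>\<^sub>M 1) * \<Delta> (\<pi> (inv t) x))"
        using comult'_mult_unit(1)[OF h(1) r'(1) h(4) r'(2)] unfolding pr' .
      also have "(embed (\<pi> (inv t) ?a) \<otimes>\<^sub>M 1) * \<Delta> (\<pi> (inv t) x) =
          mult_map (pi2 (inv t)) ((embed ?a \<otimes>\<^sub>M 1) * \<Delta> x)"
        using h by (simp add: mult_map_mult pi2_hom pi2_bij mult_map_tensor_map pi_hom pi_bij
            mult_map_embed comult_pi)
      finally show ?thesis
        using h y by (simp add: mult_map_Theta3 mult_tensor_mult comult'_def comult_pi)
    qed
    have "?L a b c = ?E a * mult_map Theta3 (comult_fst \<Delta> (unembed (can1 \<Delta> b c)))"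
      by (simp add: unembed_can1_comult' comult_fst_Theta)
    also have "\<dots> = mult_map Theta3 (?E ?a * comult_fst \<Delta> (unembed (can1 \<Delta> b c)))"
    proof (rule clinear_eq_on_span[OF _ _ _ can1_homogeneous])
      fix s assume "s \<in> homogeneous_tensors (r \<otimes> inv t) t"
      then show "?E a * mult_map Theta3 (comult_fst \<Delta> s) = mult_map Theta3 (?E ?a * comult_fst \<Delta> s)"
        using pure lin by auto
    qed (use h in \<open>auto intro!: clin clinear_compose[OF clinear_mult_map] clinear_comult_fst lin Theta3_hom Theta3_bij\<close>)
    also have "\<dots> = mult_map Theta3 (mult_map tensor_assoc (comult_snd \<Delta> (unembed (can2 \<Delta> ?a b))) * (1 \<otimes>\<^sub>M embed c))"
      by (simp only: coassoc)
    also have "\<dots> = ?R a b c"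
      using h by (simp add: mult_map_mult Theta3_hom Theta3_bij Theta3_one comult_snd_Theta unembed_can2_comult')
    finally show ?thesis .
  qed
  have 1: "?L a b c = ?R a b c" if "r \<in> carrier G" "t \<in> carrier G" "b \<in> B r" "c \<in> B t" for r t a b c
    by (rule fun_cong[OF graded_ext[OF linL(1) linR(1)]]) (rule hom[OF _ that(1,2) _ that(3,4)])
  have 2: "?L a b c = ?R a b c" if "t \<in> carrier G" "c \<in> B t" for t a b c
    by (rule fun_cong[OF graded_ext[OF linL(2) linR(2)]]) (rule 1[OF _ that(1) _ that(2)])
  show ?thesis
    by (rule fun_cong[OF graded_ext[OF linL(3) linR(3)]]) (rule 2)
qed

theorem regular_comult': "regular_multiplier_hopf comult'"
proof -
  have "bij (galois (can1 comult'))" "bij (galois (can2 comult'))"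
    "bij (galois (can3 comult'))" "bij (galois (can4 comult'))"
    unfolding galois1_comult' galois2_comult' galois3_comult' galois4_comult'
    by (intro bij_comp Theta_bij Psi_bij bij_tensor_flip bij_galois1 bij_galois2 bij_galois3 bij_galois4)+
  then show ?thesis
    unfolding regular_multiplier_hopf_iff multiplier_hopf_def comultiplication_def
    using comult'_hom range_comult' coassoc_comult'
    by (simp add: galois_def comult_fst_def comult_snd_def)
qed

text \<open>\<open>Theta\<close> agrees with \<open>tensor_map (\<pi> (inv q)) id\<close> on tensors
  whose second leg has degree q, that is, on those fixed by \<open>?Q\<close>. It remains to see
  that multiplying by 1 \<otimes> b' confines \<Delta>(b) to such tensors, for b that need not be
  homogeneous.\<close>

lemma is_deformed_comult': "is_deformed_comult G B \<pi> \<Delta> comult'"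
proof -
  have "unembed (can1 comult' b b') = tensor_map (\<pi> (inv q)) id (unembed (can1 \<Delta> b b'))"
    "unembed (can4 comult' b' b) = tensor_map (\<pi> (inv q)) id (unembed (can4 \<Delta> b' b))"
    if q: "q \<in> carrier G" "b' \<in> B q" for q b b'
  proof -
    let ?Q = "tensor_map (\<lambda>x. x) (\<lambda>y. component G B y q) :: ('b, 'b) tensor \<Rightarrow> _"
    have lin: "clinear ?Q" "clinear (\<lambda>y. component G B y q)" by (intro clin clinear_component)+
    have Q: "?Q (x \<otimes>\<^sub>C y) = x \<otimes>\<^sub>C component G B y q" for x y
      using lin(2) by (simp add: tensor_map_tensor clin)
    have fixed: "Theta t = tensor_map (\<pi> (inv q)) id t" if "?Q t = t" for t
    proof -
      have "Theta \<circ> ?Q = tensor_map (\<pi> (inv q)) id \<circ> ?Q"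
        by (rule tensor_ext) (use q in \<open>simp_all add: clin lin Theta_clinear Q Theta_tensor
            tensor_map_tensor pi_clinear\<close>)
      then show ?thesis using that by (metis comp_apply)
    qed
    have mult: "?Q (s * t) = ?Q s * t" "?Q (s * t) = s * ?Q t" for s t
    proof -
      note z = clinear_zero[OF lin(1)] and a = clinear_add[OF lin(1)]
      show "?Q (s * t) = ?Q s * t"
      proof (induction s)
        case (tensor x y)
        show ?case
          by (induction t) (simp_all add: z a distrib_left tensor_mult_tensor Q component_mult_left)
      qed (simp_all add: z a distrib_right)
      show "?Q (s * t) = s * ?Q t"
      proof (induction s)
        case (tensor x y)
        show ?case
          by (induction t) (simp_all add: z a distrib_left tensor_mult_tensor Q component_mult_right)
      qed (simp_all add: z a distrib_right)
    qed
    \<comment> \<open>The central projection \<open>?Q\<close> is shifted onto the test element,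
      where the factor 1 \<otimes> b' of degree q absorbs it.\<close>
    have one: "mult_left (1 \<otimes>\<^sub>M embed b') (?Q t) = mult_left (1 \<otimes>\<^sub>M embed b') t" for t
      by (rule fun_cong[OF tensor_ext])
        (use q in \<open>auto intro!: clin lin simp: Q component_mult_right[symmetric]
          component_mult_left component_homogeneous[of q b']\<close>)
    have one': "mult_right (1 \<otimes>\<^sub>M embed b') (?Q t) = mult_right (1 \<otimes>\<^sub>M embed b') t" for t
      by (rule fun_cong[OF tensor_ext])
        (use q in \<open>auto intro!: clin lin simp: Q component_mult_left[symmetric]
          component_mult_right component_homogeneous[of q b']\<close>)
    have m1: "unembed (can1 \<Delta> b b') * u = mult_left (\<Delta> b) (mult_left (1 \<otimes>\<^sub>M embed b') u)" for u
      by (subst mult_left_unembed[OF range1]) (simp add: can1_def)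
    have m4: "u * unembed (can4 \<Delta> b' b) = mult_right (\<Delta> b) (mult_right (1 \<otimes>\<^sub>M embed b') u)" for u
      by (subst mult_right_unembed[OF range4]) (simp add: can4_def)
    have "?Q (unembed (can1 \<Delta> b b')) * t = unembed (can1 \<Delta> b b') * t" for t
    proof -
      have "?Q (unembed (can1 \<Delta> b b')) * t = unembed (can1 \<Delta> b b') * ?Q t"
        by (simp only: mult[symmetric])
      then show ?thesis
        by (simp only: m1 one)
    qed
    then have "(?Q (unembed (can1 \<Delta> b b')) - unembed (can1 \<Delta> b b')) * t = 0" for t
      by (simp add: left_diff_distrib)
    then have 1: "?Q (unembed (can1 \<Delta> b b')) = unembed (can1 \<Delta> b b')"
      using nondegenerate_left eq_iff_diff_eq_0 by blast
    show "unembed (can1 comult' b b') = tensor_map (\<pi> (inv q)) id (unembed (can1 \<Delta> b b'))"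
      unfolding unembed_can1_comult' by (rule fixed[OF 1])
    have "t * ?Q (unembed (can4 \<Delta> b' b)) = t * unembed (can4 \<Delta> b' b)" for t
    proof -
      have "t * ?Q (unembed (can4 \<Delta> b' b)) = ?Q t * unembed (can4 \<Delta> b' b)"
        by (simp only: mult[symmetric])
      then show ?thesis
        by (simp only: m4 one')
    qed
    then have "t * (?Q (unembed (can4 \<Delta> b' b)) - unembed (can4 \<Delta> b' b)) = 0" for t
      by (simp add: right_diff_distrib)
    then have 4: "?Q (unembed (can4 \<Delta> b' b)) = unembed (can4 \<Delta> b' b)"
      using nondegenerate_right eq_iff_diff_eq_0 by blast
    show "unembed (can4 comult' b' b) = tensor_map (\<pi> (inv q)) id (unembed (can4 \<Delta> b' b))"
      unfolding unembed_can4_comult' by (rule fixed[OF 4])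
  qed
  then show ?thesis
    unfolding is_deformed_comult_def can1_def[symmetric] can4_def[symmetric]
    by (metis embed_unembed range_comult'(1,4))
qed

end

section \<open>Involutions on tensor products and multipliers\<close>

lemma involution_tensor_star:
  fixes st :: "'a::nondegenerate_complex_algebra \<Rightarrow> 'a"
  assumes "involution st"
  shows "involution (tensor_star st)" and "tensor_star st (x \<otimes>\<^sub>C y) = st x \<otimes>\<^sub>C st y"
proof -
  have st: "st (a + b) = st a + st b" "st (c *\<^sub>C a) = cnj c *\<^sub>C st a" "st (a * b) = st b * st a"
    "st (st a) = a" for a b c
    using assms by (auto simp: involution_def)
  have bal: "balanced (\<lambda>a b. st a \<otimes>\<^sub>C st b)"
    by (simp add: balanced_def st tensor_add_left tensor_add_right tensor_scaleC_left tensor_scaleC_right)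
  have ten: "tensor_star st (x \<otimes>\<^sub>C y) = st x \<otimes>\<^sub>C st y" for x y
    unfolding tensor_star_def by (rule tensor_lift_tensor[OF bal])
  have add: "tensor_star st (s + t) = tensor_star st s + tensor_star st t" for s t
    unfolding tensor_star_def by (rule tensor_lift_add[OF bal])
  have zero: "tensor_star st 0 = 0"
    unfolding tensor_star_def by (rule tensor_lift_zero[OF bal])
  show "tensor_star st (x \<otimes>\<^sub>C y) = st x \<otimes>\<^sub>C st y" by (rule ten)
  have scale: "tensor_star st (c *\<^sub>C t) = cnj c *\<^sub>C tensor_star st t" for c t
    by (induction t)
      (simp_all add: zero add ten st cvec.scale_zero_right scaleC_add_right tensor_scaleC_left[symmetric])
  have mult: "tensor_star st (s * t) = tensor_star st t * tensor_star st s" for s t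
  proof (induction s)
    case (tensor x y)
    show ?case
      by (induction t) (simp_all add: zero add ten st distrib_left distrib_right tensor_mult_tensor)
  qed (simp_all add: zero add distrib_left distrib_right)
  have inv: "tensor_star st (tensor_star st t) = t" for t
    by (induction t) (simp_all add: zero add ten st)
  show "involution (tensor_star st)"
    using add scale mult inv by (simp add: involution_def)
qed

lemma mult_left_star:
  fixes st :: "'a::nondegenerate_complex_algebra \<Rightarrow> 'a"
  assumes "involution st"
  shows "mult_left (mult_star st m) x = st (mult_right m (st x))"
proof -
  have st: "st (a + b) = st a + st b" "st (c *\<^sub>C a) = cnj c *\<^sub>C st a" "st (a * b) = st b * st a"
    "st (st a) = a" for a b c
    using assms by (auto simp: involution_def)
  have "a * st (mult_right m (st b)) = st (mult_left m (st a)) * b" for a b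
    by (metis mult_left_right st(3,4))
  then have "double_centralizer (st \<circ> mult_right m \<circ> st) (st \<circ> mult_left m \<circ> st)"
    by (simp add: double_centralizer_def clinear_iff st mult_left_mult mult_right_mult
        clinear_add[OF mult_left_linear] clinear_add[OF mult_right_linear]
        clinear_scale[OF mult_left_linear] clinear_scale[OF mult_right_linear])
  then show ?thesis
    by (simp add: mult_star_def mult_left_Abs)
qed

context graded_algebra
begin

lemma bilinear_graded_ext:
  assumes "cbilinear h" "cbilinear k"
    "\<And>p q x y. p \<in> carrier G \<Longrightarrow> q \<in> carrier G \<Longrightarrow> x \<in> B p \<Longrightarrow> y \<in> B q \<Longrightarrow> h x y = k x y"
  shows "h a b = k a b"
proof -
  have lin: "clinear (\<lambda>a. h a b)" "clinear (\<lambda>a. k a b)" "clinear (h a)" "clinear (k a)" for a b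
    using assms(1,2) by (simp_all add: cbilinear_def)
  have "h a y = k a y" if "q \<in> carrier G" "y \<in> B q" for a q y
    by (rule fun_cong[OF graded_ext[OF lin(1,2)]]) (rule assms(3)[OF _ that(1) _ that(2)])
  then show ?thesis
    by (rule fun_cong[OF graded_ext[OF lin(3,4)]])
qed

lemma deformed_functional_eq_glue:
  "deformed_functional G B \<pi> \<psi> = glue (\<lambda>p x. \<psi> (\<pi> (inv p) x))"
  by (rule ext) (simp add: deformed_functional_def glue_def)

end

section \<open>Counit and antipode of the deformation\<close>

context deformation
begin

interpretation D: regular_hopf comult'
  by unfold_locales (rule regular_comult')

text \<open>The first defining identity fixes D(b)(1 \<otimes> y) for homogeneous y, hence for all y
  by linearity, and non-degeneracy recovers the multiplier D(b). So the description is
  unique.\<close>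

lemma deformed_comult_eq: "deformed_comult G B \<pi> \<Delta> = comult'"
  unfolding deformed_comult_def
proof (rule the_equality[where P = "is_deformed_comult G B \<pi> \<Delta>", OF is_deformed_comult'])
  fix D assume D: "is_deformed_comult G B \<pi> \<Delta> D"
  show "D = comult'"
  proof
    fix b
    have eq: "D b * (1 \<otimes>\<^sub>M embed y) = comult' b * (1 \<otimes>\<^sub>M embed y)" for y
    proof (rule fun_cong[OF graded_ext])
      fix q y assume "q \<in> carrier G" "y \<in> B q"
      then show "D b * (1 \<otimes>\<^sub>M embed y) = comult' b * (1 \<otimes>\<^sub>M embed y)"
        using D is_deformed_comult' by (simp add: is_deformed_comult_def)
    qed (intro clin)+
    show "D b = comult' b"
    proof (rule multiplier_tensor_eqI)
      fix x y :: 'b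
      have expand: "mult_left m (x \<otimes>\<^sub>C y) * (u \<otimes>\<^sub>C v) = mult_left (m * (1 \<otimes>\<^sub>M embed y)) ((x * u) \<otimes>\<^sub>C v)" for u v m
        by (simp add: mult_left_mult[symmetric] tensor_mult_tensor)
      have "(\<lambda>t. mult_left (D b) (x \<otimes>\<^sub>C y) * t) = (\<lambda>t. mult_left (comult' b) (x \<otimes>\<^sub>C y) * t)"
        by (rule tensor_ext) (simp_all only: expand eq clin)
      then have "(mult_left (D b) (x \<otimes>\<^sub>C y) - mult_left (comult' b) (x \<otimes>\<^sub>C y)) * t = 0" for t
        by (simp add: left_diff_distrib fun_eq_iff)
      then show "mult_left (D b) (x \<otimes>\<^sub>C y) = mult_left (comult' b) (x \<otimes>\<^sub>C y)"
        using nondegenerate_left eq_iff_diff_eq_0 by blast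
    qed
  qed
qed

lemma pi2_can1:
  assumes "p \<in> carrier G"
  shows "pi2 p (unembed (can1 \<Delta> a b)) = unembed (can1 \<Delta> (\<pi> p a) (\<pi> p b))"
proof -
  have "can1 \<Delta> (\<pi> p a) (\<pi> p b) = mult_map (pi2 p) (can1 \<Delta> a b)"
    using assms by (simp add: can1_def comult_pi mult_map_mult pi2_hom pi2_bij mult_map_tensor_map
        pi_hom pi_bij mult_map_embed)
  then show ?thesis
    using mult_map_range_embed(2)[OF pi2_hom[OF assms] pi2_bij[OF assms] range1] by metis
qed

lemma slice_fst_pi:
  assumes "p \<in> carrier G" "clinear f"
  shows "slice_fst (\<lambda>x. f (\<pi> p x)) t = \<pi> (inv p) (slice_fst f (pi2 p t))"
proof -
  have lin: "clinear (\<lambda>x. f (\<pi> p x))"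
    by (intro clinear_compose[OF assms(2)] pi_clinear assms(1))
  show ?thesis
    by (rule fun_cong[OF tensor_ext])
      (use assms lin in \<open>auto intro!: clinear_slice_fst clinear_compose[OF pi_clinear] clinear_compose[OF clinear_slice_fst]
        tensor_map_clinear pi_clinear simp: slice_fst_tensor pi2_tensor clinear_scale[OF pi_clinear]\<close>)
qed

text \<open>After the twist a leg x of degree p next to one of degree q is moved, by its new degree,
  to an element depending only on the total degree pq. This drives the computations for the antipode
  and the right integral.\<close>

lemma pi_inv_degree:
  assumes "p \<in> carrier G" "q \<in> carrier G" "x \<in> B p"
  obtains s where "s \<in> carrier G" "\<pi> (inv q) x \<in> B s" "\<pi> (inv s) (\<pi> (inv q) x) = \<pi> (inv (p \<otimes> q)) x"
proof -
  obtain s where s: "s \<in> carrier G" "\<pi> (inv q) x \<in> B s" "\<pi> s = \<pi> (inv q \<otimes> p \<otimes> inv (inv q))"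
    using pi_homogeneous[of "inv q" p] assms by (metis inv_closed)
  have "\<pi> (inv s) = \<pi> (inv (inv q \<otimes> p \<otimes> inv (inv q)))"
    by (rule pi_inv_cong) (use s assms in simp_all)
  then have "\<pi> (inv s) (\<pi> (inv q) x) = \<pi> (inv (p \<otimes> q)) x"
    using assms by (simp add: pi_mult inv_mult_group)
  with s that show ?thesis by blast
qed

text \<open>Since \<pi>_p respects \<Delta>, the functional \<epsilon> \<circ> \<pi>_p satisfies the
  counit identity; uniqueness does the rest.\<close>

lemma counit_pi:
  assumes "is_counit \<Delta> \<epsilon>" "p \<in> carrier G"
  shows "\<epsilon> (\<pi> p x) = \<epsilon> x"
proof -
  have lin: "clinear \<epsilon>" and eq: "\<And>a b. slice_fst \<epsilon> (unembed (can1 \<Delta> a b)) = a * b"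
    using assms(1) by (auto simp: is_counit_def algebra_hom_clinear)
  have "(\<lambda>x. \<epsilon> (\<pi> p x)) = \<epsilon>"
  proof (rule counit_unique[OF _ lin _ eq])
    show "clinear (\<lambda>x. \<epsilon> (\<pi> p x))"
      by (intro clinear_compose[OF lin] pi_clinear assms(2))
    show "slice_fst (\<lambda>x. \<epsilon> (\<pi> p x)) (unembed (can1 \<Delta> a b)) = a * b" for a b
      using assms(2) by (simp add: slice_fst_pi lin pi2_can1 eq algebra_hom_mult[OF pi_hom])
  qed
  then show ?thesis by metis
qed

text \<open>For y of degree q, \<epsilon>(x) y is a slice of a tensor spanned by \<Delta>(b)(1
  \<otimes> b') with b of degree pq and b' of degree q. Those slice to b b' = 0, as pq differs from
  q. If \<epsilon>(x) were nonzero, every y, and so x itself, would vanish.\<close>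

lemma counit_degree:
  assumes "is_counit \<Delta> \<epsilon>" "p \<in> carrier G" "x \<in> B p" "p \<noteq> \<one>"
  shows "\<epsilon> x = 0"
proof (rule ccontr)
  assume ne: "\<epsilon> x \<noteq> 0"
  have lin: "clinear \<epsilon>" and eq: "\<And>a b. slice_fst \<epsilon> (unembed (can1 \<Delta> a b)) = a * b"
    using assms(1) by (auto simp: is_counit_def algebra_hom_clinear)
  have "\<epsilon> x *\<^sub>C y = 0" for y :: 'b
  proof (rule fun_cong[OF graded_ext[of "\<lambda>y. \<epsilon> x *\<^sub>C y" "\<lambda>y. 0"]])
    fix q y assume q: "q \<in> carrier G" "y \<in> B q"
    have pq: "p \<otimes> q \<noteq> q" using assms(2,4) q(1) by (simp add: r_cancel_one)
    have "slice_fst \<epsilon> (x \<otimes>\<^sub>C y) = 0"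
    proof (rule can1_homogeneous_ext[OF clinear_slice_fst[OF lin] clinear_const_zero assms(2) q(1) assms(3) q(2)])
      fix b b' assume "b \<in> B (p \<otimes> q)" "b' \<in> B q"
      then show "slice_fst \<epsilon> (unembed (can1 \<Delta> b b')) = 0"
        unfolding eq by (intro orthogonal[OF _ q(1) pq] m_closed assms(2) q(1))
    qed
    then show "\<epsilon> x *\<^sub>C y = 0" by (simp add: slice_fst_tensor lin)
  qed (intro clin)+
  then have "x = 0" using ne by (metis cvec.scale_eq_0_iff)
  with ne show False by (simp add: clinear_zero lin)
qed

text \<open>\<epsilon> on the first leg does not see the twist because it is invariant under the
  action. On the second leg it selects degree 1, where the twist is trivial.\<close>

lemma is_counit_comult':
  assumes "is_counit \<Delta> \<epsilon>"
  shows "is_counit comult' \<epsilon>"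
proof -
  have hom: "algebra_hom \<epsilon>" and eq1: "\<And>a b. slice_fst \<epsilon> (unembed (can1 \<Delta> a b)) = a * b"
    and eq2: "\<And>a b. slice_snd \<epsilon> (unembed (can2 \<Delta> a b)) = a * b"
    using assms by (auto simp: is_counit_def)
  note lin = algebra_hom_clinear[OF hom]
  have 1: "slice_fst \<epsilon> (Theta t) = slice_fst \<epsilon> t" for t
    by (rule fun_cong[OF tensor_graded_ext])
      (auto intro!: clinear_compose[OF clinear_slice_fst] clinear_slice_fst lin Theta_clinear
        simp: Theta_tensor slice_fst_tensor lin counit_pi[OF assms])
  have 2: "slice_snd \<epsilon> (Theta t) = slice_snd \<epsilon> t" for t
  proof (rule fun_cong[where x = t, OF tensor_graded_ext])
    fix q v y assume q: "q \<in> carrier G" "y \<in> B q"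
    show "slice_snd \<epsilon> (Theta (v \<otimes>\<^sub>C y)) = slice_snd \<epsilon> (v \<otimes>\<^sub>C y)"
    proof (cases "q = \<one>")
      case True
      with q show ?thesis by (simp add: Theta_tensor[of \<one>])
    next
      case False
      then show ?thesis
        using q by (simp add: Theta_tensor slice_snd_tensor lin counit_degree[OF assms])
    qed
  qed (intro clinear_compose[OF clinear_slice_snd] clinear_slice_snd lin Theta_clinear)+
  have "slice_snd \<epsilon> (unembed (can2 comult' a b)) = a * b" for a b
  proof (rule bilinear_graded_ext[of "\<lambda>a b. slice_snd \<epsilon> (unembed (can2 comult' a b))" "(*)"])
    show "cbilinear (\<lambda>a b. slice_snd \<epsilon> (unembed (can2 comult' a b)))"
      using cbilinear_can2[OF comult'_clinear] unfolding cbilinear_def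
      by (intro conjI allI clinear_compose[OF clinear_slice_snd[OF lin]] clinear_unembed range_comult'; blast)
    show "cbilinear ((*) :: 'b \<Rightarrow> _)" by (intro cbilinearI clin)
    fix p r a b assume h: "p \<in> carrier G" "r \<in> carrier G" "a \<in> B p" "b \<in> B r"
    then have "slice_snd \<epsilon> (unembed (can2 comult' a b)) = \<pi> (r \<otimes> inv p) a * b"
      by (simp add: unembed_can2_comult' 2 eq2)
    \<comment> \<open>The instance q = 1, with b as the factor u: multiplication by b does not
      distinguish the substituted element from a.\<close>
    also have "\<dots> = a * b"
      using pi_homogeneous_mult(1)[of p \<one> r a b] h by simp
    finally show "slice_snd \<epsilon> (unembed (can2 comult' a b)) = a * b" .
  qed
  then show ?thesis
    by (simp add: is_counit_def hom unembed_can1_comult' 1 eq1)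
qed

definition antipode' :: "('b \<Rightarrow> 'b multiplier) \<Rightarrow> 'b \<Rightarrow> 'b multiplier" where
  "antipode' S = glue (\<lambda>p x. mult_map (\<pi> (inv p)) (S x))"

context
  fixes \<epsilon> :: "'b \<Rightarrow> complex" and S :: "'b \<Rightarrow> 'b multiplier"
  assumes counit: "is_counit \<Delta> \<epsilon>" and antipode: "is_antipode \<Delta> \<epsilon> S"
begin

lemma S_clinear: "clinear S" and S_mult: "S (a * b) = S b * S a"
  and S_left: "tensor_lift (*) (tensor_map S embed (unembed (can1 \<Delta> a b))) = embed (\<epsilon> a *\<^sub>C b)"
  and S_right: "tensor_lift (*) (tensor_map embed S (unembed (can2 \<Delta> a b))) = embed (\<epsilon> b *\<^sub>C a)"
  using antipode by (simp_all add: is_antipode_def)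

text \<open>Conjugating S by \<pi>_p gives a solution of the same antipode identity, so uniqueness
  applies.\<close>

lemma antipode_pi:
  assumes p: "p \<in> carrier G"
  shows "S (\<pi> p x) = mult_map (\<pi> p) (S x)"
proof -
  let ?m = "mult_map (\<pi> (inv p))"
  have m: "algebra_hom (\<pi> (inv p))" "bij (\<pi> (inv p))"
    using p by (simp_all add: pi_hom pi_bij)
  note anti = is_antipode_clinear[OF S_clinear]
  have lin: "clinear (\<lambda>x. ?m (S (\<pi> p x)))"
    by (intro clinear_compose[OF clinear_mult_map] clinear_compose[OF S_clinear] pi_clinear p m)
  have *: "tensor_lift (*) (tensor_map (\<lambda>x. ?m (S (\<pi> p x))) embed t) =
      ?m (tensor_lift (*) (tensor_map S embed (pi2 p t)))" for t
  proof (rule fun_cong[where x = t, OF tensor_ext])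
    show "clinear (\<lambda>t. tensor_lift (*) (tensor_map (\<lambda>x. ?m (S (\<pi> p x))) embed t))"
      by (rule is_antipode_clinear[OF lin])
    show "clinear (\<lambda>t. ?m (tensor_lift (*) (tensor_map S embed (pi2 p t))))"
      by (intro clinear_compose[OF clinear_mult_map] clinear_compose[OF anti(1)] tensor_map_clinear pi_clinear m p)
    show "tensor_lift (*) (tensor_map (\<lambda>x. ?m (S (\<pi> p x))) embed (a \<otimes>\<^sub>C b)) =
      ?m (tensor_lift (*) (tensor_map S embed (pi2 p (a \<otimes>\<^sub>C b))))" for a b
      using p by (simp add: pi2_tensor anti(3) is_antipode_clinear(3)[OF lin] mult_map_mult m mult_map_embed)
  qed
  have "(\<lambda>x. ?m (S (\<pi> p x))) = S"
  proof (rule antipode_unique[OF lin S_clinear _ S_left])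
    show "tensor_lift (*) (tensor_map (\<lambda>x. ?m (S (\<pi> p x))) embed (unembed (can1 \<Delta> a b))) = embed (\<epsilon> a *\<^sub>C b)" for a b
      unfolding * using p
      by (simp add: pi2_can1 S_left mult_map_embed m counit_pi[OF counit] clinear_scale[OF pi_clinear])
  qed
  then have "mult_map (\<pi> p) (?m (S (\<pi> p x))) = mult_map (\<pi> p) (S x)" by metis
  moreover have "\<pi> p \<circ> \<pi> (inv p) = id" using p by (simp add: fun_eq_iff)
  ultimately show ?thesis
    using p by (simp add: mult_map_compose pi_hom pi_bij)
qed

text \<open>B_p \<otimes> B_q is spanned by elements on which m(S \<otimes> \<iota>) gives
  \<epsilon>(b) b' with b of degree pq, and \<epsilon> vanishes off degree 1.\<close>

lemma antipode_support:
  assumes "p \<in> carrier G" "q \<in> carrier G" "x \<in> B p" "y \<in> B q" "p \<otimes> q \<noteq> \<one>"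
  shows "S x * embed y = 0"
proof -
  have "tensor_lift (*) (tensor_map S embed (x \<otimes>\<^sub>C y)) = 0"
    by (rule can1_homogeneous_ext[OF is_antipode_clinear(1)[OF S_clinear] clinear_const_zero assms(1-4)])
      (use assms in \<open>simp add: S_left counit_degree[OF counit, of "p \<otimes> q"] clinear_zero[OF clinear_embed[OF clinear_id(1)]]\<close>)
  then show ?thesis by (simp add: is_antipode_clinear(3)[OF S_clinear])
qed

text \<open>If \<pi>_p(z) had degree p^-1, then \<pi>_p^-1 = \<pi>_p \<pi>_t \<pi>_p^-1, hence
  \<pi>_t = \<pi>_p^-1. The support is thus located only up to the kernel of the action.\<close>

lemma antipode'_support:
  assumes "p \<in> carrier G" "t \<in> carrier G" "x \<in> B p" "z \<in> B t" "\<pi> t \<noteq> \<pi> (inv p)"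
  shows "mult_left (mult_map (\<pi> (inv p)) (S x)) z = 0"
proof -
  obtain t' where t': "t' \<in> carrier G" "\<pi> p z \<in> B t'" "\<pi> t' = \<pi> (p \<otimes> t \<otimes> inv p)"
    using pi_homogeneous[of p t] assms by metis
  have "p \<otimes> t' \<noteq> \<one>"
  proof
    assume "p \<otimes> t' = \<one>"
    then have "t' = inv p" using assms(1) t'(1) by (metis inv_equality inv_inv)
    then have "\<pi> (inv p) x = \<pi> p (\<pi> t (\<pi> (inv p) x))" for x
      using t'(3) assms(1,2) by (metis inv_closed m_closed pi_mult)
    then have "x = \<pi> p (\<pi> t x)" for x
      using assms(1) by (metis pi_cancel(1))
    then have "\<pi> (inv p) x = \<pi> t x" for x
      using assms(1) by (metis pi_cancel(1))
    with assms(5) show False by auto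
  qed
  then have "mult_left (S x) (\<pi> p z) = 0"
    using antipode_support[OF assms(1) t'(1) assms(3) t'(2)]
    by (metis mult_embed clinear_embed[OF clinear_id(1)] clinear_zero embed_inject)
  then show ?thesis
    using mult_left_map(1)[of "\<pi> (inv p)" "S x" "\<pi> p z"] assms(1)
    by (simp add: pi_hom pi_bij clinear_zero[OF pi_clinear])
qed

lemma antipode'_clinear: "clinear (antipode' S)"
  and antipode'_homogeneous: "p \<in> carrier G \<Longrightarrow> x \<in> B p \<Longrightarrow> antipode' S x = mult_map (\<pi> (inv p)) (S x)"
proof -
  have *: "clinear (\<lambda>x. mult_map (\<pi> (inv p)) (S x))" if "p \<in> carrier G" for p
    using that by (intro clinear_compose[OF clinear_mult_map] S_clinear pi_hom pi_bij inv_closed)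
  show "clinear (antipode' S)"
    unfolding antipode'_def by (rule clinear_glue[OF *])
  show "p \<in> carrier G \<Longrightarrow> x \<in> B p \<Longrightarrow> antipode' S x = mult_map (\<pi> (inv p)) (S x)"
    unfolding antipode'_def by (rule glue_homogeneous[OF *])
qed

text \<open>For different degrees p and q one has ab = 0, and the product of the images must vanish.
  If \<pi>_p^-1 = \<pi>_q^-1, it is the image of S(b)S(a) = S(ab) under one automorphism; otherwise
  the two supports are disjoint.\<close>

lemma antipode'_mult: "antipode' S (a * b) = antipode' S b * antipode' S a"
proof (rule bilinear_graded_ext[of "\<lambda>a b. antipode' S (a * b)" "\<lambda>a b. antipode' S b * antipode' S a"])
  show "cbilinear (\<lambda>a b. antipode' S (a * b))" "cbilinear (\<lambda>a b. antipode' S b * antipode' S a)"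
    by (intro cbilinearI clinear_compose[OF antipode'_clinear] clin antipode'_clinear)+
  fix p q a b assume h: "p \<in> carrier G" "q \<in> carrier G" "a \<in> B p" "b \<in> B q"
  have same: "mult_map (\<pi> (inv p)) (S (a * b)) = mult_map (\<pi> (inv p)) (S b) * mult_map (\<pi> (inv p)) (S a)"
    using h by (simp add: S_mult mult_map_mult pi_hom pi_bij)
  show "antipode' S (a * b) = antipode' S b * antipode' S a"
  proof (cases "p = q")
    case True
    then have "a * b \<in> B p" using h closed by simp
    with True h same show ?thesis by (simp add: antipode'_homogeneous)
  next
    case False
    then have ab: "a * b = 0" using h orthogonal by blast
    have "mult_map (\<pi> (inv q)) (S b) * mult_map (\<pi> (inv p)) (S a) = 0"
    proof (cases "\<pi> (inv p) = \<pi> (inv q)")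
      case True
      then show ?thesis
        using same h by (simp add: ab clinear_zero[OF S_clinear] clinear_zero[OF clinear_mult_map] pi_hom pi_bij)
    next
      case False
      let ?m = "mult_map (\<pi> (inv q)) (S b)" and ?n = "mult_map (\<pi> (inv p)) (S a)"
      have "mult_left (?m * ?n) z = mult_left 0 z" for z
      proof (rule fun_cong[OF graded_ext[OF mult_left_linear mult_left_linear]])
        fix t z assume t: "t \<in> carrier G" "z \<in> B t"
        show "mult_left (?m * ?n) z = mult_left 0 z"
        proof (cases "\<pi> t = \<pi> (inv p)")
          case True
          \<comment> \<open>Multipliers preserve each summand, since the projection onto it is
            central.\<close>
          have "component G B (mult_left ?n z) t = mult_left ?n z"
            using mult_left_central(1)[of "\<lambda>b. component G B b t" ?n z, OF component_mult_left component_mult_right]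
            by (simp add: component_homogeneous[OF t])
          then have "mult_left ?n z \<in> B t"
            using t(1) by (metis component_mem)
          then show ?thesis
            using antipode'_support[OF h(2) t(1) h(4)] True False by simp
        next
          case False
          then show ?thesis
            using antipode'_support[OF h(1) t(1) h(3) t(2)] by simp
        qed
      qed
      then show ?thesis by (rule multiplier_eqI)
    qed
    then show ?thesis
      using h by (simp add: ab antipode'_homogeneous clinear_zero[OF antipode'_clinear])
  qed
qed

text \<open>With r the total degree, the deformed antipode sends the twisted leg to
  S(\<pi>_r^-1(x)). Multiplied by y this is the same as S(x): either \<pi>_r is trivial, or both
  products vanish by \<open>antipode_support\<close>.\<close>

lemma antipode'_left:
  "tensor_lift (*) (tensor_map (antipode' S) embed (unembed (can1 comult' a b))) = embed (\<epsilon> a *\<^sub>C b)"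
proof (rule bilinear_graded_ext[of "\<lambda>a b. tensor_lift (*) (tensor_map (antipode' S) embed (unembed (can1 comult' a b)))"
      "\<lambda>a b. embed (\<epsilon> a *\<^sub>C b)"])
  note anti = is_antipode_clinear[OF S_clinear] and anti' = is_antipode_clinear[OF antipode'_clinear]
  have lin\<epsilon>: "clinear \<epsilon>" using counit by (simp add: is_counit_def algebra_hom_clinear)
  show "cbilinear (\<lambda>a b. tensor_lift (*) (tensor_map (antipode' S) embed (unembed (can1 comult' a b))))"
    using cbilinear_can1[OF comult'_clinear] unfolding cbilinear_def
    by (intro conjI allI clinear_compose[OF anti'(1)] clinear_unembed range_comult'; blast)
  show "cbilinear (\<lambda>a b. embed (\<epsilon> a *\<^sub>C b))"
    by (intro cbilinearI clin lin\<epsilon>)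
  fix r q a b assume h: "r \<in> carrier G" "q \<in> carrier G" "a \<in> B r" "b \<in> B q"
  let ?p = "r \<otimes> inv q"
  have p: "?p \<in> carrier G" "?p \<otimes> q = r" using h by (simp_all add: m_assoc)
  have "tensor_lift (*) (tensor_map (antipode' S) embed (Theta (unembed (can1 \<Delta> a b)))) =
      tensor_lift (*) (tensor_map S embed (unembed (can1 \<Delta> a b)))"
  proof (rule clinear_eq_on_span[OF _ _ _ can1_homogeneous[OF h]])
    show "clinear (\<lambda>t. tensor_lift (*) (tensor_map (antipode' S) embed (Theta t)))"
      by (rule clinear_compose[OF anti'(1) Theta_clinear])
    show "clinear (\<lambda>t. tensor_lift (*) (tensor_map S embed t))" by (rule anti(1))
    fix t assume "t \<in> homogeneous_tensors ?p q"
    then obtain x y where t: "t = x \<otimes>\<^sub>C y" "x \<in> B ?p" "y \<in> B q" by blast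
    obtain s where s: "s \<in> carrier G" "\<pi> (inv q) x \<in> B s" "\<pi> (inv s) (\<pi> (inv q) x) = \<pi> (inv r) x"
      using pi_inv_degree[OF p(1) h(2) t(2)] unfolding p(2) by blast
    have "antipode' S (\<pi> (inv q) x) = S (\<pi> (inv r) x)"
      using s by (simp add: antipode'_homogeneous antipode_pi[symmetric])
    moreover have "S (\<pi> (inv r) x) * embed y = S x * embed y"
    proof (cases "\<forall>z. \<pi> r z = z")
      case True
      then show ?thesis using h(1) by (metis pi_cancel(1))
    next
      case False
      then have r1: "r \<noteq> \<one>" by auto
      obtain w where w: "w \<in> carrier G" "\<pi> (inv r) x \<in> B w" "\<pi> w = \<pi> (inv r \<otimes> ?p \<otimes> inv (inv r))"
        using pi_homogeneous[of "inv r" ?p] h(1) p(1) t(2) by (metis inv_closed)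
      \<comment> \<open>The degree w of \<pi>_r^-1(x) acts like q^-1 r; if it were q^-1, then
        \<pi>_r would be trivial.\<close>
      have "w \<otimes> q \<noteq> \<one>"
      proof
        assume "w \<otimes> q = \<one>"
        then have wq: "inv q = w" by (rule inv_equality[OF _ h(2) w(1)])
        have "\<pi> w z = \<pi> (inv q) (\<pi> r z)" for z
          unfolding w(3) using h by (simp add: pi_mult)
        then have "\<pi> q (\<pi> (inv q) z) = \<pi> q (\<pi> (inv q) (\<pi> r z))" for z
          unfolding wq by simp
        then have "\<pi> r z = z" for z using h(2) by simp
        with False show False by blast
      qed
      then show ?thesis
        using antipode_support[OF w(1) h(2) w(2) t(3)] antipode_support[OF p(1) h(2) t(2,3)] r1 p(2)
        by simp
    qed
    ultimately show "tensor_lift (*) (tensor_map (antipode' S) embed (Theta t)) = tensor_lift (*) (tensor_map S embed t)"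
      using t h by (simp add: Theta_tensor anti anti')
  qed
  then show "tensor_lift (*) (tensor_map (antipode' S) embed (unembed (can1 comult' a b))) = embed (\<epsilon> a *\<^sub>C b)"
    by (simp add: unembed_can1_comult' S_left)
qed

text \<open>The second legs all have the one degree s^-1 r, so twist and deformed antipode use the
  same automorphism. It can be pulled out of the product, and the antipode identity of \<Delta>
  applies inside.\<close>

lemma antipode'_right:
  "tensor_lift (*) (tensor_map embed (antipode' S) (unembed (can2 comult' a b))) = embed (\<epsilon> b *\<^sub>C a)"
proof (rule bilinear_graded_ext[of "\<lambda>a b. tensor_lift (*) (tensor_map embed (antipode' S) (unembed (can2 comult' a b)))"
      "\<lambda>a b. embed (\<epsilon> b *\<^sub>C a)"])
  note anti = is_antipode_clinear[OF S_clinear] and anti' = is_antipode_clinear[OF antipode'_clinear]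
  have lin\<epsilon>: "clinear \<epsilon>" using counit by (simp add: is_counit_def algebra_hom_clinear)
  show "cbilinear (\<lambda>a b. tensor_lift (*) (tensor_map embed (antipode' S) (unembed (can2 comult' a b))))"
    using cbilinear_can2[OF comult'_clinear] unfolding cbilinear_def
    by (intro conjI allI clinear_compose[OF anti'(2)] clinear_unembed range_comult'; blast)
  show "cbilinear (\<lambda>a b. embed (\<epsilon> b *\<^sub>C a))"
    by (intro cbilinearI clin lin\<epsilon>)
  fix p r a b assume h: "p \<in> carrier G" "r \<in> carrier G" "a \<in> B p" "b \<in> B r"
  let ?a = "\<pi> (r \<otimes> inv p) a"
  obtain s where s: "s \<in> carrier G" "?a \<in> B s" "\<pi> s = \<pi> ((r \<otimes> inv p) \<otimes> p \<otimes> inv (r \<otimes> inv p))"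
    using pi_homogeneous[of "r \<otimes> inv p" p] h by (metis inv_closed m_closed)
  let ?q = "inv s \<otimes> r"
  have q: "?q \<in> carrier G" using s h by simp
  have hom: "algebra_hom (\<pi> (inv ?q))" "bij (\<pi> (inv ?q))" by (simp_all add: q pi_hom pi_bij del: inv_mult_group)
  have "tensor_lift (*) (tensor_map embed (antipode' S) (Theta (unembed (can2 \<Delta> ?a b)))) =
      mult_map (\<pi> (inv ?q)) (tensor_lift (*) (tensor_map embed S (unembed (can2 \<Delta> ?a b))))"
  proof (rule clinear_eq_on_span[OF _ _ _ can2_homogeneous[OF s(1) h(2) s(2) h(4)]])
    show "clinear (\<lambda>t. tensor_lift (*) (tensor_map embed (antipode' S) (Theta t)))"
      by (rule clinear_compose[OF anti'(2) Theta_clinear])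
    show "clinear (\<lambda>t. mult_map (\<pi> (inv ?q)) (tensor_lift (*) (tensor_map embed S t)))"
      by (rule clinear_compose[OF clinear_mult_map[OF hom] anti(2)])
    fix t assume "t \<in> homogeneous_tensors s ?q"
    then obtain x y where t: "t = x \<otimes>\<^sub>C y" "x \<in> B s" "y \<in> B ?q" by blast
    then show "tensor_lift (*) (tensor_map embed (antipode' S) (Theta t)) =
        mult_map (\<pi> (inv ?q)) (tensor_lift (*) (tensor_map embed S t))"
      by (simp add: t(1) Theta_tensor[OF q t(3)] anti anti' antipode'_homogeneous[OF q t(3)]
          mult_map_mult hom mult_map_embed)
  qed
  then have "tensor_lift (*) (tensor_map embed (antipode' S) (unembed (can2 comult' a b))) =
      embed (\<pi> (inv ?q) (\<epsilon> b *\<^sub>C ?a))"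
    using h by (simp add: unembed_can2_comult' S_right mult_map_embed hom)
  \<comment> \<open>For r = 1 the outer automorphism is \<pi>_s = \<pi>_p and undoes the
    substitution \<pi>_p^-1; in every other degree \<epsilon>(b) = 0.\<close>
  also have "\<pi> (inv ?q) (\<epsilon> b *\<^sub>C ?a) = \<epsilon> b *\<^sub>C a"
  proof (cases "r = \<one>")
    case True
    then have "\<pi> (inv ?q) ?a = a"
      using s h by (simp add: inv_mult_group pi_mult)
    then show ?thesis
      by (simp only: clinear_scale[OF algebra_hom_clinear[OF hom(1)]])
  next
    case False
    then have "\<epsilon> b = 0" using counit_degree[OF counit h(2,4)] by blast
    then show ?thesis
      by (simp add: clinear_zero[OF algebra_hom_clinear[OF hom(1)]])
  qed
  finally show "tensor_lift (*) (tensor_map embed (antipode' S) (unembed (can2 comult' a b))) = embed (\<epsilon> b *\<^sub>C a)" .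
qed

theorem is_antipode_comult': "is_antipode comult' \<epsilon> (antipode' S)"
  unfolding is_antipode_def
  using antipode'_clinear antipode'_mult antipode'_left antipode'_right by blast

lemma antipode_comult'_unique: "is_antipode comult' \<epsilon> S' \<Longrightarrow> S' = antipode' S"
  by (rule D.antipode_unique[OF _ antipode'_clinear _ antipode'_left]) (auto simp: is_antipode_def)

end

lemma counit_comult'_unique:
  assumes "is_counit \<Delta> \<epsilon>"
  shows "is_counit comult' \<epsilon>' \<longleftrightarrow> \<epsilon>' = \<epsilon>"
proof
  assume "is_counit comult' \<epsilon>'"
  with is_counit_comult'[OF assms] show "\<epsilon>' = \<epsilon>"
    by (intro D.counit_unique) (auto simp: is_counit_def algebra_hom_clinear)
qed (simp add: is_counit_comult'[OF assms])

end

section \<open>Integrals on the deformation\<close>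

context deformation
begin

interpretation D: regular_hopf comult'
  by unfold_locales (rule regular_comult')

text \<open>Slicing the second leg leaves the automorphism on the first leg untouched, so the result
  is f(b) times that automorphism applied to the substituted element, and the two cancel.\<close>

theorem left_integral_comult':
  assumes "left_integral \<Delta> f"
  shows "left_integral comult' f"
proof -
  have lin_f: "clinear f" and inv: "\<And>a b. slice_snd f (unembed (can2 \<Delta> b a)) = f a *\<^sub>C b"
    using assms by (auto simp: left_integral_def left_invariant_iff)
  have "slice_snd f (unembed (can2 comult' a b)) = f b *\<^sub>C a" for a b
  proof (rule bilinear_graded_ext[of "\<lambda>a b. slice_snd f (unembed (can2 comult' a b))" "\<lambda>a b. f b *\<^sub>C a"])
    show "cbilinear (\<lambda>a b. slice_snd f (unembed (can2 comult' a b)))"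
      using cbilinear_can2[OF comult'_clinear] unfolding cbilinear_def
      by (intro conjI allI clinear_compose[OF clinear_slice_snd[OF lin_f]] clinear_unembed range_comult'; blast)
    show "cbilinear (\<lambda>a b. f b *\<^sub>C a)"
      by (intro cbilinearI clin lin_f)
    fix p r a b assume h: "p \<in> carrier G" "r \<in> carrier G" "a \<in> B p" "b \<in> B r"
    let ?a = "\<pi> (r \<otimes> inv p) a"
    obtain s where s: "s \<in> carrier G" "?a \<in> B s" "\<pi> s = \<pi> ((r \<otimes> inv p) \<otimes> p \<otimes> inv (r \<otimes> inv p))"
      using pi_homogeneous[of "r \<otimes> inv p" p] h by (metis inv_closed m_closed)
    let ?q = "inv s \<otimes> r"
    have q: "?q \<in> carrier G" "inv ?q \<in> carrier G" using s h by simp_all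
    have "slice_snd f (Theta (unembed (can2 \<Delta> ?a b))) =
        \<pi> (inv ?q) (slice_snd f (unembed (can2 \<Delta> ?a b)))"
    proof (rule clinear_eq_on_span[OF _ _ _ can2_homogeneous[OF s(1) h(2) s(2) h(4)]])
      show "clinear (\<lambda>t. slice_snd f (Theta t))"
        by (rule clinear_compose[OF clinear_slice_snd[OF lin_f] Theta_clinear])
      show "clinear (\<lambda>t. \<pi> (inv ?q) (slice_snd f t))"
        by (rule clinear_compose[OF pi_clinear[OF q(2)] clinear_slice_snd[OF lin_f]])
      fix t assume "t \<in> homogeneous_tensors s ?q"
      then obtain x y where t: "t = x \<otimes>\<^sub>C y" "x \<in> B s" "y \<in> B ?q" by blast
      show "slice_snd f (Theta t) = \<pi> (inv ?q) (slice_snd f t)"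
        by (simp only: t(1) Theta_tensor[OF q(1) t(3)] slice_snd_tensor[OF lin_f] clinear_scale[OF pi_clinear[OF q(2)]])
    qed
    also have "\<dots> = f b *\<^sub>C \<pi> (inv ?q) ?a"
      by (simp only: inv clinear_scale[OF pi_clinear[OF q(2)]])
    \<comment> \<open>As s acts like r p r^-1, the element r^-1 s acts like p r^-1, the inverse of r
      p^-1.\<close>
    also have "\<pi> (inv ?q) ?a = a"
      using s h by (simp add: inv_mult_group pi_mult)
    finally show "slice_snd f (unembed (can2 comult' a b)) = f b *\<^sub>C a"
      by (simp only: unembed_can2_comult'[OF h])
  qed
  then show ?thesis
    using assms lin_f by (simp add: left_integral_def D.left_invariant_iff)
qed

text \<open>In the deformation a functional on the first leg is precomposed with an automorphism
  depending on the degree of b. This is the defect that destroys right invariance in the example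
  below.\<close>

lemma slice_fst_comult':
  assumes "q \<in> carrier G" "b \<in> B q" "clinear f"
  shows "slice_fst f (unembed (can1 comult' a b)) = slice_fst (\<lambda>x. f (\<pi> (inv q) x)) (unembed (can1 \<Delta> a b))"
proof -
  have lin_pi: "clinear (\<lambda>x. f (\<pi> (inv q) x))"
    by (intro clinear_compose[OF assms(3)] pi_clinear inv_closed assms(1))
  have "slice_fst f (Theta (unembed (can1 \<Delta> a b))) = slice_fst (\<lambda>x. f (\<pi> (inv q) x)) (unembed (can1 \<Delta> a b))"
  proof -
    \<comment> \<open>With a arbitrary, only the second leg has a known degree.\<close>
    have mem: "unembed (can1 \<Delta> a b) \<in> cvec.span {x \<otimes>\<^sub>C y | x y. y \<in> B q}"
    proof (induction a rule: graded_induct)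
      case zero
      have "unembed (can1 \<Delta> 0 b) = 0"
        by (simp only: galois1_tensor[symmetric] tensor_zero clinear_zero[OF clinear_galois1])
      then show ?case by (simp add: cvec.span_zero)
    next
      case (add x y)
      have "unembed (can1 \<Delta> (x + y) b) = unembed (can1 \<Delta> x b) + unembed (can1 \<Delta> y b)"
        by (simp only: galois1_tensor[symmetric] tensor_add_left clinear_add[OF clinear_galois1])
      with add show ?case by (simp add: cvec.span_add)
    next
      case (homogeneous r a)
      have "homogeneous_tensors (r \<otimes> inv q) q \<subseteq> {x \<otimes>\<^sub>C y | x y. y \<in> B q}" by blast
      then show ?case
        using can1_homogeneous[OF homogeneous(1) assms(1) homogeneous(2) assms(2)] cvec.span_mono by blast
    qed
    show ?thesis
    proof (rule clinear_eq_on_span[OF _ _ _ mem])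
      show "clinear (\<lambda>t. slice_fst f (Theta t))"
        by (rule clinear_compose[OF clinear_slice_fst[OF assms(3)] Theta_clinear])
      show "clinear (slice_fst (\<lambda>x. f (\<pi> (inv q) x)))"
        by (rule clinear_slice_fst[OF lin_pi])
      fix t :: "('b, 'b) tensor" assume "t \<in> {x \<otimes>\<^sub>C y | x y. y \<in> B q}"
      then show "slice_fst f (Theta t) = slice_fst (\<lambda>x. f (\<pi> (inv q) x)) t"
        using assms(1) by (auto simp: Theta_tensor slice_fst_tensor assms(3) lin_pi)
    qed
  qed
  then show ?thesis by (simp only: unembed_can1_comult')
qed

text \<open>On the twisted first leg the modified functional equals f \<circ> \<pi>_r^-1 with r the
  degree of a, independently of how r splits over the two legs. Moving \<pi>_r^-1 across the
  canonical product reduces to right invariance of f.\<close>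

theorem right_integral_comult':
  assumes "right_integral \<Delta> f"
  shows "right_integral comult' (deformed_functional G B \<pi> f)"
proof -
  have lin_f: "clinear f" and inv: "\<And>a b. slice_fst f (unembed (can1 \<Delta> a b)) = f a *\<^sub>C b"
    using assms by (auto simp: right_integral_def right_invariant_iff)
  let ?f = "deformed_functional G B \<pi> f"
  have *: "clinear (\<lambda>x. f (\<pi> (inv p) x))" if "p \<in> carrier G" for p
    by (intro clinear_compose[OF lin_f] pi_clinear inv_closed that)
  have lin': "clinear ?f"
    unfolding deformed_functional_eq_glue by (rule clinear_glue[OF *])
  have hom': "?f x = f (\<pi> (inv p) x)" if "p \<in> carrier G" "x \<in> B p" for p x
    unfolding deformed_functional_eq_glue by (rule glue_homogeneous[OF * that])
  have "slice_fst ?f (unembed (can1 comult' a b)) = ?f a *\<^sub>C b" for a b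
  proof (rule bilinear_graded_ext[of "\<lambda>a b. slice_fst ?f (unembed (can1 comult' a b))" "\<lambda>a b. ?f a *\<^sub>C b"])
    show "cbilinear (\<lambda>a b. slice_fst ?f (unembed (can1 comult' a b)))"
      using cbilinear_can1[OF comult'_clinear] unfolding cbilinear_def
      by (intro conjI allI clinear_compose[OF clinear_slice_fst[OF lin']] clinear_unembed range_comult'; blast)
    show "cbilinear (\<lambda>a b. ?f a *\<^sub>C b)"
      by (intro cbilinearI clin lin')
    fix r q a b assume h: "r \<in> carrier G" "q \<in> carrier G" "a \<in> B r" "b \<in> B q"
    let ?p = "r \<otimes> inv q"
    have p: "?p \<in> carrier G" "?p \<otimes> q = r" using h by (simp_all add: m_assoc)
    have r: "inv r \<in> carrier G" using h by simp
    have "slice_fst ?f (Theta (unembed (can1 \<Delta> a b))) = slice_fst (\<lambda>x. f (\<pi> (inv r) x)) (unembed (can1 \<Delta> a b))"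
    proof (rule clinear_eq_on_span[OF _ _ _ can1_homogeneous[OF h]])
      show "clinear (\<lambda>t. slice_fst ?f (Theta t))"
        by (rule clinear_compose[OF clinear_slice_fst[OF lin'] Theta_clinear])
      show "clinear (slice_fst (\<lambda>x. f (\<pi> (inv r) x)))"
        by (rule clinear_slice_fst[OF *[OF h(1)]])
      fix t assume "t \<in> homogeneous_tensors ?p q"
      then obtain x y where t: "t = x \<otimes>\<^sub>C y" "x \<in> B ?p" "y \<in> B q" by blast
      obtain s where s: "s \<in> carrier G" "\<pi> (inv q) x \<in> B s" "\<pi> (inv s) (\<pi> (inv q) x) = \<pi> (inv r) x"
        using pi_inv_degree[OF p(1) h(2) t(2)] unfolding p(2) by blast
      have "?f (\<pi> (inv q) x) = f (\<pi> (inv r) x)"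
        using hom'[OF s(1,2)] s(3) by simp
      then show "slice_fst ?f (Theta t) = slice_fst (\<lambda>x. f (\<pi> (inv r) x)) t"
        by (simp only: t(1) Theta_tensor[OF h(2) t(3)] slice_fst_tensor[OF lin'] slice_fst_tensor[OF *[OF h(1)]])
    qed
    also have "\<dots> = \<pi> r (f (\<pi> (inv r) a) *\<^sub>C \<pi> (inv r) b)"
      using r h by (simp add: slice_fst_pi[OF r lin_f] pi2_can1 inv)
    also have "\<dots> = ?f a *\<^sub>C b"
      using h by (simp add: clinear_scale[OF pi_clinear] hom')
    finally show "slice_fst ?f (unembed (can1 comult' a b)) = ?f a *\<^sub>C b"
      by (simp only: unembed_can1_comult')
  qed
  \<comment> \<open>For a of degree p, the degree of \<pi>_p(a) acts like p, so
    \<open>?f (\<pi> p a)\<close> is f(a): every value of f on a homogeneous element is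
    attained.\<close>
  moreover have "\<exists>a. ?f a \<noteq> 0"
  proof (rule ccontr)
    assume none: "\<not> (\<exists>a. ?f a \<noteq> 0)"
    have "f = (\<lambda>a. 0)"
    proof (rule graded_ext[OF lin_f clinear_const_zero])
      fix p a assume p: "p \<in> carrier G" "a \<in> B p"
      obtain s where s: "s \<in> carrier G" "\<pi> p a \<in> B s" "\<pi> s = \<pi> (p \<otimes> p \<otimes> inv p)"
        using pi_homogeneous[of p p] p by metis
      have "\<pi> (inv s) = \<pi> (inv (p \<otimes> p \<otimes> inv p))"
        by (rule pi_inv_cong) (use s p in simp_all)
      then have "\<pi> (inv s) (\<pi> p a) = a"
        using p by (simp add: m_assoc)
      then have "?f (\<pi> p a) = f a" using hom'[OF s(1,2)] by simp
      then show "f a = 0" using none by simp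
    qed
    then show False using assms by (simp add: right_integral_def)
  qed
  ultimately show ?thesis
    using lin' by (simp add: right_integral_def D.right_invariant_iff)
qed

section \<open>The involutive case\<close>

context
  fixes st :: "'b \<Rightarrow> 'b"
  assumes star: "cograded_multiplier_hopf_star st G B \<Delta>"
    and pi_star: "p \<in> carrier G \<Longrightarrow> \<pi> p (st b) = st (\<pi> p b)"
begin

lemma st_involution: "involution st"
  and st_homogeneous: "p \<in> carrier G \<Longrightarrow> x \<in> B p \<Longrightarrow> st x \<in> B p"
  and comult_st: "\<Delta> (st a) = mult_star (tensor_star st) (\<Delta> a)"
  using star by (auto simp: cograded_multiplier_hopf_star_def multiplier_hopf_star_def)

lemma st_add: "st (a + b) = st a + st b" and st_mult: "st (a * b) = st b * st a"
  using st_involution by (auto simp: involution_def)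

lemma st_zero: "st 0 = 0"
  using st_add[of 0 0] by simp

lemma component_st: "component G B (st a) p = st (component G B a p)"
  by (induction a rule: graded_induct)
    (simp_all add: st_zero st_add component_add clinear_zero[OF clinear_component]
      component_homogeneous st_homogeneous)

text \<open>The twist commutes with the involution of the tensor square, because the summands are
  invariant under the involution and the action respects it.\<close>

theorem multiplier_hopf_star_comult': "multiplier_hopf_star st comult'"
proof -
  note ts = involution_tensor_star[OF st_involution]
  have ts_simps: "tensor_star st (s + t) = tensor_star st s + tensor_star st t"
    "tensor_star st (tensor_star st t) = t" for s t
    using ts(1) by (auto simp: involution_def)
  have ts_zero: "tensor_star st 0 = 0"
    using ts_simps(1)[of 0 0] by simp
  have Theta_star: "Theta (tensor_star st t) = tensor_star st (Theta t)" for t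
  proof (induction t)
    case zero
    show ?case by (simp add: ts_zero clinear_zero[OF Theta_clinear])
  next
    case (add s t)
    then show ?case by (simp add: ts_simps clinear_add[OF Theta_clinear])
  next
    case (tensor x y)
    show ?case
    proof (induction y rule: graded_induct)
      case zero
      show ?case by (simp add: tensor_zero ts_zero clinear_zero[OF Theta_clinear])
    next
      case (add y z)
      then show ?case by (simp add: tensor_add_right ts_simps clinear_add[OF Theta_clinear])
    next
      case (homogeneous q y)
      then show ?case
        by (simp add: ts(2) Theta_tensor st_homogeneous pi_star)
    qed
  qed
  have "comult' (st a) = mult_star (tensor_star st) (comult' a)" for a
    unfolding comult'_def comult_st
  proof (rule mult_map_eqI[OF Theta_hom Theta_bij])
    fix t
    show "mult_left (mult_star (tensor_star st) (mult_map Theta (\<Delta> a))) (Theta t) =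
        Theta (mult_left (mult_star (tensor_star st) (\<Delta> a)) t)"
      by (simp add: mult_left_star[OF ts(1)] Theta_star mult_left_map Theta_hom Theta_bij flip: Theta_star)
  qed
  then show ?thesis
    using regular_comult' st_involution by (simp add: multiplier_hopf_star_def regular_multiplier_hopf_def)
qed

text \<open>By orthogonality the component of \<open>st a * a\<close> in degree p is the
  corresponding product for the component of a alone. The value is therefore a sum of values of f at
  such products.\<close>

lemma positive_deformed_functional:
  assumes pos: "positive_functional st f"
  shows "positive_functional st (deformed_functional G B \<pi> f)"
  unfolding positive_functional_def
proof
  fix a
  have "f (\<pi> (inv p) (component G B (st a * a) p)) =
      f (st (\<pi> (inv p) (component G B a p)) * \<pi> (inv p) (component G B a p))"
    if p: "p \<in> carrier G" for p
  proof -
    have "component G B (st a * a) p = component G B (component G B (st a * a) p) p"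
      using p by (simp add: component_homogeneous[of p])
    also have "\<dots> = component G B (st a * component G B a p) p"
      by (simp only: component_mult_right)
    also have "\<dots> = st (component G B a p) * component G B a p"
      by (simp only: component_mult_left component_st)
    finally show ?thesis
      using p by (simp add: algebra_hom_mult[OF pi_hom] pi_star)
  qed
  then have "Im (f (\<pi> (inv p) (component G B (st a * a) p))) = 0 \<and>
      Re (f (\<pi> (inv p) (component G B (st a * a) p))) \<ge> 0"
    if "component G B (st a * a) p \<noteq> 0" for p
    using pos component_mem_carrier[OF that] by (simp add: positive_functional_def)
  then show "Im (deformed_functional G B \<pi> f (st a * a)) = 0 \<and>
      0 \<le> Re (deformed_functional G B \<pi> f (st a * a))"
    unfolding deformed_functional_def by (auto simp: Im_sum Re_sum intro!: sum.neutral sum_nonneg)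
qed

end

end

lemma deformationI:
  assumes "group G" "regular_multiplier_hopf \<Delta>" "cograded_multiplier_hopf G B \<Delta>" "admissible_action G B \<Delta> \<pi>"
  shows "deformation G B \<Delta> \<pi>"
  by (intro deformation.intro graded_algebra_cograded[OF assms(1,3)] regular_hopf.intro
      deformation_axioms.intro assms)

section \<open>A right integral which is not right invariant for the deformation\<close>

text \<open>If the comultiplication takes values in the tensor square itself, both sides of the
  multiplier axiom are the iterated coproduct of b multiplied by a in the first leg and c in the
  last, so ordinary coassociativity suffices.\<close>

lemma regular_multiplier_hopf_embed:
  fixes d :: "'a::nondegenerate_complex_algebra \<Rightarrow> ('a, 'a) tensor"
  assumes hom: "algebra_hom d"
    and coassoc: "\<And>b. tensor_map d id (d b) = tensor_assoc (tensor_map id d (d b))"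
    and bij: "bij (galois (can1 (\<lambda>b. embed (d b))))" "bij (galois (can2 (\<lambda>b. embed (d b))))"
      "bij (galois (can3 (\<lambda>b. embed (d b))))" "bij (galois (can4 (\<lambda>b. embed (d b))))"
  shows "regular_multiplier_hopf (\<lambda>b. embed (d b))"
proof -
  let ?D = "\<lambda>b. embed (d b)"
  note lin = algebra_hom_clinear[OF hom]
  have linD: "clinear ?D" by (rule clinear_embed[OF lin])
  have homD: "algebra_hom ?D"
    using hom linD by (simp add: algebra_hom_def embed_mult)
  have c1: "can1 ?D a b = embed (mult_right (1 \<otimes>\<^sub>M embed b) (d a))"
    and c2: "can2 ?D a b = embed (mult_left (embed a \<otimes>\<^sub>M 1) (d b))"
    and c3: "can3 ?D a b = embed (mult_right (embed b \<otimes>\<^sub>M 1) (d a))"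
    and c4: "can4 ?D a b = embed (mult_left (1 \<otimes>\<^sub>M embed a) (d b))" for a b
    by (simp_all add: can1_def can2_def can3_def can4_def mult_embed embed_mult_right)
  have fst: "comult_fst ?D t = embed (tensor_map d id t)" for t
    by (rule fun_cong[where x = t, OF tensor_ext])
      (auto intro!: clinear_comult_fst[OF linD] clinear_embed tensor_map_clinear lin clin
        simp: linD embed_tensor tensor_map_tensor[OF lin clinear_id(1)])
  have snd: "comult_snd ?D t = embed (tensor_map id d t)" for t
    by (rule fun_cong[where x = t, OF tensor_ext])
      (auto intro!: clinear_comult_snd[OF linD] clinear_embed tensor_map_clinear lin clin
        simp: linD embed_tensor tensor_map_tensor[OF clinear_id(1) lin])
  have fst_mult: "tensor_map d id (mult_right (1 \<otimes>\<^sub>M embed c) t) = mult_right (1 \<otimes>\<^sub>M embed c) (tensor_map d id t)" for c t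
    by (rule fun_cong[where x = t, OF tensor_ext])
      (auto intro!: clinear_compose[OF tensor_map_clinear] clinear_mult_right tensor_map_clinear lin clin
        simp: tensor_map_tensor[OF lin clinear_id(1)])
  have snd_mult: "tensor_map id d (mult_left (embed c \<otimes>\<^sub>M 1) t) = mult_left (embed c \<otimes>\<^sub>M 1) (tensor_map id d t)" for c t
    by (rule fun_cong[where x = t, OF tensor_ext])
      (auto intro!: clinear_compose[OF tensor_map_clinear] clinear_mult_left tensor_map_clinear lin clin
        simp: tensor_map_tensor[OF clinear_id(1) lin])
  have assoc_mult: "tensor_assoc (mult_left (embed c \<otimes>\<^sub>M 1) t) = mult_left ((embed c \<otimes>\<^sub>M 1) \<otimes>\<^sub>M 1) (tensor_assoc t)"
    for c :: 'a and t :: "('a, ('a, 'a) tensor) tensor"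
  proof -
    have "(\<lambda>t :: ('a, ('a, 'a) tensor) tensor. tensor_assoc (mult_left (embed c \<otimes>\<^sub>M 1) t)) =
        (\<lambda>t. mult_left ((embed c \<otimes>\<^sub>M 1) \<otimes>\<^sub>M 1) (tensor_assoc t))"
      by (rule tensor_ext3')
        (auto intro!: clinear_compose[OF clinear_tensor_assoc] clinear_mult_left clinear_tensor_assoc clin)
    then show ?thesis by metis
  qed
  have "((embed a \<otimes>\<^sub>M 1) \<otimes>\<^sub>M 1) * comult_fst ?D (unembed (can1 ?D b c)) =
        mult_map tensor_assoc (comult_snd ?D (unembed (can2 ?D a b))) * (1 \<otimes>\<^sub>M embed c)" for a b c
    by (simp add: fst snd c1 c2 fst_mult snd_mult mult_map_embed algebra_hom_tensor_assoc bij_tensor_assoc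
        mult_embed embed_mult_right assoc_mult coassoc mult_left_right_commute)
  then have "comultiplication ?D"
    using homD unfolding comultiplication_def comult_fst_def[symmetric] comult_snd_def[symmetric]
    by (simp add: c1 c2)
  then show ?thesis
    using bij by (simp add: regular_multiplier_hopf_iff multiplier_hopf_def c3 c4 flip: galois_def)
qed

section \<open>Sweedler's Hopf algebra in the basis of idempotents and nilpotents\<close>

definition "hE = Sweedler 1 0 0 0"
definition "hF = Sweedler 0 1 0 0"
definition "hX = Sweedler 0 0 1 0"
definition "hY = Sweedler 0 0 0 1"

lemmas basis_defs = hE_def hF_def hX_def hY_def

lemma sweedler_table [simp]:
  "hE * hE = hE" "hE * hF = 0" "hE * hX = 0" "hE * hY = hY"
  "hF * hE = 0" "hF * hF = hF" "hF * hX = hX" "hF * hY = 0"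
  "hX * hE = hX" "hX * hF = 0" "hX * hX = 0" "hX * hY = 0"
  "hY * hE = 0" "hY * hF = hY" "hY * hX = 0" "hY * hY = 0"
  by (simp_all add: basis_defs zero_sweedler_def)

lemma sweedler_basis: "Sweedler a b c d = a *\<^sub>C hE + b *\<^sub>C hF + c *\<^sub>C hX + d *\<^sub>C hY"
  by (simp add: basis_defs)

lemma sweedler_ext:
  assumes "clinear f" "clinear g" "f hE = g hE" "f hF = g hF" "f hX = g hX" "f hY = g hY"
  shows "f = g"
proof
  fix h show "f h = g h"
    by (cases h)
      (simp only: sweedler_basis clinear_add[OF assms(1)] clinear_add[OF assms(2)]
        clinear_scale[OF assms(1)] clinear_scale[OF assms(2)] assms(3-6))
qed

lemma sweedler_tensor_ext:
  assumes lin: "clinear f" "clinear g"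
    and basis: "\<And>h k. h \<in> {hE, hF, hX, hY} \<Longrightarrow> k \<in> {hE, hF, hX, hY} \<Longrightarrow> f (h \<otimes>\<^sub>C k) = g (h \<otimes>\<^sub>C k)"
  shows "f = g"
proof (rule tensor_ext[OF lin])
  fix h k
  have *: "f (h \<otimes>\<^sub>C k) = g (h \<otimes>\<^sub>C k)" if "k \<in> {hE, hF, hX, hY}" for h k
    by (rule fun_cong[where x = h, OF sweedler_ext])
      (auto intro!: clinear_compose[OF lin(1)] clinear_compose[OF lin(2)] clin basis that)
  show "f (h \<otimes>\<^sub>C k) = g (h \<otimes>\<^sub>C k)"
    by (rule fun_cong[where x = k, OF sweedler_ext])
      (auto intro!: clinear_compose[OF lin(1)] clinear_compose[OF lin(2)] clin *)
qed

text \<open>In Sweedler's Hopf algebra \<open>g\<close> is group-like and \<open>\<Delta>(x) = x \<otimes> 1 + g \<otimes> x\<close>; here \<open>hE = (1 + g) / 2\<close>,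
  \<open>hF = (1 - g) / 2\<close>, \<open>hX = x hE\<close> and \<open>hY = x hF\<close>.\<close>

fun delta :: "sweedler \<Rightarrow> (sweedler, sweedler) tensor" where
  "delta (Sweedler a b c d) =
     a *\<^sub>C (hE \<otimes>\<^sub>C hE + hF \<otimes>\<^sub>C hF) + b *\<^sub>C (hE \<otimes>\<^sub>C hF + hF \<otimes>\<^sub>C hE) +
     c *\<^sub>C (hX \<otimes>\<^sub>C hE + hY \<otimes>\<^sub>C hF + hE \<otimes>\<^sub>C hX - hF \<otimes>\<^sub>C hY) +
     d *\<^sub>C (hX \<otimes>\<^sub>C hF + hY \<otimes>\<^sub>C hE + hE \<otimes>\<^sub>C hY - hF \<otimes>\<^sub>C hX)"

text \<open>The antipode, with g mapped to g and x to -gx, rewritten in the chosen basis.\<close>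

fun antip :: "sweedler \<Rightarrow> sweedler" where
  "antip (Sweedler a b c d) = Sweedler a b d (- c)"

fun antip_inv :: "sweedler \<Rightarrow> sweedler" where
  "antip_inv (Sweedler a b c d) = Sweedler a b (- d) c"

fun alpha :: "sweedler \<Rightarrow> sweedler" where
  "alpha (Sweedler a b c d) = Sweedler a b (- c) (- d)"

text \<open>In the basis 1, g, x, gx this is twice the coefficient of x, a right integral that
  changes sign under \<open>alpha\<close>.\<close>

fun psi :: "sweedler \<Rightarrow> complex" where
  "psi (Sweedler a b c d) = c + d"

lemma sweedler_clinearI:
  assumes "\<And>a b c d a' b' c' d'. f (Sweedler (a + a') (b + b') (c + c') (d + d')) = f (Sweedler a b c d) + f (Sweedler a' b' c' d')"
    and "\<And>k a b c d. f (Sweedler (k * a) (k * b) (k * c) (k * d)) = k *\<^sub>C f (Sweedler a b c d)"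
  shows "clinear f"
  unfolding clinear_iff
proof (intro conjI allI)
  fix x y k
  show "f (x + y) = f x + f y" by (cases x; cases y) (simp add: assms)
  show "f (k *\<^sub>C x) = k *\<^sub>C f x" by (cases x) (simp add: assms)
qed

lemma delta_clinear [clin]: "clinear delta"
  by (rule sweedler_clinearI) (simp_all add: scaleC_add_left scaleC_add_right ac_simps)

lemma antip_clinear [clin]: "clinear antip" and antip_inv_clinear [clin]: "clinear antip_inv"
  and alpha_clinear [clin]: "clinear alpha" and psi_clinear [clin]: "clinear psi"
  by (rule sweedler_clinearI; simp add: scaleC_complex_def algebra_simps)+

lemma basis_maps [simp]:
  "delta hE = hE \<otimes>\<^sub>C hE + hF \<otimes>\<^sub>C hF"
  "delta hF = hE \<otimes>\<^sub>C hF + hF \<otimes>\<^sub>C hE"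
  "delta hX = hX \<otimes>\<^sub>C hE + hY \<otimes>\<^sub>C hF + hE \<otimes>\<^sub>C hX - hF \<otimes>\<^sub>C hY"
  "delta hY = hX \<otimes>\<^sub>C hF + hY \<otimes>\<^sub>C hE + hE \<otimes>\<^sub>C hY - hF \<otimes>\<^sub>C hX"
  "antip hE = hE" "antip hF = hF" "antip hX = - hY" "antip hY = hX"
  "antip_inv hE = hE" "antip_inv hF = hF" "antip_inv hX = hY" "antip_inv hY = - hX"
  "alpha hE = hE" "alpha hF = hF" "alpha hX = - hX" "alpha hY = - hY"
  "psi hE = 0" "psi hF = 0" "psi hX = 1" "psi hY = 1"
  by (simp_all add: basis_defs)

definition "gal1 d = tensor_lift (\<lambda>a b. mult_right (1 \<otimes>\<^sub>M embed b) (d a))"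
definition "gal2 d = tensor_lift (\<lambda>a b. mult_left (embed a \<otimes>\<^sub>M 1) (d b))"
definition "gal3 d = tensor_lift (\<lambda>a b. mult_right (embed b \<otimes>\<^sub>M 1) (d a))"
definition "gal4 d = tensor_lift (\<lambda>a b. mult_left (1 \<otimes>\<^sub>M embed a) (d b))"

lemma
  fixes d :: "'a::nondegenerate_complex_algebra \<Rightarrow> ('a, 'a) tensor"
  assumes d: "clinear d"
  shows gal_tensor: "gal1 d (a \<otimes>\<^sub>C b) = mult_right (1 \<otimes>\<^sub>M embed b) (d a)"
      "gal2 d (a \<otimes>\<^sub>C b) = mult_left (embed a \<otimes>\<^sub>M 1) (d b)"
      "gal3 d (a \<otimes>\<^sub>C b) = mult_right (embed b \<otimes>\<^sub>M 1) (d a)"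
      "gal4 d (a \<otimes>\<^sub>C b) = mult_left (1 \<otimes>\<^sub>M embed a) (d b)"
    and gal_clinear: "clinear (gal1 d)" "clinear (gal2 d)" "clinear (gal3 d)" "clinear (gal4 d)"
proof -
  have *: "cbilinear (\<lambda>a b :: 'a. mult_right (1 \<otimes>\<^sub>M embed b) (d a))"
    "cbilinear (\<lambda>a b. mult_left (embed (a :: 'a) \<otimes>\<^sub>M 1) (d b))"
    "cbilinear (\<lambda>a b :: 'a. mult_right (embed b \<otimes>\<^sub>M 1) (d a))"
    "cbilinear (\<lambda>a b. mult_left (1 \<otimes>\<^sub>M embed (a :: 'a)) (d b))"
    by (rule cbilinearI; (rule clinear_mult_left[OF d] clinear_mult_right[OF d] | intro clin))+
  show "gal1 d (a \<otimes>\<^sub>C b) = mult_right (1 \<otimes>\<^sub>M embed b) (d a)"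
      "gal2 d (a \<otimes>\<^sub>C b) = mult_left (embed a \<otimes>\<^sub>M 1) (d b)"
      "gal3 d (a \<otimes>\<^sub>C b) = mult_right (embed b \<otimes>\<^sub>M 1) (d a)"
      "gal4 d (a \<otimes>\<^sub>C b) = mult_left (1 \<otimes>\<^sub>M embed a) (d b)"
    by (simp_all only: gal1_def gal2_def gal3_def gal4_def tensor_lift_apply *)
  show "clinear (gal1 d)" "clinear (gal2 d)" "clinear (gal3 d)" "clinear (gal4 d)"
    unfolding gal1_def gal2_def gal3_def gal4_def by (intro clinear_tensor_lift *)+
qed

lemma galois_embed:
  fixes d :: "'a::nondegenerate_complex_algebra \<Rightarrow> ('a, 'a) tensor"
  shows "galois (can1 (\<lambda>b. embed (d b))) = gal1 d" "galois (can2 (\<lambda>b. embed (d b))) = gal2 d"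
    "galois (can3 (\<lambda>b. embed (d b))) = gal3 d" "galois (can4 (\<lambda>b. embed (d b))) = gal4 d"
  by (simp_all add: galois_def gal1_def gal2_def gal3_def gal4_def can1_def can2_def can3_def can4_def
      mult_embed embed_mult_right)

lemma delta_hom: "delta (h * k) = delta h * delta k"
proof -
  have basis: "delta (h * k) = delta h * delta k"
    if "h \<in> {hE, hF, hX, hY}" "k \<in> {hE, hF, hX, hY}" for h k
    using that
    by (elim insertE emptyE; simp add: distrib_left distrib_right left_diff_distrib right_diff_distrib
        tensor_mult_tensor tensor_zero clinear_zero[OF delta_clinear])
  have lin: "clinear (\<lambda>h. delta (h * k))" "clinear (\<lambda>h. delta h * delta k)"
    "clinear (\<lambda>k. delta (h * k))" "clinear (\<lambda>k. delta h * delta k)" for h k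
    by (intro clinear_compose[OF delta_clinear] clin)+
  have 1: "delta (h * k) = delta h * delta k" if "k \<in> {hE, hF, hX, hY}" for h k
    by (rule fun_cong[where x = h, OF sweedler_ext[OF lin(1,2)]]; rule basis[OF _ that]; simp)
  show ?thesis
    by (rule fun_cong[where x = k, OF sweedler_ext[OF lin(3,4)]]; rule 1; simp)
qed

lemma mult_lin_simps:
  "mult_left m (x + y) = mult_left m x + mult_left m y" "mult_left m (x - y) = mult_left m x - mult_left m y"
  "mult_left m (- x) = - mult_left m x"
  "mult_right m (x + y) = mult_right m x + mult_right m y" "mult_right m (x - y) = mult_right m x - mult_right m y"
  "mult_right m (- x) = - mult_right m x"
  by (simp_all add: clinear_add clinear_diff clinear_neg mult_left_linear mult_right_linear)

lemma tensor_map_lin_simps: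
  assumes "clinear f" "clinear g"
  shows "tensor_map f g (s + t) = tensor_map f g s + tensor_map f g t"
    "tensor_map f g (s - t) = tensor_map f g s - tensor_map f g t"
    "tensor_map f g (- t) = - tensor_map f g t"
  by (simp_all add: clinear_add clinear_diff clinear_neg tensor_map_clinear assms)

lemma gal_lin_simps:
  fixes d :: "'a::nondegenerate_complex_algebra \<Rightarrow> ('a, 'a) tensor"
  assumes "clinear d"
  shows "gal1 d (s + t) = gal1 d s + gal1 d t" "gal1 d (s - t) = gal1 d s - gal1 d t" "gal1 d (- t) = - gal1 d t" "gal1 d 0 = 0"
    "gal2 d (s + t) = gal2 d s + gal2 d t" "gal2 d (s - t) = gal2 d s - gal2 d t" "gal2 d (- t) = - gal2 d t" "gal2 d 0 = 0"
    "gal3 d (s + t) = gal3 d s + gal3 d t" "gal3 d (s - t) = gal3 d s - gal3 d t" "gal3 d (- t) = - gal3 d t" "gal3 d 0 = 0"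
    "gal4 d (s + t) = gal4 d s + gal4 d t" "gal4 d (s - t) = gal4 d s - gal4 d t" "gal4 d (- t) = - gal4 d t" "gal4 d 0 = 0"
  by (simp_all add: clinear_add clinear_diff clinear_neg clinear_zero gal_clinear assms)

lemma flip_lin_simps:
  "tensor_flip (s + t) = tensor_flip s + tensor_flip t"
  "tensor_flip (s - t) = tensor_flip s - tensor_flip t"
  "tensor_flip (- t) = - tensor_flip t" "tensor_flip 0 = 0"
  by (simp_all add: clinear_add clinear_diff clinear_neg clinear_zero clin)

text \<open>The inverses are the classical ones: a \<otimes> b goes to (\<iota> \<otimes>
  S)(\<Delta>(a))(1 \<otimes> b) for the first map, with S on the other leg for the second. The last
  two need the inverse antipode, and flips because the comultiplied element changes its leg.\<close>

lemma bij_gal_delta: "bij (gal1 delta)" "bij (gal2 delta)" "bij (gal3 delta)" "bij (gal4 delta)"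
proof -
  have lin: "clinear (\<lambda>h. tensor_map (\<lambda>x. x) antip (delta h))" "clinear (\<lambda>h. tensor_map antip (\<lambda>x. x) (delta h))"
    "clinear (\<lambda>h. tensor_map antip_inv (\<lambda>x. x) (delta h))" "clinear (\<lambda>h. tensor_map (\<lambda>x. x) antip_inv (delta h))"
    by (intro clinear_compose[OF tensor_map_clinear] clin)+
  note ss = gal_tensor[OF delta_clinear] gal_lin_simps[OF delta_clinear]
    tensor_map_lin_simps tensor_map_tensor clin mult_lin_simps flip_lin_simps tensor_zero tensor_neg
    delta_clinear clinear_neg[OF delta_clinear]
  show "bij (gal1 delta)"
  proof (rule o_bij)
    note gal = gal_tensor(1)[OF lin(1)] gal_lin_simps(1-4)[OF lin(1)]
    show "gal1 (\<lambda>h. tensor_map (\<lambda>x. x) antip (delta h)) \<circ> gal1 delta = id"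
      by (rule sweedler_tensor_ext; (intro clinear_comp gal_clinear lin clin)?; elim insertE emptyE; simp add: ss gal)
    show "gal1 delta \<circ> gal1 (\<lambda>h. tensor_map (\<lambda>x. x) antip (delta h)) = id"
      by (rule sweedler_tensor_ext; (intro clinear_comp gal_clinear lin clin)?; elim insertE emptyE; simp add: ss gal)
  qed
  show "bij (gal2 delta)"
  proof (rule o_bij)
    note gal = gal_tensor(2)[OF lin(2)] gal_lin_simps(5-8)[OF lin(2)]
    show "gal2 (\<lambda>h. tensor_map antip (\<lambda>x. x) (delta h)) \<circ> gal2 delta = id"
      by (rule sweedler_tensor_ext; (intro clinear_comp gal_clinear lin clin)?; elim insertE emptyE; simp add: ss gal)
    show "gal2 delta \<circ> gal2 (\<lambda>h. tensor_map antip (\<lambda>x. x) (delta h)) = id"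
      by (rule sweedler_tensor_ext; (intro clinear_comp gal_clinear lin clin)?; elim insertE emptyE; simp add: ss gal)
  qed
  show "bij (gal3 delta)"
  proof (rule o_bij)
    note gal = gal_tensor(3)[OF lin(3)] gal_lin_simps(9-12)[OF lin(3)]
    show "(tensor_flip \<circ> gal3 (\<lambda>h. tensor_map antip_inv (\<lambda>x. x) (delta h)) \<circ> tensor_flip) \<circ> gal3 delta = id"
      by (rule sweedler_tensor_ext; (intro clinear_comp gal_clinear lin clin)?; elim insertE emptyE; simp add: ss gal)
    show "gal3 delta \<circ> (tensor_flip \<circ> gal3 (\<lambda>h. tensor_map antip_inv (\<lambda>x. x) (delta h)) \<circ> tensor_flip) = id"
      by (rule sweedler_tensor_ext; (intro clinear_comp gal_clinear lin clin)?; elim insertE emptyE; simp add: ss gal)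
  qed
  show "bij (gal4 delta)"
  proof (rule o_bij)
    note gal = gal_tensor(4)[OF lin(4)] gal_lin_simps(13-16)[OF lin(4)]
    show "(tensor_flip \<circ> gal4 (\<lambda>h. tensor_map (\<lambda>x. x) antip_inv (delta h)) \<circ> tensor_flip) \<circ> gal4 delta = id"
      by (rule sweedler_tensor_ext; (intro clinear_comp gal_clinear lin clin)?; elim insertE emptyE; simp add: ss gal)
    show "gal4 delta \<circ> (tensor_flip \<circ> gal4 (\<lambda>h. tensor_map (\<lambda>x. x) antip_inv (delta h)) \<circ> tensor_flip) = id"
      by (rule sweedler_tensor_ext; (intro clinear_comp gal_clinear lin clin)?; elim insertE emptyE; simp add: ss gal)
  qed
qed

lemma delta_coassoc: "tensor_map delta id (delta h) = tensor_assoc (tensor_map id delta (delta h))"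
proof (rule fun_cong[where x = h, OF sweedler_ext])
  note assoc = clinear_add[OF clinear_tensor_assoc] clinear_diff[OF clinear_tensor_assoc]
    clinear_neg[OF clinear_tensor_assoc]
  note ss = tensor_map_lin_simps tensor_map_tensor clin delta_clinear tensor_add_left tensor_add_right tensor_neg
    clinear_diff[OF clinear_tensor(1)[OF clinear_id(1)]] clinear_diff[OF clinear_tensor(2)[OF clinear_id(1)]] assoc
  show "clinear (\<lambda>h. tensor_map delta id (delta h))" "clinear (\<lambda>h. tensor_assoc (tensor_map id delta (delta h)))"
    by (intro clinear_compose[OF tensor_map_clinear] clinear_compose[OF clinear_tensor_assoc] clin)+
  show "tensor_map delta id (delta hE) = tensor_assoc (tensor_map id delta (delta hE))"
    "tensor_map delta id (delta hF) = tensor_assoc (tensor_map id delta (delta hF))"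
    "tensor_map delta id (delta hX) = tensor_assoc (tensor_map id delta (delta hX))"
    "tensor_map delta id (delta hY) = tensor_assoc (tensor_map id delta (delta hY))"
    by (simp_all add: ss algebra_simps)
qed

lemma alpha_delta: "tensor_map alpha alpha (delta h) = delta (alpha h)"
  by (rule fun_cong[where x = h, OF sweedler_ext])
    (auto intro!: clinear_compose[OF tensor_map_clinear] clinear_compose[OF delta_clinear] clin
      simp: tensor_map_lin_simps tensor_map_tensor clin tensor_neg clinear_neg[OF delta_clinear])

lemma alpha_hom: "alpha (h * k) = alpha h * alpha k" and alpha_alpha: "alpha (alpha h) = h"
  by (cases h; cases k; simp)+

lemma psi_delta: "slice_fst psi (delta h) = psi h *\<^sub>C Sweedler 1 1 0 0"
proof (rule fun_cong[where x = h, OF sweedler_ext])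
  note lin = clinear_slice_fst[OF psi_clinear]
  show "clinear (\<lambda>h. slice_fst psi (delta h))" by (rule clinear_compose[OF lin delta_clinear])
  show "clinear (\<lambda>h. psi h *\<^sub>C Sweedler 1 1 0 0)" by (intro clin)
qed (simp_all add: clinear_add[OF clinear_slice_fst[OF psi_clinear]] clinear_diff[OF clinear_slice_fst[OF psi_clinear]]
    slice_fst_tensor[OF psi_clinear], simp_all add: basis_defs zero_sweedler_def)

text \<open>The tensor product of an algebra with the functions on \<open>\<int>/2\<close>; the second copy sits over the
  non-trivial element, and \<open>\<noteq>\<close> on the Boolean indices is addition modulo \<open>2\<close>.\<close>

definition incl :: "bool \<Rightarrow> 'a::nondegenerate_complex_algebra \<Rightarrow> 'a \<times> 'a" where
  "incl i h = (if i then (0, h) else (h, 0))"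

definition prj :: "bool \<Rightarrow> 'a::nondegenerate_complex_algebra \<times> 'a \<Rightarrow> 'a" where
  "prj i x = (if i then snd x else fst x)"

lemma incl_clinear [clin]: "clinear (incl i)" and prj_clinear [clin]: "clinear (prj i)"
  by (auto simp: clinear_iff incl_def prj_def scaleC_prod_def cvec.scale_zero_right)

lemma prj_incl [simp]: "prj i (incl j h) = (if i = j then h else 0)"
  by (simp add: prj_def incl_def)

lemma incl_mult: "incl i h * incl j k = (if i = j then incl i (h * k) else 0)"
  by (auto simp: incl_def times_prod_def zero_prod_def)

lemma mult_incl: "x * incl i h = incl i (prj i x * h)" "incl i h * x = incl i (h * prj i x)"
  by (simp_all add: incl_def prj_def times_prod_def)

lemma prj_mult: "prj i (x * y) = prj i x * prj i y"
  by (simp add: prj_def times_prod_def)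

lemma incl_prj: "incl False (prj False x) + incl True (prj True x) = x"
  by (cases x) (simp add: incl_def prj_def)

definition incl2 :: "bool \<times> bool \<Rightarrow> ('a::nondegenerate_complex_algebra, 'a) tensor \<Rightarrow> ('a \<times> 'a, 'a \<times> 'a) tensor" where
  "incl2 c = tensor_map (incl (fst c)) (incl (snd c))"

definition prj2 :: "bool \<times> bool \<Rightarrow> ('a::nondegenerate_complex_algebra \<times> 'a, 'a \<times> 'a) tensor \<Rightarrow> ('a, 'a) tensor" where
  "prj2 c = tensor_map (prj (fst c)) (prj (snd c))"

lemma incl2_clinear [clin]: "clinear (incl2 c)" and prj2_clinear [clin]: "clinear (prj2 c)"
  unfolding incl2_def prj2_def by (intro clin)+

lemma incl2_tensor [simp]: "incl2 c (x \<otimes>\<^sub>C y) = incl (fst c) x \<otimes>\<^sub>C incl (snd c) y"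
  and prj2_tensor [simp]: "prj2 c (u \<otimes>\<^sub>C v) = prj (fst c) u \<otimes>\<^sub>C prj (snd c) v"
  by (simp_all add: incl2_def prj2_def tensor_map_tensor clin)

lemma prj2_incl2: "prj2 c (incl2 c' t) = (if c = c' then t else 0)"
proof (induction t)
  case zero
  show ?case by (simp add: clinear_zero[OF incl2_clinear] clinear_zero[OF prj2_clinear])
next
  case (add s t)
  then show ?case by (simp add: clinear_add[OF incl2_clinear] clinear_add[OF prj2_clinear])
next
  case (tensor x y)
  show ?case by (auto simp: prod_eq_iff tensor_zero)
qed

lemma sum_bool2:
  "(\<Sum>c\<in>UNIV. f c) = f (False, False) + f (False, True) + f (True, False) + f (True, True)"
  by (simp add: UNIV_Times_UNIV[symmetric] UNIV_bool sum.cartesian_product[symmetric] add.assoc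
      del: UNIV_Times_UNIV)

lemma sum_incl2_prj2: "(\<Sum>c\<in>UNIV. incl2 c (prj2 c t)) = t"
proof (rule fun_cong[where x = t, OF tensor_ext])
  show "clinear (\<lambda>t. \<Sum>c\<in>UNIV. incl2 c (prj2 c t))"
    unfolding sum_bool2 by (intro clinear_plus clinear_compose[OF incl2_clinear] prj2_clinear)
  show "(\<Sum>c\<in>UNIV. incl2 c (prj2 c (u \<otimes>\<^sub>C v))) = u \<otimes>\<^sub>C v" for u v :: "'a \<times> 'a"
  proof -
    have "u \<otimes>\<^sub>C v = (incl False (prj False u) + incl True (prj True u)) \<otimes>\<^sub>C (incl False (prj False v) + incl True (prj True v))"
      by (simp only: incl_prj)
    also have "\<dots> = (\<Sum>c\<in>UNIV. incl2 c (prj2 c (u \<otimes>\<^sub>C v)))"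
      by (simp add: sum_bool2 tensor_add_left tensor_add_right add_ac)
    finally show ?thesis by (rule sym)
  qed
qed (rule clinear_id)

text \<open>The canonical maps of the doubled algebra have this shape: they permute the four
  summands of the tensor square and apply the same map to each.\<close>

definition blocks ::
    "(bool \<times> bool \<Rightarrow> bool \<times> bool) \<Rightarrow>
     (('a::nondegenerate_complex_algebra, 'a) tensor \<Rightarrow> ('a, 'a) tensor) \<Rightarrow>
     ('a \<times> 'a, 'a \<times> 'a) tensor \<Rightarrow> ('a \<times> 'a, 'a \<times> 'a) tensor" where
  "blocks \<sigma> f t = (\<Sum>c\<in>UNIV. incl2 (\<sigma> c) (f (prj2 c t)))"

lemma blocks_clinear:
  assumes "clinear f"
  shows "clinear (blocks \<sigma> f)"
  unfolding blocks_def[abs_def] sum_bool2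
  by (intro clinear_plus clinear_compose[OF incl2_clinear] clinear_compose[OF assms] prj2_clinear)

lemma prj2_blocks:
  assumes "bij \<sigma>"
  shows "prj2 (\<sigma> c) (blocks \<sigma> f t) = f (prj2 c t)"
proof -
  have "prj2 (\<sigma> c) (blocks \<sigma> f t) = (\<Sum>c'\<in>UNIV. if c = c' then f (prj2 c' t) else 0)"
    using assms by (simp add: blocks_def clinear_sum[OF prj2_clinear] prj2_incl2 bij_is_inj inj_eq)
  then show ?thesis by simp
qed

lemma bij_blocks:
  assumes "bij \<sigma>" "bij f"
  shows "bij (blocks \<sigma> f)"
proof (rule o_bij)
  let ?i = "inv_into UNIV \<sigma>" and ?g = "inv_into UNIV f"
  have *: "blocks \<tau> k (blocks \<sigma> f t) = t"
    if \<sigma>: "bij \<sigma>" and \<tau>: "\<And>c. \<tau> (\<sigma> c) = c" and k: "\<And>x. k (f x) = x"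
    for \<tau> \<sigma> :: "bool \<times> bool \<Rightarrow> bool \<times> bool" and k f :: "('a, 'a) tensor \<Rightarrow> ('a, 'a) tensor" and t
  proof -
    have "blocks \<tau> k (blocks \<sigma> f t) = (\<Sum>c\<in>UNIV. incl2 (\<tau> (\<sigma> c)) (k (prj2 (\<sigma> c) (blocks \<sigma> f t))))"
      unfolding blocks_def[of \<tau>] by (rule sum.reindex_bij_betw[OF \<sigma>, symmetric])
    then show ?thesis
      by (simp add: prj2_blocks \<sigma> \<tau> k sum_incl2_prj2)
  qed
  show "blocks ?i ?g \<circ> blocks \<sigma> f = id"
    by (rule ext, simp, rule *) (use assms in \<open>simp_all add: bij_is_inj\<close>)
  show "blocks \<sigma> f \<circ> blocks ?i ?g = id"
    by (rule ext, simp, rule *)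
      (use assms in \<open>simp_all add: bij_is_surj surj_f_inv_f bij_imp_bij_inv\<close>)
qed

text \<open>Block (i, j) of the coproduct is the coproduct of the component of index i + j, dual to
  the group law of \<int>/2.\<close>

definition double :: "('a::nondegenerate_complex_algebra \<Rightarrow> ('a, 'a) tensor) \<Rightarrow> 'a \<times> 'a \<Rightarrow> ('a \<times> 'a, 'a \<times> 'a) tensor" where
  "double d b = (\<Sum>c\<in>UNIV. incl2 c (d (prj (fst c \<noteq> snd c) b)))"

lemma incl2_mult: "incl2 c s * incl2 c' t = (if c = c' then incl2 c (s * t) else 0)"
proof (induction s)
  case zero
  show ?case by (simp add: clinear_zero[OF incl2_clinear])
next
  case (add s s')
  then show ?case by (simp add: clinear_add[OF incl2_clinear] distrib_right)
next
  case (tensor x y)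
  show ?case
  proof (induction t)
    case zero
    show ?case by (simp add: clinear_zero[OF incl2_clinear])
  next
    case (add t t')
    then show ?case by (simp add: clinear_add[OF incl2_clinear] distrib_left)
  next
    case (tensor x' y')
    show ?case by (auto simp: tensor_mult_tensor incl_mult prod_eq_iff tensor_zero)
  qed
qed

context
  fixes d :: "'a::nondegenerate_complex_algebra \<Rightarrow> ('a, 'a) tensor"
  assumes hom: "algebra_hom d"
    and coassoc: "\<And>b. tensor_map d id (d b) = tensor_assoc (tensor_map id d (d b))"
    and bij_gal: "bij (gal1 d)" "bij (gal2 d)" "bij (gal3 d)" "bij (gal4 d)"
begin

lemma d_clinear: "clinear d"
  by (rule algebra_hom_clinear[OF hom])

lemma double_clinear: "clinear (double d)"
  unfolding double_def[abs_def] sum_bool2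
  by (intro clinear_plus clinear_compose[OF incl2_clinear] clinear_compose[OF d_clinear] prj_clinear)

lemma double_hom: "algebra_hom (double d)"
  unfolding algebra_hom_def
proof (intro conjI allI double_clinear)
  fix x y
  show "double d (x * y) = double d x * double d y"
    by (simp add: double_def sum_bool2 distrib_left distrib_right incl2_mult prj_mult algebra_hom_mult[OF hom])
qed

lemma double_incl: "double d (incl i x) = incl2 (False, i) (d x) + incl2 (True, \<not> i) (d x)"
  by (cases i) (simp_all add: double_def sum_bool2 clinear_zero[OF d_clinear] clinear_zero[OF incl2_clinear])

lemma mult_incl2:
  "mult_right (1 \<otimes>\<^sub>M embed b) (incl2 c t) = incl2 c (mult_right (1 \<otimes>\<^sub>M embed (prj (snd c) b)) t)"
  "mult_left (embed b \<otimes>\<^sub>M 1) (incl2 c t) = incl2 c (mult_left (embed (prj (fst c) b) \<otimes>\<^sub>M 1) t)"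
  "mult_right (embed b \<otimes>\<^sub>M 1) (incl2 c t) = incl2 c (mult_right (embed (prj (fst c) b) \<otimes>\<^sub>M 1) t)"
  "mult_left (1 \<otimes>\<^sub>M embed b) (incl2 c t) = incl2 c (mult_left (1 \<otimes>\<^sub>M embed (prj (snd c) b)) t)"
  for t :: "('a, 'a) tensor"
  by (rule fun_cong[where x = t, OF tensor_ext];
      (intro clinear_mult_left clinear_mult_right clinear_compose[OF incl2_clinear] incl2_clinear clinear_id)?;
      simp add: mult_incl)+

text \<open>The index permutations follow from the degrees: a leg multiplied by an element of index
  j has index j, and both legs add up to the index of the comultiplied element.\<close>

lemma gal_double:
  "gal1 (double d) = blocks (\<lambda>(i, j). (i \<noteq> j, j)) (gal1 d)"
  "gal2 (double d) = blocks (\<lambda>(i, j). (i, i \<noteq> j)) (gal2 d)"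
  "gal3 (double d) = blocks (\<lambda>(i, j). (j, i \<noteq> j)) (gal3 d)"
  "gal4 (double d) = blocks (\<lambda>(i, j). (i \<noteq> j, i)) (gal4 d)"
  by (rule tensor_ext; (intro gal_clinear double_clinear blocks_clinear d_clinear)?;
      simp add: gal_tensor[OF double_clinear] double_def blocks_def sum_bool2 mult_lin_simps mult_incl2
        gal_tensor[OF d_clinear] add_ac)+

lemma bij_index:
  "bij (\<lambda>(i, j). (i \<noteq> j, j :: bool))" "bij (\<lambda>(i, j). (i :: bool, i \<noteq> j))"
  "bij (\<lambda>(i, j). (j :: bool, i \<noteq> j))" "bij (\<lambda>(i, j). (i \<noteq> j, i :: bool))"
proof -
  show "bij (\<lambda>(i, j). (i \<noteq> j, j :: bool))" "bij (\<lambda>(i, j). (i :: bool, i \<noteq> j))"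
    by (rule o_bij[where g = "\<lambda>(i, j). (i \<noteq> j, j :: bool)"], auto simp: fun_eq_iff)
      (rule o_bij[where g = "\<lambda>(i, j). (i :: bool, i \<noteq> j)"], auto simp: fun_eq_iff)
  show "bij (\<lambda>(i, j). (j :: bool, i \<noteq> j))"
    by (rule o_bij[where g = "\<lambda>(i, j). (i \<noteq> j, i :: bool)"]) (auto simp: fun_eq_iff)
  show "bij (\<lambda>(i, j). (i \<noteq> j, i :: bool))"
    by (rule o_bij[where g = "\<lambda>(i, j). (j :: bool, i \<noteq> j)"]) (auto simp: fun_eq_iff)
qed

lemma bij_gal_double:
  "bij (gal1 (double d))" "bij (gal2 (double d))" "bij (gal3 (double d))" "bij (gal4 (double d))"
  unfolding gal_double by (intro bij_blocks bij_index bij_gal)+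

text \<open>On either side the block (i, j, k) contains the iterated coproduct of the component of
  index i + j + k.\<close>

lemma double_coassoc:
  "tensor_map (double d) id (double d b) = tensor_assoc (tensor_map id (double d) (double d b))"
proof -
  define J where "J i j k = tensor_map (incl2 (i, j) :: ('a, 'a) tensor \<Rightarrow> _) (incl k :: 'a \<Rightarrow> _)" for i j k
  have J: "clinear (J i j k)" "J i j k (s \<otimes>\<^sub>C x) = incl2 (i, j) s \<otimes>\<^sub>C incl k x" for i j k s x
    unfolding J_def by (simp_all add: clin tensor_map_tensor)
  have l: "tensor_map (double d) id (incl2 (i, j) s) =
      J False i j (tensor_map d id s) + J True (\<not> i) j (tensor_map d id s)" for i j s
  proof (rule fun_cong[where x = s, OF tensor_ext])
    show "clinear (\<lambda>s. tensor_map (double d) id (incl2 (i, j) s))"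
      by (intro clinear_compose[OF tensor_map_clinear] double_clinear clin)
    show "clinear (\<lambda>s. J False i j (tensor_map d id s) + J True (\<not> i) j (tensor_map d id s))"
      by (intro clinear_plus clinear_compose[OF J(1)] tensor_map_clinear d_clinear clin)
  qed (simp add: tensor_map_tensor[OF double_clinear clinear_id(1)] tensor_map_tensor[OF d_clinear clinear_id(1)]
      double_incl tensor_add_left J)
  have a: "tensor_assoc (incl i x \<otimes>\<^sub>C incl2 (j, k) s) = J i j k (tensor_assoc (x \<otimes>\<^sub>C s))" for i j k x s
    by (rule fun_cong[where x = s, OF tensor_ext])
      (auto intro!: clinear_compose[OF clinear_tensor_assoc] clinear_compose[OF J(1)] clin simp: J)
  have r: "tensor_assoc (tensor_map id (double d) (incl2 (i, j) s)) =
      J i False j (tensor_assoc (tensor_map id d s)) + J i True (\<not> j) (tensor_assoc (tensor_map id d s))" for i j s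
  proof (rule fun_cong[where x = s, OF tensor_ext])
    show "clinear (\<lambda>s. tensor_assoc (tensor_map id (double d) (incl2 (i, j) s)))"
      by (intro clinear_compose[OF clinear_tensor_assoc] clinear_compose[OF tensor_map_clinear] double_clinear clin)
    show "clinear (\<lambda>s. J i False j (tensor_assoc (tensor_map id d s)) + J i True (\<not> j) (tensor_assoc (tensor_map id d s)))"
      by (intro clinear_plus clinear_compose[OF J(1)] clinear_compose[OF clinear_tensor_assoc] tensor_map_clinear d_clinear clin)
  qed (simp add: tensor_map_tensor[OF clinear_id(1) double_clinear] tensor_map_tensor[OF clinear_id(1) d_clinear]
      double_incl tensor_add_right clinear_add[OF clinear_tensor_assoc] a)
  note add = clinear_add[OF tensor_map_clinear[OF double_clinear clinear_id(2)]]
    clinear_add[OF tensor_map_clinear[OF clinear_id(2) double_clinear]] clinear_add[OF clinear_tensor_assoc]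
  show ?thesis
    unfolding double_def[of d b] sum_bool2 fst_conv snd_conv
    unfolding add l r coassoc by (simp add: add_ac)
qed

lemma regular_double: "regular_multiplier_hopf (\<lambda>b. embed (double d b))"
  by (rule regular_multiplier_hopf_embed[OF double_hom double_coassoc]) (simp_all only: galois_embed bij_gal_double)

end

lemma Collect_range2: "{F x y | x y. x \<in> range f \<and> y \<in> range g} = {F (f h) (g k) | h k. True}"
  by blast

section \<open>Cograding and admissible action on the doubled algebra\<close>

definition Z2 :: "int monoid" where
  "Z2 = \<lparr>carrier = {0, 1}, monoid.mult = (\<lambda>x y. (x + y) mod 2), one = 0\<rparr>"

lemma Z2_simps [simp]: "carrier Z2 = {0, 1}" "x \<otimes>\<^bsub>Z2\<^esub> y = (x + y) mod 2" "\<one>\<^bsub>Z2\<^esub> = 0"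
  by (simp_all add: Z2_def)

lemma group_Z2: "group Z2"
  by (rule groupI) auto

lemma inv_Z2: "x \<in> {0, 1} \<Longrightarrow> inv\<^bsub>Z2\<^esub> x = x"
  by (rule group.inv_equality[OF group_Z2]) auto

definition grade2 :: "int \<Rightarrow> ('a::nondegenerate_complex_algebra \<times> 'a) set" where
  "grade2 p = range (incl (p = 1))"

lemma decomposition_grade2:
  fixes b :: "'a::nondegenerate_complex_algebra \<times> 'a"
  shows "\<exists>!f. decomposition Z2 grade2 b f"
proof
  let ?f = "\<lambda>p :: int. if p = 0 then incl False (prj False b) else if p = 1 then incl True (prj True b) else 0"
  have sum: "(\<Sum>p | f p \<noteq> 0. f p) = f 0 + f 1" if "\<And>p. p \<notin> {0, 1} \<Longrightarrow> f p = 0"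
    for f :: "int \<Rightarrow> 'a \<times> 'a"
  proof -
    have "(\<Sum>p | f p \<noteq> 0. f p) = (\<Sum>p\<in>{0, 1}. f p)"
      by (rule sum.mono_neutral_left) (use that in auto)
    then show ?thesis by simp
  qed
  have "finite {p. ?f p \<noteq> 0}"
    by (rule finite_subset[of _ "{0, 1}"]) auto
  then show "decomposition Z2 grade2 b ?f"
    unfolding decomposition_def by (subst sum) (auto simp: grade2_def incl_prj)
  fix f assume f: "decomposition Z2 grade2 b f"
  then have out: "f p = 0" if "p \<notin> {0, 1}" for p
    using that by (auto simp: decomposition_def)
  from f obtain x y where xy: "f 0 = incl False x" "f 1 = incl True y"
    by (auto simp: decomposition_def grade2_def)
  have "b = incl False x + incl True y"
    using f sum[of f, OF out] by (simp add: decomposition_def xy)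
  then have "prj False b = x" "prj True b = y"
    by (simp_all add: clinear_add[OF prj_clinear])
  with xy out show "f = ?f" by (auto simp: fun_eq_iff)
qed

context
  fixes d :: "'a::nondegenerate_complex_algebra \<Rightarrow> ('a, 'a) tensor"
  assumes hom: "algebra_hom d"
    and coassoc: "\<And>b. tensor_map d id (d b) = tensor_assoc (tensor_map id d (d b))"
    and bij_gal: "bij (gal1 d)" "bij (gal2 d)" "bij (gal3 d)" "bij (gal4 d)"
begin

lemmas double_facts = hom coassoc bij_gal

lemma gal_double_incl:
  "gal1 (double d) (incl i h \<otimes>\<^sub>C incl j k) = incl2 (i \<noteq> j, j) (gal1 d (h \<otimes>\<^sub>C k))"
  "gal2 (double d) (incl i h \<otimes>\<^sub>C incl j k) = incl2 (i, i \<noteq> j) (gal2 d (h \<otimes>\<^sub>C k))"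
  by (cases i; cases j; simp add: gal_double[OF double_facts] blocks_def sum_bool2 tensor_zero
      gal_lin_simps[OF algebra_hom_clinear[OF hom]] clinear_zero[OF incl2_clinear])+

lemma can_double:
  "embed (double d b) * (1 \<otimes>\<^sub>M embed b') = embed (gal1 (double d) (b \<otimes>\<^sub>C b'))"
  "(embed b' \<otimes>\<^sub>M 1) * embed (double d b) = embed (gal2 (double d) (b' \<otimes>\<^sub>C b))"
  by (simp_all add: gal_tensor[OF double_clinear[OF double_facts]] mult_embed embed_mult_right)

text \<open>A canonical map sends one block onto another, acting there as the canonical map of d.
  The span conditions thus reduce to surjectivity of the latter.\<close>

lemma cograded_double: "cograded_multiplier_hopf Z2 grade2 (\<lambda>b. embed (double d b))"
  unfolding cograded_multiplier_hopf_def
proof (intro conjI ballI allI impI decomposition_grade2)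
  show "multiplier_hopf (\<lambda>b. embed (double d b))"
    using regular_double[OF double_facts] by (simp add: regular_multiplier_hopf_def)
next
  fix p q :: int assume "p \<in> carrier Z2" "q \<in> carrier Z2"
  define i j where "i = (p = 1)" and "j = (q = 1)"
  have sets: "grade2 p = range (incl i)" "grade2 q = range (incl j)" "grade2 (p \<otimes>\<^bsub>Z2\<^esub> q) = range (incl (i \<noteq> j))"
    using \<open>p \<in> carrier Z2\<close> \<open>q \<in> carrier Z2\<close> by (auto simp: grade2_def i_def j_def)
  have "cvec.span {x \<otimes>\<^sub>C y | x y. x \<in> grade2 p \<and> y \<in> grade2 q} = range (incl2 (i, j) :: ('a, 'a) tensor \<Rightarrow> _)"
  proof -
    have "{x \<otimes>\<^sub>C y | x y. x \<in> grade2 p \<and> y \<in> grade2 q} = {incl2 (i, j) (h \<otimes>\<^sub>C k :: ('a, 'a) tensor) | h k. True}"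
      unfolding sets Collect_range2 by simp
    then show ?thesis
      by (simp only: span_tensor_image[OF incl2_clinear])
  qed
  note rhs = this
  have img: "cvec.span {embed (incl2 (i, j) (g (h \<otimes>\<^sub>C k))) | h k. True} = embed ` range (incl2 (i, j) :: ('a, 'a) tensor \<Rightarrow> _)"
    if g: "bij g" "clinear g" for g :: "('a, 'a) tensor \<Rightarrow> ('a, 'a) tensor"
  proof -
    have "clinear (\<lambda>t. embed (incl2 (i, j) (g t)))"
      by (intro clinear_embed clinear_compose[OF incl2_clinear] g)
    from span_tensor_image[OF this]
    have "cvec.span {embed (incl2 (i, j) (g (h \<otimes>\<^sub>C k))) | h k. True} = embed ` incl2 (i, j) ` range g"
      by (simp only: image_image)
    then show ?thesis by (simp only: bij_is_surj[OF g(1)])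
  qed
  \<comment> \<open>Addition modulo 2: i + (i + j) = j and (i + j) + j = i.\<close>
  have ij: "(i \<noteq> (i \<noteq> j)) = j" "((i \<noteq> j) \<noteq> j) = i" by auto
  have "{embed (double d b) * (1 \<otimes>\<^sub>M embed b') | b b'. b \<in> grade2 (p \<otimes>\<^bsub>Z2\<^esub> q) \<and> b' \<in> grade2 q} =
      {embed (incl2 (i, j) (gal1 d (h \<otimes>\<^sub>C k))) | h k. True}"
    unfolding sets can_double Collect_range2 gal_double_incl ij ..
  then show "cvec.span {embed (double d b) * (1 \<otimes>\<^sub>M embed b') | b b'. b \<in> grade2 (p \<otimes>\<^bsub>Z2\<^esub> q) \<and> b' \<in> grade2 q} =
      embed ` cvec.span {x \<otimes>\<^sub>C y | x y. x \<in> grade2 p \<and> y \<in> grade2 q}"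
    using img[OF bij_gal(1) gal_clinear(1)[OF algebra_hom_clinear[OF hom]]] by (simp only: rhs)
  have "{(embed b' \<otimes>\<^sub>M 1) * embed (double d b) | b b'. b \<in> grade2 (p \<otimes>\<^bsub>Z2\<^esub> q) \<and> b' \<in> grade2 p} =
      {embed (incl2 (i, j) (gal2 d (h \<otimes>\<^sub>C k))) | h k. True}"
    unfolding sets can_double Collect_range2[of "\<lambda>b b'. embed (gal2 (double d) (b' \<otimes>\<^sub>C b))"] gal_double_incl ij by blast
  then show "cvec.span {(embed b' \<otimes>\<^sub>M 1) * embed (double d b) | b b'. b \<in> grade2 (p \<otimes>\<^bsub>Z2\<^esub> q) \<and> b' \<in> grade2 p} =
      embed ` cvec.span {x \<otimes>\<^sub>C y | x y. x \<in> grade2 p \<and> y \<in> grade2 q}"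
    using img[OF bij_gal(2) gal_clinear(2)[OF algebra_hom_clinear[OF hom]]] by (simp only: rhs)
next
  fix p assume "p \<in> carrier Z2"
  show "cvec.subspace (grade2 p :: ('a \<times> 'a) set)"
    unfolding grade2_def by (intro subspace_range clin)
  fix x y :: "'a \<times> 'a" assume "x \<in> grade2 p" "y \<in> grade2 p"
  then show "x * y \<in> grade2 p"
    by (auto simp: grade2_def incl_mult)
next
  fix p q and x y :: "'a \<times> 'a"
  assume "p \<in> carrier Z2" "q \<in> carrier Z2" "p \<noteq> q" "x \<in> grade2 p" "y \<in> grade2 q"
  then show "x * y = 0"
    by (auto simp: grade2_def incl_mult)
qed

end

definition double_map :: "('a \<Rightarrow> 'a) \<Rightarrow> int \<Rightarrow> 'a \<times> 'a \<Rightarrow> 'a \<times> 'a" where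
  "double_map f p b = (if p = 1 then (f (fst b), f (snd b)) else b)"

lemma prj_double_map: "prj i (double_map f 1 b) = f (prj i b)"
  by (simp add: prj_def double_map_def)

text \<open>An involution commuting with d acts on both copies simultaneously and preserves each of
  them. As the group is abelian, the trivial action \<rho> is compatible with conjugation.\<close>

lemma admissible_double:
  assumes hom: "algebra_hom d" "algebra_hom f" and invol: "\<And>x. f (f x) = x"
    and comm: "\<And>x. tensor_map f f (d x) = d (f x)"
  shows "admissible_action Z2 grade2 (\<lambda>b. embed (double d b)) (double_map f)"
proof -
  note lin = algebra_hom_clinear[OF hom(1)] algebra_hom_clinear[OF hom(2)]
  let ?\<pi> = "double_map f"
  have one: "?\<pi> 0 = id" by (simp add: double_map_def fun_eq_iff)
  have inv1: "?\<pi> 1 (?\<pi> 1 x) = x" for x by (simp add: double_map_def invol)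
  have hom1: "algebra_hom (?\<pi> 1)"
    using hom(2) by (simp add: algebra_hom_def clinear_iff double_map_def times_prod_def scaleC_prod_def)
  have bij1: "bij (?\<pi> 1)"
    by (rule o_bij[where g = "?\<pi> 1"]) (simp_all add: fun_eq_iff inv1)
  have incl1: "?\<pi> 1 (incl i h) = incl i (f h)" for i h
    by (simp add: double_map_def incl_def clinear_zero[OF lin(2)])
  have map1: "tensor_map (?\<pi> 1) (?\<pi> 1) (incl2 c t) = incl2 c (tensor_map f f t)" for c t
    by (rule fun_cong[where x = t, OF tensor_ext])
      (auto intro!: clinear_compose[OF tensor_map_clinear] clinear_compose[OF incl2_clinear]
        tensor_map_clinear incl2_clinear algebra_hom_clinear[OF hom1] lin
        simp: tensor_map_tensor algebra_hom_clinear[OF hom1] lin incl1)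
  have map_double: "double d (?\<pi> 1 b) = tensor_map (?\<pi> 1) (?\<pi> 1) (double d b)" for b
    by (simp add: double_def sum_bool2 clinear_add[OF tensor_map_clinear] algebra_hom_clinear[OF hom1]
        map1 comm prj_double_map)
  have comult: "embed (double d (?\<pi> p b)) = mult_map (tensor_map (?\<pi> p) (?\<pi> p)) (embed (double d b))"
    if "p \<in> {0, 1}" for p b
  proof -
    from that consider "p = 0" | "p = 1" by blast
    then show ?thesis
    proof cases
      case 2
      show ?thesis
        by (simp only: 2 map_double mult_map_embed algebra_hom_tensor_map bij_tensor_map hom1 bij1
            algebra_hom_clinear)
    qed (simp add: one tensor_map_id)
  qed
  have action: "hopf_action Z2 (\<lambda>b. embed (double d b)) ?\<pi>"
    unfolding hopf_action_def using hom1 bij1 comult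
    by (auto simp: one algebra_hom_id fun_eq_iff inv1)
  have grading: "?\<pi> p ` grade2 q = grade2 q \<and> ?\<pi> q = ?\<pi> (p \<otimes>\<^bsub>Z2\<^esub> q \<otimes>\<^bsub>Z2\<^esub> inv\<^bsub>Z2\<^esub> p)"
    if "p \<in> carrier Z2" "q \<in> carrier Z2" for p q
  proof
    have "incl i h \<in> range (\<lambda>x. incl i (f x))" for i h
      by (rule range_eqI[of _ _ "f h"]) (simp add: invol)
    then show "?\<pi> p ` grade2 q = grade2 q"
      using that by (auto simp: one grade2_def incl1 image_image)
    show "?\<pi> q = ?\<pi> (p \<otimes>\<^bsub>Z2\<^esub> q \<otimes>\<^bsub>Z2\<^esub> inv\<^bsub>Z2\<^esub> p)"
      using that by (auto simp: inv_Z2)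
  qed
  \<comment> \<open>Elements of \<open>AutoGroup\<close> are extensional functions on the carrier,
    so the identity has to be restricted to it.\<close>
  define \<rho> where "\<rho> = (\<lambda>p :: int. restrict (\<lambda>x. x) (carrier Z2))"
  have \<rho>: "\<rho> \<in> hom Z2 (AutoGroup Z2)"
    by (auto simp: \<rho>_def hom_def AutoGroup_def auto_def BijGroup_def Bij_def compose_def bij_betw_def inj_on_def extensional_def)
  show ?thesis
    unfolding admissible_action_def
  proof (intro conjI action bexI[of _ \<rho>] \<rho> ballI)
    fix p q assume pq: "p \<in> carrier Z2" "q \<in> carrier Z2"
    then have "\<rho> p q = q" by (simp add: \<rho>_def)
    then show "?\<pi> p ` grade2 q = grade2 (\<rho> p q)" "?\<pi> (\<rho> p q) = ?\<pi> (p \<otimes>\<^bsub>Z2\<^esub> q \<otimes>\<^bsub>Z2\<^esub> inv\<^bsub>Z2\<^esub> p)"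
      using grading[OF pq] by simp_all
  qed
qed

text \<open>The non-trivial group element acts by a sign change on \<psi>, so for b in the second
  copy the deformed slice is -\<psi>(a) b in place of \<psi>(a) b.\<close>

theorem right_integral_not_invariant:
  "\<exists>(G :: int monoid) (B :: int \<Rightarrow> (sweedler \<times> sweedler) set) \<Delta> \<pi> \<psi>.
     group G \<and> regular_multiplier_hopf \<Delta> \<and> cograded_multiplier_hopf G B \<Delta> \<and>
     admissible_action G B \<Delta> \<pi> \<and> right_integral \<Delta> \<psi> \<and>
     \<not> right_invariant (deformed_comult G B \<pi> \<Delta>) \<psi>"
proof -
  have hom: "algebra_hom delta" and alpha: "algebra_hom alpha"
    by (simp_all add: algebra_hom_def delta_clinear delta_hom alpha_clinear alpha_hom)
  note facts = hom delta_coassoc bij_gal_delta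
  let ?\<Delta> = "\<lambda>b. embed (double delta b)" and ?\<pi> = "double_map alpha"
  define \<psi> :: "sweedler \<times> sweedler \<Rightarrow> complex" where "\<psi> b = psi (fst b) + psi (snd b)" for b
  have regular: "regular_multiplier_hopf ?\<Delta>"
    by (rule regular_double[OF facts])
  have cograded: "cograded_multiplier_hopf Z2 grade2 ?\<Delta>"
    by (rule cograded_double[OF facts])
  have admissible: "admissible_action Z2 grade2 ?\<Delta> ?\<pi>"
    by (rule admissible_double[OF hom alpha alpha_alpha alpha_delta])
  interpret deformation Z2 grade2 ?\<Delta> ?\<pi>
    by (rule deformationI[OF group_Z2 regular cograded admissible])
  have lin_psi: "clinear \<psi>"
    using psi_clinear by (simp add: clinear_iff \<psi>_def scaleC_prod_def scaleC_complex_def algebra_simps)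
  have psi_incl: "\<psi> (incl i h) = psi h" for i h
    by (simp add: \<psi>_def incl_def clinear_zero[OF psi_clinear])
  have can1: "unembed (can1 ?\<Delta> a b) = gal1 (double delta) (a \<otimes>\<^sub>C b)" for a b
    by (simp add: can1_def can_double[OF facts])
  have slice: "slice_fst \<psi> (unembed (can1 ?\<Delta> a b)) = \<psi> a *\<^sub>C b" for a b
  proof -
    have *: "slice_fst \<psi> (incl2 c t) = incl (snd c) (slice_fst psi t)" for c t
      by (rule fun_cong[where x = t, OF tensor_ext];
          (intro clinear_compose[OF clinear_slice_fst[OF lin_psi]] incl2_clinear clinear_compose[OF incl_clinear]
            clinear_slice_fst psi_clinear)?;
          simp add: slice_fst_tensor[OF psi_clinear] slice_fst_tensor[OF lin_psi] psi_incl clinear_scale[OF incl_clinear])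
    have gal: "slice_fst psi (gal1 delta (h \<otimes>\<^sub>C k)) = psi h *\<^sub>C k" for h k
    proof -
      have "slice_fst psi (mult_right (1 \<otimes>\<^sub>M embed k) t) = slice_fst psi t * k" for t :: "(sweedler, sweedler) tensor"
        by (rule fun_cong[where x = t, OF tensor_ext])
          (auto intro!: clin clinear_compose[OF clinear_slice_fst] clinear_slice_fst simp: psi_clinear slice_fst_tensor)
      then show ?thesis
        by (cases k) (simp add: gal_tensor[OF delta_clinear] psi_delta)
    qed
    show ?thesis
      unfolding can1 gal_double[OF facts] blocks_def sum_bool2
      by (simp add: clinear_add[OF clinear_slice_fst[OF lin_psi]] * gal, cases b)
        (simp add: \<psi>_def prj_def incl_def scaleC_prod_def scaleC_add_left)
  qed
  have "\<psi> (hX, 0) = 1"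
    by (simp add: \<psi>_def clinear_zero[OF psi_clinear])
  then have "right_integral ?\<Delta> \<psi>"
    unfolding right_integral_def right_invariant_iff using lin_psi slice by (metis zero_neq_one)
  moreover have "\<not> right_invariant comult' \<psi>"
  proof
    assume inv: "right_invariant comult' \<psi>"
    interpret D: regular_hopf comult'
      by unfold_locales (rule regular_comult')
    \<comment> \<open>Any a with \<psi>(a) nonzero and any nonzero b in the non-trivial degree would
      expose the sign; here \<psi>(a) = 1.\<close>
    let ?a = "(hX, 0) :: sweedler \<times> sweedler" and ?b = "(0, hE) :: sweedler \<times> sweedler"
    have b: "?b \<in> grade2 1" by (auto simp: grade2_def incl_def)
    have neg: "\<psi> (?\<pi> (inv\<^bsub>Z2\<^esub> 1) x) = - \<psi> x" for x
    proof -
      have "psi (alpha h) = - psi h" for h by (cases h) simp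
      then show ?thesis by (simp add: \<psi>_def inv_Z2 double_map_def)
    qed
    have neg_slice: "slice_fst (\<lambda>x. - \<psi> x) t = - slice_fst \<psi> t" for t :: "(sweedler \<times> sweedler, sweedler \<times> sweedler) tensor"
    proof -
      have lin: "clinear (\<lambda>x. - \<psi> x)" and lin2: "clinear (\<lambda>t. - slice_fst \<psi> t :: sweedler \<times> sweedler)"
        by (intro clinear_uminus lin_psi clinear_slice_fst)+
      show ?thesis
        by (rule fun_cong[where x = t, OF tensor_ext[OF clinear_slice_fst[OF lin] lin2]])
          (subst slice_fst_tensor[OF lin], subst slice_fst_tensor[OF lin_psi], rule cvec.scale_minus_left)
    qed
    have "\<psi> ?a *\<^sub>C ?b = slice_fst \<psi> (unembed (can1 comult' ?a ?b))"
      using inv unfolding D.right_invariant_iff by metis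
    also have "\<dots> = slice_fst (\<lambda>x. \<psi> (?\<pi> (inv\<^bsub>Z2\<^esub> 1) x)) (unembed (can1 ?\<Delta> ?a ?b))"
      by (rule slice_fst_comult'[OF _ b lin_psi]) simp
    also have "\<dots> = - (\<psi> ?a *\<^sub>C ?b)"
      unfolding neg neg_slice slice ..
    finally have "?b = - ?b"
      by (simp add: \<psi>_def clinear_zero[OF psi_clinear])
    then show False by (simp add: hE_def)
  qed
  ultimately show ?thesis
    using group_Z2 regular cograded admissible deformed_comult_eq by metis
qed

theorem theorem2p11:
  fixes G :: "('g, 'm) monoid_scheme"
    and B :: "'g \<Rightarrow> 'b::nondegenerate_complex_algebra set"
    and \<Delta> \<Delta>' :: "'b \<Rightarrow> ('b, 'b) tensor multiplier"
    and \<epsilon> :: "'b \<Rightarrow> complex"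
    and S :: "'b \<Rightarrow> 'b multiplier"
    and \<pi> :: "'g \<Rightarrow> 'b \<Rightarrow> 'b"
  assumes group: "group G"
    and regular: "regular_multiplier_hopf \<Delta>"
    and cograded: "cograded_multiplier_hopf G B \<Delta>"
    and counit: "is_counit \<Delta> \<epsilon>"
    and antipode: "is_antipode \<Delta> \<epsilon> S"
    and admissible: "admissible_action G B \<Delta> \<pi>"
    and deformed: "\<Delta>' = deformed_comult G B \<pi> \<Delta>"
  shows
    "is_deformed_comult G B \<pi> \<Delta> \<Delta>' \<and>
     \<comment> \<open>(1)\<close>
     regular_multiplier_hopf \<Delta>' \<and>
     (\<forall>\<epsilon>'. is_counit \<Delta>' \<epsilon>' \<longleftrightarrow> \<epsilon>' = \<epsilon>) \<and>
     (\<exists>!S'. is_antipode \<Delta>' \<epsilon> S') \<and>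
     (\<forall>S'. is_antipode \<Delta>' \<epsilon> S' \<longrightarrow>
        (\<forall>p \<in> carrier G. \<forall>b \<in> B p. S' b = mult_map (\<pi> (inv\<^bsub>G\<^esub> p)) (S b))) \<and>
     \<comment> \<open>(2)\<close>
     (\<forall>st. cograded_multiplier_hopf_star st G B \<Delta> \<and>
        (\<forall>p \<in> carrier G. \<forall>b. \<pi> p (st b) = st (\<pi> p b)) \<longrightarrow>
        multiplier_hopf_star st \<Delta>') \<and>
     \<comment> \<open>(3)\<close>
     (\<forall>\<phi>. left_integral \<Delta> \<phi> \<longrightarrow> left_integral \<Delta>' \<phi>) \<and>
     (\<exists>(G0 :: int monoid) (B0 :: int \<Rightarrow> (sweedler \<times> sweedler) set) \<Delta>0 \<pi>0 \<psi>0.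
        group G0 \<and> regular_multiplier_hopf \<Delta>0 \<and> cograded_multiplier_hopf G0 B0 \<Delta>0 \<and>
        admissible_action G0 B0 \<Delta>0 \<pi>0 \<and> right_integral \<Delta>0 \<psi>0 \<and>
        \<not> right_invariant (deformed_comult G0 B0 \<pi>0 \<Delta>0) \<psi>0) \<and>
     (\<forall>\<psi>. right_integral \<Delta> \<psi> \<longrightarrow> right_integral \<Delta>' (deformed_functional G B \<pi> \<psi>)) \<and>
     (\<forall>st. cograded_multiplier_hopf_star st G B \<Delta> \<and>
        (\<forall>p \<in> carrier G. \<forall>b. \<pi> p (st b) = st (\<pi> p b)) \<longrightarrow>
        (\<forall>\<phi>. left_integral \<Delta> \<phi> \<and> positive_functional st \<phi> \<longrightarrow>
           left_integral \<Delta>' \<phi> \<and> positive_functional st \<phi>) \<and>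
        (\<forall>\<psi>. right_integral \<Delta> \<psi> \<and> positive_functional st \<psi> \<longrightarrow>
           right_integral \<Delta>' (deformed_functional G B \<pi> \<psi>) \<and>
           positive_functional st (deformed_functional G B \<pi> \<psi>)))"
proof -
  interpret deformation G B \<Delta> \<pi>
    by (rule deformationI[OF group regular cograded admissible])
  have \<Delta>': "\<Delta>' = comult'"
    unfolding deformed by (rule deformed_comult_eq)
  \<comment> \<open>This equivalence yields both unique existence and the degreewise
    formula.\<close>
  have antipodes: "is_antipode comult' \<epsilon> S' \<longleftrightarrow> S' = antipode' S" for S'
    using is_antipode_comult'[OF counit antipode] antipode_comult'_unique[OF counit antipode] by blast
  have star: "multiplier_hopf_star st comult'"
    and positive: "\<And>f. positive_functional st f \<Longrightarrow> positive_functional st (deformed_functional G B \<pi> f)"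
    if "cograded_multiplier_hopf_star st G B \<Delta> \<and> (\<forall>p \<in> carrier G. \<forall>b. \<pi> p (st b) = st (\<pi> p b))" for st
    using that multiplier_hopf_star_comult'[of st] positive_deformed_functional[of st] by blast+
  show ?thesis
    unfolding \<Delta>'
  proof (intro conjI)
    show "\<exists>!S'. is_antipode comult' \<epsilon> S'"
      "\<forall>S'. is_antipode comult' \<epsilon> S' \<longrightarrow>
        (\<forall>p \<in> carrier G. \<forall>b \<in> B p. S' b = mult_map (\<pi> (inv\<^bsub>G\<^esub> p)) (S b))"
      using antipodes antipode'_homogeneous[OF counit antipode] by auto
    show "\<forall>\<epsilon>'. is_counit comult' \<epsilon>' \<longleftrightarrow> \<epsilon>' = \<epsilon>"
      using counit_comult'_unique[OF counit] by blast
  qed (intro is_deformed_comult' regular_comult' right_integral_not_invariant allI impI conjI;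
      use star positive left_integral_comult' right_integral_comult' in blast)+
qed

end
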